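(* There is an algorithm which, given $n$ and two tours $x,y\in PSBT_n$ (e.g. as successor lists), decides in time polynomial in $n$ (at most $O(n^3)$ operations) whether the vertices $x^v$ and $y^v$ of the polytope $\mathrm{PSB}(n)$ are adjacent.
   Context: Let $n\ge 3$ and let $D_n$ be the complete directed graph on the vertex set (cities) $\{1,\dots,n\}$ with arc set $E=\{(u,v):u\neq v\}$. A Hamiltonian tour is a directed Hamiltonian cycle in $D_n$; for a tour $\tau$, $\tau(i)$ denotes the successor of city $i$, and $\tau^k(i)$, $\tau^{-k}(i)$ denote the $k$-th successor and $k$-th predecessor of $i$. A city $i$ is a peak of $\tau$ if $\tau^{-1}(i)<i$ and $\tau(i)<i$. A city $i$ is a step-back peak of $\tau$ if either ($\tau^{-1}(i)<i$, $\tau(i)=i-1$ and $\tau^2(i)>i$) or ($\tau^{-2}(i)>i$, $\tau^{-1}(i)=i-1$ and $\tau(i)<i$). A proper peak is a peak that is not a step-back peak. A pyramidal tour with step-backs is a Hamiltonian tour whose only proper peak is $n$; $PSBT_n$ denotes the set of all such tours. For a tour $x$, $x^v\in\mathbb{R}^E$ is its characteristic vector ($x^v_e=1$ if arc $e$ belongs to $x$, and $0$ otherwise), and $\mathrm{PSB}(n)=\mathrm{conv}\{x^v: x\in PSBT_n\}$; its vertices are the vectors $x^v$, $x\in PSBT_n$. Two vertices are adjacent if the segment joining them is an edge (one-dimensional face) of $\mathrm{PSB}(n)$. *)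

theory Defs
  imports "HOL-Analysis.Analysis" "HOL-Library.Function_Algebras"
begin

section \<open>Real vector space structure on functions (pointwise), so that R^E can be
  represented by functions on arcs\<close>

instantiation "fun" :: (type, real_vector) real_vector
begin
definition scaleR_fun :: "real \<Rightarrow> ('a \<Rightarrow> 'b) \<Rightarrow> 'a \<Rightarrow> 'b" where
  "scaleR_fun r f = (\<lambda>x. r *\<^sub>R f x)"
instance
  by standard (auto simp: scaleR_fun_def fun_eq_iff scaleR_add_right scaleR_add_left)
end

text \<open>Cities are 1..n. A tour is given by its successor function s, a permutation of
  {1..n} (identity outside) consisting of a single cycle through all cities.\<close>

definition tour :: "nat \<Rightarrow> (nat \<Rightarrow> nat) \<Rightarrow> bool" where
  "tour n s \<longleftrightarrow> s permutes {1..n} \<and>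
     (\<forall>i\<in>{1..n}. {(s ^^ k) i | k. True} = {1..n})"

definition pred_of :: "(nat \<Rightarrow> nat) \<Rightarrow> nat \<Rightarrow> nat" where
  "pred_of s = inv s"

definition peak :: "(nat \<Rightarrow> nat) \<Rightarrow> nat \<Rightarrow> bool" where
  "peak s i \<longleftrightarrow> pred_of s i < i \<and> s i < i"

definition step_back_peak :: "(nat \<Rightarrow> nat) \<Rightarrow> nat \<Rightarrow> bool" where
  "step_back_peak s i \<longleftrightarrow>
     (pred_of s i < i \<and> s i = i - 1 \<and> s (s i) > i) \<or>
     (pred_of s (pred_of s i) > i \<and> pred_of s i = i - 1 \<and> s i < i)"

definition proper_peak :: "(nat \<Rightarrow> nat) \<Rightarrow> nat \<Rightarrow> bool" where
  "proper_peak s i \<longleftrightarrow> peak s i \<and> \<not> step_back_peak s i"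

definition PSBT :: "nat \<Rightarrow> (nat \<Rightarrow> nat) set" where
  "PSBT n = {s. tour n s \<and> (\<forall>i\<in>{1..n}. proper_peak s i \<longleftrightarrow> i = n)}"

text \<open>Arc set E of the complete digraph on {1..n}; vectors of R^E are represented as
  functions on nat \<times> nat vanishing outside E.\<close>

definition arcs :: "nat \<Rightarrow> (nat \<times> nat) set" where
  "arcs n = {(u, v). u \<in> {1..n} \<and> v \<in> {1..n} \<and> u \<noteq> v}"

definition charvec :: "nat \<Rightarrow> (nat \<Rightarrow> nat) \<Rightarrow> (nat \<times> nat \<Rightarrow> real)" where
  "charvec n s = (\<lambda>(u, v). if (u, v) \<in> arcs n \<and> s u = v then 1 else 0)"

definition PSB :: "nat \<Rightarrow> (nat \<times> nat \<Rightarrow> real) set" where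
  "PSB n = convex hull (charvec n ` PSBT n)"

definition adjacent_vertices :: "'a::real_vector set \<Rightarrow> 'a \<Rightarrow> 'a \<Rightarrow> bool" where
  "adjacent_vertices P a b \<longleftrightarrow> a \<noteq> b \<and> closed_segment a b face_of P"

datatype instr =
    Const nat int
  | Add nat nat nat
  | Sub nat nat nat
  | Load nat nat
  | Store nat nat
  | Jz nat nat
  | Halt

type_synonym config = "nat \<times> (nat \<Rightarrow> int)"

definition halted :: "instr list \<Rightarrow> config \<Rightarrow> bool" where
  "halted P c \<longleftrightarrow> fst c \<ge> length P \<or> P ! fst c = Halt"

fun exec :: "instr \<Rightarrow> config \<Rightarrow> config" where
  "exec (Const r k) (pc, m) = (Suc pc, m(r := k))"
| "exec (Add r a b) (pc, m) = (Suc pc, m(r := m a + m b))"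
| "exec (Sub r a b) (pc, m) = (Suc pc, m(r := m a - m b))"
| "exec (Load r a) (pc, m) = (Suc pc, m(r := m (nat (m a))))"
| "exec (Store a b) (pc, m) = (Suc pc, m(nat (m a) := m b))"
| "exec (Jz r l) (pc, m) = (if m r = 0 then l else Suc pc, m)"
| "exec Halt (pc, m) = (pc, m)"

definition step :: "instr list \<Rightarrow> config \<Rightarrow> config" where
  "step P c = (if halted P c then c else exec (P ! fst c) c)"

definition input_mem :: "nat \<Rightarrow> (nat \<Rightarrow> nat) \<Rightarrow> (nat \<Rightarrow> nat) \<Rightarrow> nat \<Rightarrow> int" where
  "input_mem n x y = (\<lambda>j. if j = 0 then int n
                           else if j \<le> n then int (x j)
                           else if j \<le> 2 * n then int (y (j - n))
                           else 0)"

definition decides_within ::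
  "instr list \<Rightarrow> nat \<Rightarrow> (nat \<Rightarrow> int) \<Rightarrow> bool \<Rightarrow> bool" where
  "decides_within P t m0 b \<longleftrightarrow>
     (\<exists>k \<le> t. halted P ((step P ^^ k) (0, m0)) \<and>
              snd ((step P ^^ k) (0, m0)) 0 = (if b then 1 else 0))"

end

theory Submission
  imports Defs
begin

text \<open>
  Let x and y be two tours and let z run through the tours in the support of a convex combination
  lying on the segment between their vertices. Each z takes, at every city, the outgoing arc of x or
  of y, and for any two cities the choices have the same total weight. Hence, whenever one mixed pair
  of choices is impossible, the opposite one is absent from the support as well, so the two choices
  are tied. The ties needed are: two arcs with the same head, two arcs forming a 2-cycle, and the
  incoming and outgoing arcs of a city where one of x, y passes upwards and the other downwards, or
  where one has a peak and the other a valley. Conversely any choice respecting these ties yields a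
  pyramidal tour with step-backs, and so does the complementary choice, so the vertices are
  adjacent iff the ties connect all cities where x and y differ. The program decides this by
  label propagation, n rounds over n cities.
\<close>

section \<open>Local structure of pyramidal tours with step-backs\<close>

text \<open>The complement of a labelling that respects the ties respects them too, and the two
  glued tours have the same vector sum as \<open>x\<close> and \<open>y\<close>. If the labelling
  separates two cities where \<open>x\<close> and \<open>y\<close> differ, a second segment passes
  through the midpoint of the first, which is therefore no face. Gluing is possible because the
  tours have a purely local description. The ties are hard to justify because a mixed tour may
  assemble a step-back from one arc of \<open>x\<close> and one arc of \<open>y\<close>. Such
  step-backs are refuted by counting: across the cut between \<open>k\<close> and
  \<open>k + 1\<close> a tour has a single rising arc, or two if \<open>k \<ge> 2\<close> is a
  valley, and each such valley has a peak directly above it. The machine has no multiplication, no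
  comparison and no unconditional jump, and its input fills the low cells. Hence the power of two as
  stride, the sweeps over the cities in descending order, the cell kept at 0 and the relocation of
  the input before anything else can run.\<close>

definition valley :: "(nat \<Rightarrow> nat) \<Rightarrow> nat \<Rightarrow> bool" where
  "valley s i \<longleftrightarrow> i < inv s i \<and> i < s i"

text \<open>No connectivity is required here: the largest city of any cycle is a peak that is not a step-back
  peak, hence equals n, so there is only one cycle.\<close>

definition psb :: "nat \<Rightarrow> (nat \<Rightarrow> nat) \<Rightarrow> bool" where
  "psb n s \<longleftrightarrow> s permutes {1..n} \<and> (\<forall>i\<in>{1..n}. s i \<noteq> i) \<and>
     (\<forall>i\<in>{1..<n}. peak s i \<longrightarrow> step_back_peak s i)"

lemma psb_permutes: "psb n s \<Longrightarrow> s permutes {1..n}"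
  by (simp add: psb_def)

lemma psb_inv_simps [simp]:
  assumes "psb n s"
  shows "s (inv s i) = i" "inv s (s i) = i"
  using permutes_inverses[OF psb_permutes[OF assms]] by auto

lemma psb_range:
  assumes "psb n s"
  shows "s i \<in> {1..n} \<longleftrightarrow> i \<in> {1..n}" "inv s i \<in> {1..n} \<longleftrightarrow> i \<in> {1..n}"
  using permutes_in_image[OF psb_permutes[OF assms]]
    permutes_in_image[OF permutes_inv[OF psb_permutes[OF assms]]] by auto

lemma psb_bounds:
  assumes "psb n s" "1 \<le> i" "i \<le> n"
  shows "1 \<le> s i" "s i \<le> n" "1 \<le> inv s i" "inv s i \<le> n" "s i \<noteq> i" "inv s i \<noteq> i"
proof -
  have i: "i \<in> {1..n}" using assms by simp
  show "1 \<le> s i" "s i \<le> n" "1 \<le> inv s i" "inv s i \<le> n"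
    using psb_range[OF assms(1), of i] i by auto
  show "s i \<noteq> i" using assms(1) i by (auto simp: psb_def)
  then show "inv s i \<noteq> i" using psb_inv_simps(1)[OF assms(1), of i] by metis
qed

lemma psb_peak:
  assumes "psb n s" "1 \<le> i" "i < n" "inv s i < i" "s i < i"
  shows "(Suc (s i) = i \<and> i < s (s i)) \<or> (Suc (inv s i) = i \<and> i < inv s (inv s i))"
  using assms unfolding psb_def peak_def step_back_peak_def pred_of_def
  by (metis Suc_diff_1 atLeastLessThan_iff less_le_trans zero_less_one)

lemma psb_closed_set_top:
  assumes s: "psb n s" and S: "S \<subseteq> {1..n}" "S \<noteq> {}" "s ` S \<subseteq> S"
  shows "n \<in> S"
proof -
  have fin: "finite S" using S(1) finite_subset by blast
  have inj: "inj_on s S" using permutes_inj[OF psb_permutes[OF s]] by (simp add: inj_on_def inj_def)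
  have img: "s ` S = S" using endo_inj_surj[OF fin S(3) inj] .
  define M where "M = Max S"
  have M: "M \<in> S" and Mmax: "\<And>j. j \<in> S \<Longrightarrow> j \<le> M"
    using fin S(2) by (auto simp: M_def)
  have invS: "inv s j \<in> S" if j: "j \<in> S" for j
  proof -
    from j img obtain k where "k \<in> S" "j = s k" by blast
    then show ?thesis using psb_inv_simps(2)[OF s] by simp
  qed
  have sS: "s j \<in> S" if "j \<in> S" for j using S(3) that by blast
  have Mr: "1 \<le> M" "M \<le> n" using M S(1) by auto
  have lt: "s M < M" "inv s M < M"
    using Mmax[OF sS[OF M]] Mmax[OF invS[OF M]] psb_bounds[OF s Mr] by auto
  have "M = n"
  proof (rule ccontr)
    assume "M \<noteq> n"
    then have "M < n" using Mr by simp
    from psb_peak[OF s Mr(1) this lt(2,1)] Mmax[OF sS[OF sS[OF M]]] Mmax[OF invS[OF invS[OF M]]]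
    show False by auto
  qed
  then show ?thesis using M by simp
qed

text \<open>\<open>s\<close> permutes \<open>{1..n}\<close>, so the complement of \<open>S\<close>
  is closed as well; if both were nonempty, both would contain \<open>n\<close>.\<close>

lemma psb_closed_set:
  assumes s: "psb n s" and S: "S \<subseteq> {1..n}" "S \<noteq> {}" "s ` S \<subseteq> S"
  shows "S = {1..n}"
proof (rule ccontr)
  assume ne: "S \<noteq> {1..n}"
  let ?T = "{1..n} - S"
  have fin: "finite S" using S(1) finite_subset by blast
  have inj: "inj s" using permutes_inj[OF psb_permutes[OF s]] .
  have img: "s ` S = S" using endo_inj_surj[OF fin S(3)] inj by (simp add: inj_on_def inj_def)
  have "s ` ?T \<subseteq> ?T"
  proof
    fix k assume "k \<in> s ` ?T"
    then obtain j where j: "j \<in> {1..n}" "j \<notin> S" "k = s j" by blast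
    have "k \<notin> S"
    proof
      assume "k \<in> S"
      then obtain j' where "j' \<in> S" "k = s j'" using img by blast
      then show False using j inj by (auto simp: inj_def)
    qed
    moreover have "k \<in> {1..n}" using j psb_range(1)[OF s, of j] by auto
    ultimately show "k \<in> ?T" by blast
  qed
  then have "n \<in> ?T" using psb_closed_set_top[OF s, of ?T] ne S(1) by blast
  moreover have "n \<in> S" using psb_closed_set_top[OF s S] .
  ultimately show False by blast
qed

lemma psb_no_2_cycle:
  assumes s: "psb n s" and n: "3 \<le> n" and i: "i \<in> {1..n}"
  shows "s (s i) \<noteq> i"
proof
  assume eq: "s (s i) = i"
  have "{i, s i} = {1..n}"
    using psb_closed_set[OF s, of "{i, s i}"] i psb_range(1)[OF s, of i] eq by auto
  moreover have "card {i, s i} \<le> 2" by (simp add: card_insert_if)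
  ultimately show False using n by simp
qed

text \<open>Trades the global single-cycle condition for conditions that can be checked city by city
  on a mixture of two tours. Each orbit is a closed set and hence everything; that \<open>n\<close>
  is a proper peak is automatic, since a step-back peak has a city above it.\<close>

lemma PSBT_iff_psb:
  assumes "2 \<le> n"
  shows "s \<in> PSBT n \<longleftrightarrow> psb n s"
proof
  assume "s \<in> PSBT n"
  then have t: "tour n s" and p: "\<And>i. i \<in> {1..n} \<Longrightarrow> proper_peak s i \<longleftrightarrow> i = n"
    by (auto simp: PSBT_def)
  have "s i \<noteq> i" if i: "i \<in> {1..n}" for i
  proof
    assume "s i = i"
    then have "(s ^^ k) i = i" for k by (induction k) auto
    moreover have "{1..n} = {(s ^^ k) i | k. True}" using t i unfolding tour_def by blast
    ultimately have "{1..n} = {i}" by auto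
    then have "card {1..n} = card {i}" by simp
    then show False using assms by simp
  qed
  moreover have "peak s i \<longrightarrow> step_back_peak s i" if "i \<in> {1..<n}" for i
    using p[of i] that by (auto simp: proper_peak_def)
  ultimately show "psb n s" using t by (simp add: psb_def tour_def)
next
  assume s: "psb n s"
  have "{(s ^^ k) i | k. True} = {1..n}" if i: "i \<in> {1..n}" for i
  proof (rule psb_closed_set[OF s])
    have "(s ^^ k) i \<in> {1..n}" for k
    proof (induction k)
      case (Suc k)
      then show ?case using psb_range(1)[OF s, of "(s ^^ k) i"] by simp
    qed (use i in simp)
    then show "{(s ^^ k) i | k. True} \<subseteq> {1..n}" by blast
    show "s ` {(s ^^ k) i | k. True} \<subseteq> {(s ^^ k) i | k. True}"
    proof
      fix v assume "v \<in> s ` {(s ^^ k) i | k. True}"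
      then obtain k where "v = s ((s ^^ k) i)" by blast
      then have "v = (s ^^ Suc k) i" by simp
      then show "v \<in> {(s ^^ k) i | k. True}" by blast
    qed
  qed blast
  then have t: "tour n s" using psb_permutes[OF s] unfolding tour_def by blast
  have b: "s i \<le> n" "inv s i \<le> n" if "1 \<le> i" "i \<le> n" for i
    using psb_bounds[OF s that] by auto
  have nb: "1 \<le> s n" "s n < n" "1 \<le> inv s n" "inv s n < n"
    using psb_bounds[OF s, of n] assms by auto
  have "proper_peak s n"
    using nb b[of "s n"] b[of "inv s n"]
    by (auto simp: proper_peak_def peak_def step_back_peak_def pred_of_def)
  moreover have "\<not> proper_peak s i" if "i \<in> {1..n}" "i \<noteq> n" for i
    using s that by (auto simp: proper_peak_def psb_def)
  ultimately have "\<forall>i\<in>{1..n}. proper_peak s i \<longleftrightarrow> i = n" by blast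
  then show "s \<in> PSBT n" using t by (simp add: PSBT_def)
qed

text \<open>Reversal swaps the two disjuncts of \<open>step_back_peak\<close>. Arguments about the
  path up thus carry over to the path back.\<close>

lemma psb_inv:
  assumes s: "psb n s"
  shows "psb n (inv s)"
proof -
  have ii: "inv (inv s) = s" using permutes_inv_inv[OF psb_permutes[OF s]] .
  have "peak (inv s) i \<longleftrightarrow> peak s i" "step_back_peak (inv s) i \<longleftrightarrow> step_back_peak s i" for i
    by (auto simp: peak_def step_back_peak_def pred_of_def ii)
  then show ?thesis
    using s permutes_inv[OF psb_permutes[OF s]] psb_bounds(6)[OF s] by (auto simp: psb_def)
qed

section \<open>Peaks, valleys and step-backs\<close>

lemma card_peaks_eq_card_valleys:
  assumes s: "psb n s"
  shows "card {i\<in>{1..n}. inv s i < i \<and> s i < i} = card {i\<in>{1..n}. valley s i}"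
proof -
  let ?B = "{i\<in>{1..n}. inv s i < i}" and ?A = "{i\<in>{1..n}. i < s i}"
    and ?AB = "{i\<in>{1..n}. inv s i < i \<and> i < s i}"
  \<comment> \<open>A rising arc leaves a city of \<open>?A\<close> and enters one of
    \<open>?B\<close>. Discarding the cities passed upwards, which are in both sets, leaves the
    valleys and the peaks.\<close>
  have "bij_betw s ?A ?B"
    by (rule bij_betw_byWitness[where f' = "inv s"])
      (use psb_bounds[OF s] psb_inv_simps[OF s] in \<open>auto simp: image_iff\<close>)
  then have AB: "card ?A = card ?B" by (rule bij_betw_same_card)
  have ne: "s i \<noteq> i" "inv s i \<noteq> i" if "i \<in> {1..n}" for i
    using psb_bounds[OF s, of i] that by auto
  have "{i\<in>{1..n}. inv s i < i \<and> s i < i} = ?B - ?AB" 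
  proof (rule set_eqI)
    fix i show "i \<in> {i\<in>{1..n}. inv s i < i \<and> s i < i} \<longleftrightarrow> i \<in> ?B - ?AB"
      using ne(1)[of i] by (cases "i \<in> {1..n}") auto
  qed
  then have 1: "card {i\<in>{1..n}. inv s i < i \<and> s i < i} = card ?B - card ?AB"
    by (simp add: card_Diff_subset subset_iff)
  have "{i\<in>{1..n}. valley s i} = ?A - ?AB" 
  proof (rule set_eqI)
    fix i show "i \<in> {i\<in>{1..n}. valley s i} \<longleftrightarrow> i \<in> ?A - ?AB"
      using ne(2)[of i] by (cases "i \<in> {1..n}") (auto simp: valley_def)
  qed
  then have 2: "card {i\<in>{1..n}. valley s i} = card ?A - card ?AB"
    by (simp add: card_Diff_subset subset_iff)
  show ?thesis using 1 2 AB by simp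
qed

text \<open>Each peak below \<open>n\<close> sits directly above the valley of its step-back, and 1
  is a valley, left over for the peak \<open>n\<close>. This embeds the peaks into the valleys, and
  by equal cardinality every valley is hit.\<close>

lemma psb_valley_Suc_peak:
  assumes s: "psb n s" and n: "3 \<le> n" and i: "2 \<le> i" "i \<le> n" "valley s i"
  shows "Suc i < n \<and> inv s (Suc i) < Suc i \<and> s (Suc i) < Suc i"
proof -
  let ?P = "{i\<in>{1..n}. inv s i < i \<and> s i < i}" and ?V = "{i\<in>{1..n}. valley s i}"
  define g where "g i = (if i = n then 1 else i - 1)" for i
  \<comment> \<open>A peak at 2 would have 1 on both sides, a 2-cycle. Hence the valleys
    \<open>j - 1\<close> are at least 2 and do not collide with 1, the image of
    \<open>n\<close>.\<close>
  have ge: "3 \<le> j" if j: "j \<in> ?P" "j \<noteq> n" for j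
  proof (rule ccontr)
    assume "\<not> 3 \<le> j"
    moreover have "1 \<le> s j" using psb_bounds[OF s, of j] j by auto
    ultimately have j2: "j = 2" "s j = 1" "inv s j = 1"
      using j psb_bounds[OF s, of j] by auto
    then have "s (s j) = j" using psb_inv_simps(1)[OF s, of j] by simp
    then show False using psb_no_2_cycle[OF s n, of j] j by auto
  qed
  have inj: "inj_on g ?P"
  proof (rule inj_onI)
    fix a b assume a: "a \<in> ?P" and b: "b \<in> ?P" and eq: "g a = g b"
    show "a = b" using eq ge[OF a] ge[OF b] unfolding g_def by (auto split: if_splits)
  qed
  have gV: "g j \<in> ?V" if j: "j \<in> ?P" for j
  proof (cases "j = n")
    case True
    have b1: "1 \<le> s 1" "s 1 \<le> n" "1 \<le> inv s 1" "inv s 1 \<le> n" "s 1 \<noteq> 1" "inv s 1 \<noteq> 1"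
      using psb_bounds[OF s, of 1] n by auto
    then have "valley s 1" unfolding valley_def by linarith
    then show ?thesis using True n by (simp add: g_def)
  next
    case False
    then have jn: "j < n" "1 \<le> j" using j by auto
    consider "Suc (s j) = j" "j < s (s j)" | "Suc (inv s j) = j" "j < inv s (inv s j)"
      using psb_peak[OF s jn(2,1)] j by auto
    then have "valley s (j - 1)"
    proof cases
      case 1
      then have "j - 1 = s j" by simp
      then show ?thesis using 1 psb_inv_simps[OF s] by (simp add: valley_def)
    next
      case 2
      then have "j - 1 = inv s j" by simp
      then show ?thesis using 2 psb_inv_simps[OF s] by (simp add: valley_def)
    qed
    then show ?thesis using False ge[OF j False] j by (auto simp: g_def)
  qed
  have "g ` ?P = ?V"
  proof (rule card_subset_eq)
    show "card (g ` ?P) = card ?V"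
      using card_image[OF inj] card_peaks_eq_card_valleys[OF s] by simp
  qed (use gV in auto)
  moreover have "i \<in> ?V" using i by simp
  ultimately obtain j where j: "j \<in> ?P" "i = g j" by blast
  then have "j \<noteq> n" using i by (auto simp: g_def)
  then have "j = Suc i" using j ge[OF j(1)] by (simp add: g_def)
  then show ?thesis using j \<open>j \<noteq> n\<close> by auto
qed

text \<open>Whether a city lies on the path from 1 up to n (as opposed to the path back), read off from its two
  neighbours only; meaningful for the cities strictly between 1 and n.\<close>

definition up_side :: "(nat \<Rightarrow> nat) \<Rightarrow> nat \<Rightarrow> bool" where
  "up_side s i \<longleftrightarrow> (if inv s i < i then \<not> (Suc (inv s i) = i \<and> s i < i)
                    else inv s i = Suc i \<and> i < s i)"

section \<open>Cities on the path up and on the path back\<close>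

lemma psb_peak_pred_valley:
  assumes s: "psb n s" and n: "3 \<le> n" and i: "1 \<le> i" "i < n" "inv s i < i" "s i < i"
  shows "3 \<le> i \<and> valley s (i - 1)"
proof -
  have "3 \<le> i"
  proof (rule ccontr)
    assume "\<not> 3 \<le> i"
    moreover have "1 \<le> s i" "1 \<le> inv s i" using psb_bounds[OF s, of i] i by auto
    ultimately have "i = 2" "s i = 1" "inv s i = 1" using i by auto
    then show False
      using psb_no_2_cycle[OF s n, of i] psb_inv_simps(1)[OF s, of i] i by auto
  qed
  moreover have "valley s (i - 1)"
    using psb_peak[OF s i]
  proof
    assume *: "Suc (s i) = i \<and> i < s (s i)"
    then have "i - 1 = s i" by arith
    then show ?thesis using * psb_inv_simps[OF s] by (simp add: valley_def)
  next
    assume *: "Suc (inv s i) = i \<and> i < inv s (inv s i)"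
    then have "i - 1 = inv s i" by arith
    then show ?thesis using * psb_inv_simps[OF s] by (simp add: valley_def)
  qed
  ultimately show ?thesis ..
qed

text \<open>On the path up, \<open>i\<close> is passed plainly, or it is the upper or the lower city
  of a step-back; the last three cases are the reversals of these. The cases \<open>UV\<close> and
  \<open>DV\<close> rest on the peak directly above a valley.\<close>

lemma psb_city_cases [consumes 4, case_names U UP UV D DP DV]:
  assumes s: "psb n s" and n: "3 \<le> n" and i: "2 \<le> i" "i < n"
  obtains
    "up_side s i" "inv s i < i" "i < s i"
  | "up_side s i" "Suc (inv s i) < i" "Suc (s i) = i" "i < s (s i)"
  | "up_side s i" "inv s i = Suc i" "Suc i < s i" "inv s (Suc i) < i" "Suc i < n"
  | "\<not> up_side s i" "s i < i" "i < inv s i"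
  | "\<not> up_side s i" "Suc (s i) < i" "Suc (inv s i) = i" "i < inv s (inv s i)"
  | "\<not> up_side s i" "s i = Suc i" "Suc i < inv s i" "s (Suc i) < i" "Suc i < n"
proof -
  note si = psb_inv_simps[OF s]
  have ne: "s i \<noteq> i" "inv s i \<noteq> i" using psb_bounds[OF s, of i] i by auto
  consider "inv s i < i" "i < s i" | "s i < i" "i < inv s i" | "inv s i < i" "s i < i" | "valley s i"
    using ne unfolding valley_def by linarith
  then show thesis
  proof cases
    case 1 then show thesis using that(1) by (simp add: up_side_def)
  next
    case 2 then show thesis using that(4) by (simp add: up_side_def)
  next
    case 3
    have "1 \<le> i" using i by simp
    from psb_peak[OF s this i(2) 3] show thesis
    proof
      assume *: "Suc (s i) = i \<and> i < s (s i)"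
      have "inv s i \<noteq> s i" using * si by (metis less_irrefl)
      then have "Suc (inv s i) < i" using 3 * by linarith
      then show thesis using that(2) * 3 by (simp add: up_side_def)
    next
      assume *: "Suc (inv s i) = i \<and> i < inv s (inv s i)"
      have "inv s i \<noteq> s i" using * si by (metis less_irrefl)
      then have "Suc (s i) < i" using 3 * by linarith
      then show thesis using that(5) * 3 by (simp add: up_side_def)
    qed
  next
    case 4
    then have v: "i < inv s i" "i < s i" by (auto simp: valley_def)
    have P: "Suc i < n" "inv s (Suc i) < Suc i" "s (Suc i) < Suc i"
      using psb_valley_Suc_peak[OF s n, of i] i 4 by auto
    have "1 \<le> Suc i" by simp
    from psb_peak[OF s this P] show thesis
    proof
      assume *: "Suc (s (Suc i)) = Suc i \<and> Suc i < s (s (Suc i))"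
      then have a: "s (Suc i) = i" "Suc i < s i" by auto
      have b: "inv s i = Suc i" using si(2)[of "Suc i"] a by simp
      have "inv s (Suc i) \<noteq> i" using a si(1)[of "Suc i"] by auto
      then show thesis using that(3) a b P by (simp add: up_side_def)
    next
      assume *: "Suc (inv s (Suc i)) = Suc i \<and> Suc i < inv s (inv s (Suc i))"
      then have a: "inv s (Suc i) = i" "Suc i < inv s i" by auto
      have b: "s i = Suc i" using si(1)[of "Suc i"] a by simp
      have "s (Suc i) \<noteq> i" using a si(2)[of "Suc i"] by auto
      then show thesis using that(6) a b P by (simp add: up_side_def)
    qed
  qed
qed

lemma up_side_inv:
  assumes s: "psb n s" and n: "3 \<le> n" and i: "2 \<le> i" "i < n"
  shows "up_side (inv s) i \<longleftrightarrow> \<not> up_side s i"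
proof -
  have ii: "inv (inv s) = s" using permutes_inv_inv[OF psb_permutes[OF s]] .
  from s n i show ?thesis by (cases rule: psb_city_cases) (auto simp: up_side_def ii)
qed

section \<open>Arcs rising across a cut\<close>

lemma card_up_arcs_across:
  assumes s: "psb n s" and n: "3 \<le> n"
  shows "1 \<le> k \<Longrightarrow> k < n \<Longrightarrow>
    card {u\<in>{1..k}. k < s u} = (if 2 \<le> k \<and> valley s k then 2 else 1)"
proof (induction k rule: nat_induct_at_least)
  case base
  have "s 1 \<noteq> 1" "1 \<le> s 1" using psb_bounds[OF s, of 1] n by auto
  then have "{u\<in>{1..1}. 1 < s u} = {1}" by auto
  then show ?case by simp
next
  case (Suc k)
  let ?U = "{u\<in>{1..k}. k < s u}" and ?W = "{u\<in>{1..Suc k}. Suc k < s u}"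
  let ?p = "inv s (Suc k)"
  have pb: "1 \<le> ?p" "?p \<noteq> Suc k" using psb_bounds[OF s, of "Suc k"] Suc by auto
  \<comment> \<open>Moving the cut past \<open>k + 1\<close> removes the arc into
    \<open>k + 1\<close> if it rises and adds the arc out of it if that one rises. The count thus
    grows at valleys and falls at peaks, and the growth at a valley \<open>k \<ge> 2\<close> is
    undone by the peak \<open>k + 1\<close>.\<close>
  have W: "?W = (?U - {?p}) \<union> (if Suc k < s (Suc k) then {Suc k} else {})"
  proof (rule set_eqI)
    fix u
    have "s u = Suc k \<longleftrightarrow> u = ?p" using psb_inv_simps[OF s] by metis
    then show "u \<in> ?W \<longleftrightarrow> u \<in> (?U - {?p}) \<union> (if Suc k < s (Suc k) then {Suc k} else {})"
      by (auto simp: le_Suc_eq)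
  qed
  have pU: "?p \<in> ?U \<longleftrightarrow> ?p < Suc k" using pb psb_inv_simps[OF s] by auto
  have c1: "card (?U - {?p}) = card ?U - (if ?p < Suc k then 1 else 0)"
    using pU by (simp add: card_Diff_singleton_if)
  have "card ?W = card (?U - {?p}) + (if Suc k < s (Suc k) then 1 else 0)"
    unfolding W by (simp add: card_insert_if)
  then have cW: "card ?W = card ?U - (if ?p < Suc k then 1 else 0) + (if Suc k < s (Suc k) then 1 else 0)"
    using c1 by simp
  have IH: "card ?U = (if 2 \<le> k \<and> valley s k then 2 else 1)" using Suc by simp
  have ne: "s (Suc k) \<noteq> Suc k" using psb_bounds[OF s, of "Suc k"] Suc by auto
  have "?p < Suc k \<and> s (Suc k) < Suc k \<longleftrightarrow> 2 \<le> k \<and> valley s k"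
    using psb_peak_pred_valley[OF s n, of "Suc k"] psb_valley_Suc_peak[OF s n, of k] Suc by auto
  then show ?case
    unfolding cW IH using ne pb Suc.hyps by (auto simp: valley_def)
qed

lemma two_up_arcs_valley:
  assumes s: "psb n s" and n: "3 \<le> n" and k: "k < n"
    and u: "1 \<le> u" "u \<le> k" "k < s u" and v: "1 \<le> v" "v \<le> k" "k < s v" and "u \<noteq> v"
  shows "2 \<le> k \<and> valley s k"
proof -
  have "card {u, v} \<le> card {u\<in>{1..k}. k < s u}" by (rule card_mono) (use u v in auto)
  then show ?thesis
    using card_up_arcs_across[OF s n, of k] k u \<open>u \<noteq> v\<close> by (auto split: if_splits)
qed

text \<open>The step-back itself accounts for both rising arcs that the cut can have: the one
  leaving \<open>k\<close> and the one entering \<open>k + 1\<close>.\<close>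

lemma up_arcs_across_step_back:
  assumes s: "psb n s" and n: "3 \<le> n" and k: "2 \<le> k" "k < n" "inv s k = Suc k" "k < s k"
    and u: "1 \<le> u" "u \<le> k" "k < s u"
  shows "u = k \<or> s u = Suc k"
proof (rule ccontr)
  assume *: "\<not> ?thesis"
  have "valley s k" using k by (simp add: valley_def)
  then have P: "inv s (Suc k) < Suc k" "Suc k < n"
    using psb_valley_Suc_peak[OF s n, of k] k by auto
  let ?p = "inv s (Suc k)"
  have sk: "s (Suc k) = k" using k psb_inv_simps(1)[OF s, of k] by simp
  have "?p \<noteq> k"
  proof
    assume "?p = k"
    then have "s (s k) = k" using psb_inv_simps(1)[OF s, of "Suc k"] sk by simp
    then show False using psb_no_2_cycle[OF s n, of k] k by auto
  qed
  moreover have "1 \<le> ?p" using psb_bounds[OF s, of "Suc k"] P by auto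
  moreover have "s ?p = Suc k" using psb_inv_simps(1)[OF s] .
  moreover have "u \<noteq> ?p" using * psb_inv_simps(1)[OF s, of "Suc k"] by auto
  ultimately have d: "card {u, k, ?p} = 3" "{u, k, ?p} \<subseteq> {u\<in>{1..k}. k < s u}"
    using * u k P by auto
  have "card {u, k, ?p} \<le> card {u\<in>{1..k}. k < s u}" by (rule card_mono) (use d in auto)
  then show False using d card_up_arcs_across[OF s n, of k] k by (auto split: if_splits)
qed

text \<open>\<open>z\<close> must rise across \<open>i\<close> from some \<open>u < i\<close>.
  Because of their step-backs, every arc of \<open>x\<close> rising across \<open>i - 1\<close>
  starts at \<open>i - 1\<close> or ends at \<open>i\<close>, and every arc of \<open>y\<close>
  rising across \<open>i\<close> starts at \<open>i\<close> or ends at \<open>i + 1\<close>. None of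
  these is available to \<open>z\<close>.\<close>

lemma no_reversed_run:
  assumes x: "psb n x" and y: "psb n y" and z: "psb n z" and n: "3 \<le> n"
    and zxy: "\<And>u. z u = x u \<or> z u = y u" and i: "2 \<le> i" "i < n"
    and up: "up_side x i" "up_side y i"
    and xi: "Suc (x i) = i" and yi: "inv y i = Suc i"
    and zi: "Suc (z i) = i" and zSi: "z (Suc i) = i"
  shows False
proof -
  have X: "Suc (inv x i) < i" "i < x (x i)"
    using x n i by (cases rule: psb_city_cases; use xi up in auto)+
  have Y: "i < y i" using y n i by (cases rule: psb_city_cases) (use yi up in auto)
  define j where "j = i - 1"
  have j: "x i = j" "z i = j" "Suc j = i" using xi zi i by (auto simp: j_def)
  have jr: "2 \<le> j" "j < n"
  proof -
    have "1 \<le> inv x i" using psb_bounds[OF x, of i] i by auto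
    then show "2 \<le> j" using X j by linarith
  qed (use i j in auto)
  have zSi': "inv z i = Suc i" using zSi psb_inv_simps(2)[OF z, of "Suc i"] by simp
  have "card {u\<in>{1..i}. i < z u} \<noteq> 0" using card_up_arcs_across[OF z n, of i] i by auto
  then obtain u where u: "1 \<le> u" "u \<le> i" "i < z u" by (auto simp: card_eq_0_iff)
  have "u \<noteq> i" using u j by auto
  then have ui: "u < i" using u by simp
  \<comment> \<open>Otherwise \<open>i + 1\<close> would be a peak of \<open>z\<close>, entered from
    below \<open>i\<close> and followed by two falling arcs, so without a step-back.\<close>
  have zu: "z u \<noteq> Suc i"
  proof
    assume a: "z u = Suc i"
    then have b: "inv z (Suc i) = u" using psb_inv_simps(2)[OF z, of u] by simp
    have "Suc i < n"
    proof (rule ccontr)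
      assume "\<not> Suc i < n"
      then have "n = Suc i" using i by simp
      then have "y i = Suc i" using Y psb_bounds[OF y, of i] i by simp
      then show False
        using psb_inv_simps(1)[OF y, of i] yi psb_no_2_cycle[OF y n, of i] i by auto
    qed
    with psb_peak[OF z, of "Suc i"] b zSi ui zi show False
      using psb_inv_simps[OF z] by auto
  qed
  \<comment> \<open>Otherwise \<open>i - 1\<close> would be a valley of \<open>z\<close>, while
    \<open>i\<close>, which should then be a peak, is entered from above.\<close>
  have uj: "u \<noteq> j"
  proof
    assume "u = j"
    then have "valley z j" using u j psb_inv_simps(2)[OF z, of i] by (auto simp: valley_def)
    then show False using psb_valley_Suc_peak[OF z n, of j] jr j zSi' by auto
  qed
  from zxy[of u] show False
  proof
    assume a: "z u = x u"
    have "inv x j = Suc j" using j psb_inv_simps(2)[OF x, of i] by simp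
    from up_arcs_across_step_back[OF x n jr this, of u] show False
      using X u uj ui a j by auto
  next
    assume a: "z u = y u"
    from up_arcs_across_step_back[OF y n i yi Y, of u] show False
      using u a zu ui by auto
  qed
qed

section \<open>Tours supported on the union of two tours\<close>

text \<open>The properties of the support of a convex combination on the segment that the argument uses. The last
  one expresses that the choices of x at u and at v carry the same weight.\<close>

definition mixing :: "nat \<Rightarrow> (nat \<Rightarrow> nat) \<Rightarrow> (nat \<Rightarrow> nat) \<Rightarrow> (nat \<Rightarrow> nat) set \<Rightarrow> bool" where
  "mixing n x y Z \<longleftrightarrow> 3 \<le> n \<and> psb n x \<and> psb n y \<and>
     (\<forall>z\<in>Z. psb n z \<and> (\<forall>u. z u = x u \<or> z u = y u)) \<and>
     (\<forall>u v. x u \<noteq> y u \<longrightarrow> x v \<noteq> y v \<longrightarrow> (\<exists>z\<in>Z. z u = x u \<and> z v = y v) \<longrightarrow>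
        (\<exists>z\<in>Z. z u = y u \<and> z v = x v))"

lemma mixingD:
  assumes "mixing n x y Z"
  shows "3 \<le> n" "psb n x" "psb n y" "z \<in> Z \<Longrightarrow> psb n z" "z \<in> Z \<Longrightarrow> z u = x u \<or> z u = y u"
  using assms by (auto simp: mixing_def)

lemma mixing_exchange:
  assumes "mixing n x y Z" "x u \<noteq> y u" "x v \<noteq> y v" "z \<in> Z" "z u = x u" "z v = y v"
  obtains z' where "z' \<in> Z" "z' u = y u" "z' v = x v"
  using assms unfolding mixing_def by blast

lemma mixing_commute:
  assumes "mixing n x y Z"
  shows "mixing n y x Z"
proof -
  have "\<exists>z\<in>Z. z u = x u \<and> z v = y v"
    if "x u \<noteq> y u" "x v \<noteq> y v" "\<exists>z\<in>Z. z u = y u \<and> z v = x v" for u v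
    using that mixing_exchange[OF assms, of v u] by metis
  moreover have "\<forall>z\<in>Z. psb n z \<and> (\<forall>u. z u = y u \<or> z u = x u)"
    using mixingD(4,5)[OF assms] by blast
  ultimately show ?thesis
    using mixingD(1-3)[OF assms] unfolding mixing_def by (intro conjI allI impI) simp_all
qed

lemma mixing_pred:
  assumes m: "mixing n x y Z" and z: "z \<in> Z"
  shows "inv z v = inv x v \<or> inv z v = inv y v"
    and "inv z v = inv x v \<longleftrightarrow> z (inv x v) = v"
proof -
  note si = psb_inv_simps[OF mixingD(2)[OF m]] psb_inv_simps[OF mixingD(3)[OF m]]
    psb_inv_simps[OF mixingD(4)[OF m z]]
  show "inv z v = inv x v \<or> inv z v = inv y v"
    using mixingD(5)[OF m z, of "inv z v"] si by metis
  show "inv z v = inv x v \<longleftrightarrow> z (inv x v) = v"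
    using si by metis
qed

text \<open>Taking the arc of \<open>x\<close> into \<open>i\<close> means taking the arc of
  \<open>x\<close> out of \<open>inv x i\<close>, so the exchange between two cities becomes one
  between the two mixed passages of a single city.\<close>

lemma mixing_exchange_at:
  assumes m: "mixing n x y Z" and ne: "x i \<noteq> y i" "inv x i \<noteq> inv y i"
    and z: "z \<in> Z" "inv z i = inv x i" "z i = y i"
  obtains z' where "z' \<in> Z" "inv z' i = inv y i" "z' i = x i"
proof -
  note sx = psb_inv_simps[OF mixingD(2)[OF m]] and sy = psb_inv_simps[OF mixingD(3)[OF m]]
  let ?a = "inv x i"
  have a: "x ?a = i" "y ?a \<noteq> i" using sx sy ne by metis+
  have "z ?a = x ?a" using mixing_pred(2)[OF m z(1)] z(2) a by simp
  then obtain z' where z': "z' \<in> Z" "z' ?a = y ?a" "z' i = x i"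
    using mixing_exchange[OF m, of ?a i z] a ne z by metis
  then show ?thesis using that mixing_pred[OF m z'(1), of i] a by auto
qed

text \<open>Every peak or valley in this range is part of a step-back and so has a neighbour at
  distance one.\<close>

lemma psb_not_turn:
  assumes s: "psb n s" and n: "3 \<le> n" and i: "2 \<le> i" "i < n"
  shows "Suc (inv s i) < i \<Longrightarrow> Suc (s i) < i \<Longrightarrow> False"
    and "Suc i < inv s i \<Longrightarrow> Suc i < s i \<Longrightarrow> False"
  using s n i by (cases rule: psb_city_cases; simp)+

text \<open>By exchange both mixed choices at i occur in the support. Usually one of them creates a turn that is
  not part of a step-back; the only other case is that of overlapping step-backs of x and y on
  opposite sides, where one of the two mixed tours also mixes at i - 1.\<close>

lemma pure_at_of_sides_differ:
  "mixing n x y Z \<Longrightarrow> 2 \<le> i \<Longrightarrow> i < n \<Longrightarrow> up_side x i \<noteq> up_side y i \<Longrightarrow>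
    x i \<noteq> y i \<Longrightarrow> inv x i \<noteq> inv y i \<Longrightarrow> z \<in> Z \<Longrightarrow> inv z i = inv x i \<Longrightarrow> z i = y i \<Longrightarrow> False"
proof (induction i arbitrary: x y z rule: less_induct)
  case (less i)
  \<comment> \<open>By symmetry \<open>x\<close> may be taken on the path up. \<open>z1\<close> and
    \<open>z2\<close> realise the two mixed passages at \<open>i\<close>; in each case one of them
    is refuted.\<close>
  have main: False
    if m: "mixing n x y Z"
      and i: "2 \<le> i" "i < n" and ux: "up_side x i" and uy: "\<not> up_side y i"
      and ne: "x i \<noteq> y i" "inv x i \<noteq> inv y i"
      and z1: "z1 \<in> Z" "inv z1 i = inv x i" "z1 i = y i"
      and z2: "z2 \<in> Z" "inv z2 i = inv y i" "z2 i = x i"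
    for x y z1 z2
  proof -
    note D = mixingD[OF m]
    note n = D(1) and x = D(2) and y = D(3)
    note p1 = D(4)[OF z1(1)] and p2 = D(4)[OF z2(1)]
    note si = psb_inv_simps[OF x] psb_inv_simps[OF y] psb_inv_simps[OF p1] psb_inv_simps[OF p2]
    note t1 = psb_not_turn[OF p1 n i, unfolded z1(2,3)]
    note t2 = psb_not_turn[OF p2 n i, unfolded z2(2,3)]
    have i1: "1 \<le> i" using i by simp
    have xb: "1 \<le> inv x i" "1 \<le> y i" using psb_bounds[OF x, of i] psb_bounds[OF y, of i] i by auto
    show False
      using y n i
    proof (cases rule: psb_city_cases)
      case yD: D
      show False using x n i
      proof (cases rule: psb_city_cases)
        case xU: U
        \<comment> \<open>Both tours pass \<open>i\<close> straight, so neither has the peak at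
          \<open>i\<close> that a valley at \<open>i - 1\<close> would force.\<close>
        have nv: "\<not> valley x j" "\<not> valley y j" if "2 \<le> j" "Suc j = i" for j
          using psb_valley_Suc_peak[OF x n, of j] psb_valley_Suc_peak[OF y n, of j]
            that i xU yD by auto
        have two: "z1 (inv x i) = i" using z1(2) psb_inv_simps(1)[OF p1, of i] by simp
        have two': "inv z1 (y i) = i" using z1(3) psb_inv_simps(2)[OF p1, of i] by simp
        have "inv z1 i < i" "z1 i < i" using z1 xU yD by auto
        \<comment> \<open>The peak of \<open>z1\<close> at \<open>i\<close> needs a step-back
          through \<open>i - 1\<close>. If its far arc comes from the same tour as the arc between
          \<open>i - 1\<close> and \<open>i\<close>, that tour has a valley at \<open>i - 1\<close>.
          If it comes from the other tour, that one has two rising (or, after reversal, two falling)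
          arcs across the cut below \<open>i\<close>, which again requires a valley.\<close>
        from psb_peak[OF p1 i1 i(2) this] show False
        proof
          assume "Suc (z1 i) = i \<and> i < z1 (z1 i)"
          then have q: "Suc (y i) = i" "i < z1 (y i)" using z1(3) by auto
          have d: "inv x i \<noteq> y i" using q two by auto
          then have l: "2 \<le> y i" using q xU xb by linarith
          have "z1 (y i) \<noteq> y (y i)"
          proof
            assume "z1 (y i) = y (y i)"
            then have "valley y (y i)" using q si(4)[of i] by (simp add: valley_def)
            then show False using nv(2)[OF l q(1)] by simp
          qed
          then have "z1 (y i) = x (y i)" using D(5)[OF z1(1), of "y i"] by auto
          then have "valley x (y i)"
            using two_up_arcs_valley[OF x n, of "y i" "inv x i" "y i"] q d xU xb i si(1)[of i] by auto
          then show False using nv(1)[OF l q(1)] by simp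
        next
          assume "Suc (inv z1 i) = i \<and> i < inv z1 (inv z1 i)"
          then have q: "Suc (inv x i) = i" "i < inv z1 (inv x i)" using z1(2) by auto
          have d: "inv x i \<noteq> y i" using q two' by auto
          then have l: "2 \<le> inv x i" using q yD xb by linarith
          have "inv z1 (inv x i) \<noteq> inv x (inv x i)"
          proof
            assume "inv z1 (inv x i) = inv x (inv x i)"
            then have "valley x (inv x i)" using q si(1)[of i] by (simp add: valley_def)
            then show False using nv(1)[OF l q(1)] by simp
          qed
          then have "inv z1 (inv x i) = inv y (inv x i)" using mixing_pred(1)[OF m z1(1)] by blast
          then have "valley (inv y) (inv x i)"
            using two_up_arcs_valley[OF psb_inv[OF y] n, of "inv x i" "y i" "inv x i"]
              q d yD xb i si(4)[of i] by auto
          then have "valley y (inv x i)"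
            using permutes_inv_inv[OF psb_permutes[OF y]] by (auto simp: valley_def)
          then show False using nv(2)[OF l q(1)] by simp
        qed
      next
        case xUP: UP
        show False using t1 xUP yD ne by auto
      next
        case xUV: UV
        show False using t2 xUV yD ne by auto
      qed (use ux in auto)
    next
      case yDP: DP
      show False using x n i
      proof (cases rule: psb_city_cases)
        case xU: U
        show False using t1 xU yDP ne by auto
      next
        case xUP: UP
        show False using t1 xUP yDP by auto
      next
        case xUV: UV
        \<comment> \<open>The overlapping case: \<open>y\<close> runs \<open>i - 1\<close>,
          \<open>i\<close> and \<open>x\<close> runs \<open>i + 1\<close>, \<open>i\<close>. Since
          \<open>z2\<close> leaves \<open>i\<close> upwards, \<open>j\<close> is no valley of
          \<open>z2\<close>; so \<open>z2\<close> enters \<open>j\<close> from below along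
          \<open>x\<close> and is mixed at \<open>j\<close> too. Either the induction hypothesis
          applies at \<open>j\<close>, or \<open>x\<close> is on the path back there and the
          reversed tours contain a forbidden run.\<close>
        define j where "j = inv y i"
        have j: "Suc j = i" "y j = i" using yDP psb_inv_simps(1)[OF y] by (auto simp: j_def)
        have jr: "2 \<le> j" "j < n" using yDP xb j i by auto
        have zj: "z2 j = i" using z2(2) psb_inv_simps(1)[OF p2, of i] by (simp add: j_def)
        have nv: "\<not> valley z2 j"
          using psb_valley_Suc_peak[OF p2 n, of j] jr j z2 xUV by auto
        have iz: "inv z2 j < j"
        proof -
          have "inv z2 j \<noteq> j" using psb_bounds[OF p2, of j] jr by auto
          then show ?thesis using nv zj j by (auto simp: valley_def)
        qed
        have "j < inv y j" using yDP j by (auto simp: j_def)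
        then have izx: "inv z2 j = inv x j" "inv x j \<noteq> inv y j"
          using mixing_pred(1)[OF m z2(1), of j] iz by auto
        have xj: "x j \<noteq> i" using xUV j si(2)[of j] by auto
        have dy: "\<not> up_side y j" using \<open>j < inv y j\<close> j yDP by (auto simp: up_side_def j_def)
        show False
        proof (cases "up_side x j")
          case True
          show False
            by (rule less.IH[of j x y z2]) (use m jr j izx dy True xj zj z2 in auto)
        next
          case False
          have xj: "Suc (inv x j) = j" using False iz izx by (auto simp: up_side_def)
          have ii: "inv (inv y) = y" using permutes_inv_inv[OF psb_permutes[OF y]] .
          show False
          proof (rule no_reversed_run[OF psb_inv[OF x] psb_inv[OF y] psb_inv[OF p2] n _ jr])
            show "up_side (inv x) j" "up_side (inv y) j"
              using False dy up_side_inv[OF x n jr] up_side_inv[OF y n jr] by auto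
            show "inv (inv y) j = Suc j" using ii j by simp
            show "inv z2 (Suc j) = j" using j z2(2) by (auto simp: j_def)
          qed (use mixing_pred(1)[OF m z2(1)] xj izx in auto)
        qed
      qed (use ux in auto)
    next
      case yDV: DV
      show False using x n i
      proof (cases rule: psb_city_cases)
        case xU: U
        show False using t2 xU yDV ne by auto
      next
        case xUV: UV
        show False using t2 xUV yDV by auto
      next
        case xUP: UP
        define j where "j = x i"
        have j: "Suc j = i" "inv x j = i" using xUP psb_inv_simps(2)[OF x] by (auto simp: j_def)
        have jr: "2 \<le> j" "j < n" using xUP xb j i by auto
        have zj: "inv z2 j = i" using z2(3) psb_inv_simps(2)[OF p2, of i] by (simp add: j_def)
        have nv: "\<not> valley z2 j"
          using psb_valley_Suc_peak[OF p2 n, of j] jr j z2 yDV by auto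
        have iz: "z2 j < j"
        proof -
          have "z2 j \<noteq> j" using psb_bounds[OF p2, of j] jr by auto
          then show ?thesis using nv zj j by (auto simp: valley_def)
        qed
        have "j < x j" using xUP j by (auto simp: j_def)
        then have izx: "z2 j = y j" "x j \<noteq> y j"
          using D(5)[OF z2(1), of j] iz by auto
        have yj: "inv y j \<noteq> i" using yDV j si(3)[of j] by auto
        have dx: "up_side x j" using \<open>j < x j\<close> j by (auto simp: up_side_def)
        show False
        proof (cases "up_side y j")
          case False
          show False
            by (rule less.IH[of j x y z2]) (use m jr j izx dx False yj zj z2 in auto)
        next
          case True
          have yj: "Suc (y j) = j"
            using y n jr by (cases rule: psb_city_cases) (use True iz izx in auto)
          show False
          proof (rule no_reversed_run[OF y x p2 n _ jr True dx yj])
            show "inv x j = Suc j" using j by simp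
            show "z2 (Suc j) = j" using j z2(3) by (auto simp: j_def)
          qed (use D(5)[OF z2(1)] yj izx in auto)
        qed
      qed (use ux in auto)
    qed (use uy in auto)
  qed
  note m = less.prems(1)
  obtain z' where z': "z' \<in> Z" "inv z' i = inv y i" "z' i = x i"
    using mixing_exchange_at[OF m less.prems(5,6,7,8,9)] .
  show False
  proof (cases "up_side x i")
    case True
    show False
      using main[OF m less.prems(2,3) True _ less.prems(5,6,7,8,9) z'] less.prems(4) True by simp
  next
    case False
    show False
      using main[OF mixing_commute[OF m] less.prems(2,3) _ False _ _ z' less.prems(7,8,9)]
        less.prems(4,5,6) False by simp
  qed
qed

section \<open>Ties between arc choices\<close>

definition locked :: "(nat \<Rightarrow> nat) \<Rightarrow> (nat \<Rightarrow> nat) \<Rightarrow> nat \<Rightarrow> bool" where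
  "locked x y i \<longleftrightarrow> up_side x i \<noteq> up_side y i \<or>
     (peak x i \<and> valley y i) \<or> (valley x i \<and> peak y i)"

text \<open>A labelling b stands for the choice of the arc of x at the cities where it holds and of the arc of y
  elsewhere.\<close>

definition respects_ties ::
  "nat \<Rightarrow> (nat \<Rightarrow> nat) \<Rightarrow> (nat \<Rightarrow> nat) \<Rightarrow> (nat \<Rightarrow> bool) \<Rightarrow> bool" where
  "respects_ties n x y b \<longleftrightarrow>
     (\<forall>v\<in>{1..n}. b (inv x v) = b (inv y v)) \<and>
     (\<forall>v\<in>{1..n}. x (y v) = v \<longrightarrow> b v = b (y v)) \<and>
     (\<forall>i. 2 \<le> i \<longrightarrow> i < n \<longrightarrow> locked x y i \<longrightarrow> b (inv x i) = b i)"

text \<open>Sides can differ across a shared incoming arc only if it joins consecutive cities, as a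
  step-back of one tour and an ordinary step of the other. One way of mixing the arcs before and
  after it gives a valley without the peak above it or a peak without a step-back; the exchange then
  excludes the other way.\<close>

lemma common_in_arc:
  assumes m: "mixing n x y Z" and i: "2 \<le> i" "i < n" and ux: "up_side x i" and uy: "\<not> up_side y i"
    and u: "inv x i = u" "inv y i = u" and z: "z \<in> Z"
  shows "inv x u \<noteq> inv y u \<and> (inv z u = inv x u \<longleftrightarrow> z i = x i)"
proof -
  note D = mixingD[OF m]
  note n = D(1) and x = D(2) and y = D(3)
  have xu: "x u = i" and yu: "y u = i"
    using u psb_inv_simps(1)[OF x, of i] psb_inv_simps(1)[OF y, of i] by auto
  have u1: "1 \<le> u" "u \<le> n" using psb_bounds[OF x, of i] u i by auto
  have zu: "z' u = i" if "z' \<in> Z" for z' using D(5)[OF that, of u] xu yu by auto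
  have iz: "inv z' i = u" if "z' \<in> Z" for z'
    using zu[OF that] psb_inv_simps(2)[OF D(4)[OF that], of u] by simp
  have *: "x i \<noteq> y i \<and> inv x u \<noteq> inv y u \<and>
     ((\<forall>z\<in>Z. \<not> (inv z u = inv y u \<and> z i = x i)) \<or> (\<forall>z\<in>Z. \<not> (inv z u = inv x u \<and> z i = y i)))"
    using x n i
  proof (cases rule: psb_city_cases)
    case xU: U
    have yDP: "Suc (y i) < i" "Suc u = i" "i < inv y u"
      using y n i by (cases rule: psb_city_cases; use u uy xU in auto)+
    have u2: "2 \<le> u" using yDP psb_bounds[OF y, of i] i by linarith
    have un: "u < n" using yDP i by simp
    have "\<not> valley x u" using psb_valley_Suc_peak[OF x n u2 u1(2)] yDP(2) xU by auto
    then have "inv x u \<noteq> inv y u" using yDP xu by (auto simp: valley_def)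
    moreover have "\<not> (inv z u = inv y u \<and> z i = x i)" if z: "z \<in> Z" for z
    proof
      assume *: "inv z u = inv y u \<and> z i = x i"
      then have "valley z u" using zu[OF z] yDP by (auto simp: valley_def)
      then show False using psb_valley_Suc_peak[OF D(4)[OF z] n u2 u1(2)] yDP(2) xU * by auto
    qed
    ultimately show ?thesis using xU yDP by auto
  next
    case xUP: UP
    have False using y n i by (cases rule: psb_city_cases) (use u uy xUP in auto)
    then show ?thesis ..
  next
    case xUV: UV
    have us: "u = Suc i" using xUV u by simp
    have yD: "y i < i" using y n i by (cases rule: psb_city_cases) (use u uy us in auto)
    have un: "u < n" using xUV us by simp
    have xin: "inv x u < i" using xUV us by simp
    have yin: "u < inv y u"
    proof (rule ccontr)
      assume "\<not> u < inv y u"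
      then have "inv y u < u" using psb_bounds[OF y u1] by linarith
      from psb_peak[OF y u1(1) un this] yu us yD psb_inv_simps(1)[OF y, of u]
      show False by auto
    qed
    have "\<not> (inv z u = inv x u \<and> z i = y i)" if z: "z \<in> Z" for z
    proof
      assume *: "inv z u = inv x u \<and> z i = y i"
      have "inv z u < u" "z u < u" using * xin zu[OF z] us by auto
      from psb_peak[OF D(4)[OF z] u1(1) un this] show False
        using zu[OF z] us yD * xin by auto
    qed
    then show ?thesis using xUV yD xin yin us by auto
  qed (use ux in auto)
  \<comment> \<open>The choice of the arc into \<open>u\<close> is an outgoing choice at
    \<open>a\<close>, to which the exchange applies.\<close>
  define a where "a = inv x u"
  have a: "x a = u" "y a \<noteq> u"
    using * psb_inv_simps[OF x] psb_inv_simps[OF y] by (metis a_def)+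
  have ina: "inv z' u = inv x u \<longleftrightarrow> z' a = u" if "z' \<in> Z" for z'
    using mixing_pred(2)[OF m that] a_def by simp
  have "\<not> (inv z' u = inv y u \<and> z' i = x i) \<and> \<not> (inv z' u = inv x u \<and> z' i = y i)"
    if z': "z' \<in> Z" for z'
  proof (rule ccontr)
    assume "\<not> ?thesis"
    then consider "inv z' u = inv y u" "z' i = x i" | "inv z' u = inv x u" "z' i = y i" by blast
    then show False
    proof cases
      case 1
      then have "z' a = y a" using D(5)[OF z', of a] ina[OF z'] * a by auto
      then obtain z'' where z'': "z'' \<in> Z" "z'' i = y i" "z'' a = x a"
        using mixing_exchange[OF m, of i a z'] 1 a * z' by metis
      then have "inv z'' u = inv x u" using ina[OF z''(1)] a by simp
      then show False using * 1 z' z'' by blast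
    next
      case 2
      then have "z' a = x a" using ina[OF z'] a by auto
      then obtain z'' where z'': "z'' \<in> Z" "z'' a = y a" "z'' i = x i"
        using mixing_exchange[OF m, of a i z'] 2 a * z' by metis
      then have "inv z'' u = inv y u" using ina[OF z''(1)] a mixing_pred(1)[OF m z''(1), of u] by auto
      then show False using * 2 z' z'' by blast
    qed
  qed
  then show ?thesis using * mixing_pred(1)[OF m z, of u] D(5)[OF z, of i] z by metis
qed

lemma common_in_arc':
  assumes m: "mixing n x y Z" and i: "2 \<le> i" "i < n" and side: "up_side x i \<noteq> up_side y i"
    and u: "inv x i = u" "inv y i = u" and z: "z \<in> Z"
  shows "inv x u \<noteq> inv y u \<and> (inv z u = inv x u \<longleftrightarrow> z i = x i)"
proof (cases "up_side x i")
  case True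
  then show ?thesis using common_in_arc[OF m i] side u z by blast
next
  case False
  then have *: "inv y u \<noteq> inv x u \<and> (inv z u = inv y u \<longleftrightarrow> z i = y i)"
    using common_in_arc[OF mixing_commute[OF m] i] side u z by blast
  have "x i \<noteq> y i" using side u by (metis up_side_def)
  then show ?thesis
    using * mixing_pred(1)[OF m z, of u] mixingD(5)[OF m z, of i] by metis
qed

text \<open>On equal sides one of the mixed passages at \<open>i\<close> is a run through
  \<open>i + 1\<close>, \<open>i\<close>, \<open>i - 1\<close>, in this order or backwards, which
  \<open>no_reversed_run\<close> forbids; the exchange takes care of the other passage.\<close>

lemma pure_at_of_peak_valley:
  assumes m: "mixing n x y Z" and i: "2 \<le> i" "i < n" and pv: "peak x i" "valley y i"
    and z: "z \<in> Z"
  shows "inv z i = inv x i \<longleftrightarrow> z i = x i"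
proof -
  note D = mixingD[OF m]
  note n = D(1) and x = D(2) and y = D(3)
  have p: "inv x i < i" "x i < i" and v: "i < inv y i" "i < y i"
    using pv by (auto simp: peak_def pred_of_def valley_def)
  have ne: "x i \<noteq> y i" "inv x i \<noteq> inv y i" using p v by auto
  have no: False if z': "z' \<in> Z" "inv z' i = inv y i" "z' i = x i" for z'
  proof (cases "up_side x i \<noteq> up_side y i")
    case True
    show False
      using pure_at_of_sides_differ[OF mixing_commute[OF m] i _ _ _ z'(1)] True ne z' by simp
  next
    case False
    show False
    proof (cases "up_side x i")
      case True
      have "Suc (x i) = i" using x n i by (cases rule: psb_city_cases) (use True p in auto)
      moreover have "inv y i = Suc i" using y n i by (cases rule: psb_city_cases) (use False True v in auto)
      moreover have "z' (Suc i) = i"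
        using psb_inv_simps(1)[OF D(4)[OF z'(1)], of i] z' calculation by simp
      ultimately show False
        using no_reversed_run[OF x y D(4)[OF z'(1)] n D(5)[OF z'(1)] i] True False z' by simp
    next
      case dn: False
      have ii: "inv (inv x) = x" "inv (inv y) = y"
        using permutes_inv_inv[OF psb_permutes[OF x]] permutes_inv_inv[OF psb_permutes[OF y]] .
      obtain z'' where z'': "z'' \<in> Z" "inv z'' i = inv x i" "z'' i = y i"
        using mixing_exchange_at[OF mixing_commute[OF m] _ _ z'] ne by metis
      have a: "Suc (inv x i) = i" using x n i by (cases rule: psb_city_cases) (use dn p in auto)
      moreover have b: "y i = Suc i" using y n i by (cases rule: psb_city_cases) (use False dn v in auto)
      moreover have "inv z'' (Suc i) = i"
        using psb_inv_simps(2)[OF D(4)[OF z''(1)], of i] z'' b by simp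
      moreover have "up_side (inv x) i" "up_side (inv y) i"
        using up_side_inv[OF x n i] up_side_inv[OF y n i] dn False by auto
      ultimately show False
        using no_reversed_run[OF psb_inv[OF x] psb_inv[OF y] psb_inv[OF D(4)[OF z''(1)]] n
            mixing_pred(1)[OF m z''(1)] i] z'' ii by simp
    qed
  qed
  have no': False if z': "z' \<in> Z" "inv z' i = inv x i" "z' i = y i" for z'
    using mixing_exchange_at[OF m ne z'] no by metis
  show ?thesis
    using no[OF z] no'[OF z] mixing_pred(1)[OF m z, of i] D(5)[OF z, of i] ne by metis
qed

text \<open>At a city where x and y share the outgoing arc the label is inherited from the incoming arc: such
  a city matters for the ties only if its arc is a step-back of one tour traversed on the other
  side by the other tour, and the step-back is then taken or left as a whole.\<close>

lemma respects_ties_choice: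
  assumes m: "mixing n x y Z" and z: "z \<in> Z"
  shows "respects_ties n x y (\<lambda>u. if x u \<noteq> y u then z u = x u else inv z u = inv x u)"
    (is "respects_ties n x y ?b")
  unfolding respects_ties_def
proof (intro conjI ballI allI impI)
  note D = mixingD[OF m]
  note n = D(1) and x = D(2) and y = D(3) and p = D(4)[OF z] and zxy = D(5)[OF z]
  note si = psb_inv_simps[OF x] psb_inv_simps[OF y] psb_inv_simps[OF p]
  {
    fix v assume "v \<in> {1..n}"
    show "?b (inv x v) = ?b (inv y v)"
    proof (cases "inv x v = inv y v")
      case False
      have 1: "x (inv x v) = v" "y (inv y v) = v" using si by auto
      have 2: "y (inv x v) \<noteq> v" "x (inv y v) \<noteq> v" using si False by metis+
      \<comment> \<open>\<open>z\<close> has a single arc into \<open>v\<close>, so exactly one of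
        the two tails keeps its arc to \<open>v\<close>, which is an arc of \<open>x\<close> at one
        tail and of \<open>y\<close> at the other.\<close>
      have 3: "z (inv x v) = v \<longleftrightarrow> z (inv y v) \<noteq> v"
        using mixing_pred[OF m z, of v] mixing_pred(2)[OF mixing_commute[OF m] z, of v] False by metis
      have "?b (inv x v) \<longleftrightarrow> z (inv x v) = v" using 1 2 by simp
      moreover have "?b (inv y v) \<longleftrightarrow> z (inv y v) \<noteq> v"
        using 1 2 zxy[of "inv y v"] by auto
      ultimately show ?thesis using 3 by blast
    qed simp
  next
    fix u assume u: "u \<in> {1..n}" and xy: "x (y u) = u"
    define v where "v = y u"
    have v: "v \<in> {1..n}" using psb_range(1)[OF y, of u] u by (simp add: v_def)
    have ne: "x u \<noteq> y u" "x v \<noteq> y v"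
      using psb_no_2_cycle[OF x n u] psb_no_2_cycle[OF y n u] xy by (auto simp: v_def)
    \<comment> \<open>This choice would close the 2-cycle through \<open>u\<close> and
      \<open>v\<close>.\<close>
    have no: False if z': "z' \<in> Z" "z' u = y u" "z' v = x v" for z'
      using psb_no_2_cycle[OF D(4)[OF z'(1)] n u] z' xy by (simp add: v_def)
    have no': False if z': "z' \<in> Z" "z' u = x u" "z' v = y v" for z'
      using mixing_exchange[OF m ne z'] no by metis
    show "?b u = ?b (y u)"
      using no[OF z] no'[OF z] ne zxy[of u] zxy[of v] unfolding v_def[symmetric] by auto
  next
    fix i assume i: "2 \<le> i" "i < n" and lk: "locked x y i"
    let ?u = "inv x i"
    have xu: "x ?u = i" using si by simp
    have zu: "inv z i = ?u \<longleftrightarrow> z ?u = i" using mixing_pred(2)[OF m z] .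
    show "?b ?u = ?b i"
    proof (cases "inv y i = ?u")
      case False
      then have yu: "y ?u \<noteq> i" using si(4)[of ?u] by auto
      then have bu: "?b ?u \<longleftrightarrow> inv z i = inv x i" using xu zu by simp
      show ?thesis
      proof (cases "x i = y i")
        case True
        then show ?thesis using bu by simp
      next
        case ne: False
        have "inv z i = inv x i \<longleftrightarrow> z i = x i"
        proof (cases "up_side x i = up_side y i")
          case False': False
          obtain "\<not> (inv z i = inv x i \<and> z i = y i)" "\<not> (inv z i = inv y i \<and> z i = x i)"
            using pure_at_of_sides_differ[OF m i False' ne _ z]
              pure_at_of_sides_differ[OF mixing_commute[OF m] i _ _ _ z] False False' ne by metis
          then show ?thesis
            using mixing_pred(1)[OF m z, of i] zxy[of i] ne False by metis
        next
          case True
          then consider "peak x i" "valley y i" | "valley x i" "peak y i"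
            using lk by (auto simp: locked_def)
          then show ?thesis
          proof cases
            case 1
            then show ?thesis using pure_at_of_peak_valley[OF m i _ _ z] by simp
          next
            case 2
            then have "inv z i = inv y i \<longleftrightarrow> z i = y i"
              using pure_at_of_peak_valley[OF mixing_commute[OF m] i _ _ z] by simp
            then show ?thesis using mixing_pred(1)[OF m z, of i] zxy[of i] ne False by metis
          qed
        qed
        then show ?thesis using bu ne by simp
      qed
    next
      case True
      have side: "up_side x i \<noteq> up_side y i"
        using lk True by (auto simp: locked_def peak_def pred_of_def valley_def)
      have ne: "x i \<noteq> y i" using side True by (metis up_side_def)
      have yu: "y ?u = i" using True si(3)[of i] by simp
      show ?thesis
        using common_in_arc'[OF m i side refl True z] ne xu yu by simp
    qed
  }
qed

section \<open>Gluing two tours along a labelling\<close>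

lemma respects_ties_commute:
  assumes x: "psb n x" and y: "psb n y" and b: "respects_ties n x y b"
  shows "respects_ties n y x (\<lambda>u. \<not> b u)"
proof -
  have "b v = b (x v)" if v: "v \<in> {1..n}" "y (x v) = v" for v
  proof -
    have "x v \<in> {1..n}" using psb_range(1)[OF x, of v] v by simp
    then show ?thesis using b v unfolding respects_ties_def by metis
  qed
  moreover have "b (inv y i) = b i" if i: "2 \<le> i" "i < n" "locked y x i" for i
  proof -
    have "locked x y i" using i(3) by (auto simp: locked_def)
    moreover have "b (inv x i) = b (inv y i)" using b i by (simp add: respects_ties_def)
    ultimately show ?thesis using b i by (auto simp: respects_ties_def)
  qed
  ultimately show ?thesis using b by (simp add: respects_ties_def)
qed

lemma up_side_not_peak:
  assumes "psb n s" "3 \<le> n" "2 \<le> i" "i < n" "\<not> peak s i"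
  shows "up_side s i \<Longrightarrow> i < s i" and "\<not> up_side s i \<Longrightarrow> i < inv s i"
proof -
  show "i < s i" if "up_side s i"
    using assms(1-4) by (cases rule: psb_city_cases) (use assms(5) that in \<open>auto simp: peak_def pred_of_def\<close>)
  show "i < inv s i" if "\<not> up_side s i"
    using assms(1-4) by (cases rule: psb_city_cases) (use assms(5) that in \<open>auto simp: peak_def pred_of_def\<close>)
qed

text \<open>Wherever \<open>z\<close> changes tours, at \<open>i\<close> or at \<open>i - 1\<close>,
  the city is not locked: both tours are on the same side there, and a valley of one does not meet a
  peak of the other. So \<open>z\<close> gets the far arc of a step-back whichever tour supplies it,
  and the ties on 2-cycles keep the far end from being \<open>i\<close> itself.\<close>

lemma respects_ties_step_back:
  assumes n: "3 \<le> n" and x: "psb n x" and y: "psb n y" and b: "respects_ties n x y b"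
    and z: "z = (\<lambda>u. if b u then x u else y u)"
    and iz: "\<And>v. 1 \<le> v \<Longrightarrow> v \<le> n \<Longrightarrow> inv z v = (if b (inv x v) then inv x v else inv y v)"
    and i: "1 \<le> i" "i < n" and pk: "inv z i < i" "z i < i" and bi: "b (inv x i)"
  shows "(Suc (z i) = i \<and> i < z (z i)) \<or> (Suc (inv z i) = i \<and> i < inv z (inv z i))"
proof -
  have b1: "b (inv x v) = b (inv y v)" if "1 \<le> v" "v \<le> n" for v
    using b that by (auto simp: respects_ties_def)
  have b2: "b v = b (y v)" if "1 \<le> v" "v \<le> n" "x (y v) = v" for v
    using b that by (auto simp: respects_ties_def)
  have b3: "b (inv x j) = b j" if "2 \<le> j" "j < n" "locked x y j" for j
    using b that by (auto simp: respects_ties_def)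
  have zi: "inv z i = inv x i" using iz[of i] i bi by simp
  have zb: "1 \<le> z i" using psb_bounds[OF x, of i] psb_bounds[OF y, of i] i z by auto
  then have i2: "2 \<le> i" using pk i by linarith
  \<comment> \<open>The step-back of \<open>x\<close> on the path back, entered by \<open>z\<close>
    along \<open>y\<close>. As \<open>j\<close> is not locked, \<open>y\<close> also comes from
    above; if it came from \<open>i\<close>, the 2-cycle would tie \<open>i\<close> to
    \<open>j\<close> and contradict the choice of \<open>y\<close> on the way in.\<close>
  have down: "i < inv z j"
    if j: "2 \<le> j" "Suc j = i" "x j = i" "i < inv x j" "b j" "\<not> b (inv x j)" for j
  proof -
    have jn: "j < n" "1 \<le> j" "j \<le> n" using j i by auto
    have nl: "\<not> locked x y j" using b3[OF j(1) jn(1)] j by auto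
    have "valley x j" using j by (auto simp: valley_def)
    moreover have "\<not> up_side x j" using j by (auto simp: up_side_def)
    ultimately have "j < inv y j"
      using nl up_side_not_peak(2)[OF y n j(1) jn(1)] by (auto simp: locked_def)
    moreover have "inv y j \<noteq> i"
    proof
      assume *: "inv y j = i"
      then have "y i = j" using psb_inv_simps(1)[OF y, of j] by simp
      then have "b i = b j" using b2[of i] i j by simp
      then show False using b1[OF jn(2,3)] j * by simp
    qed
    ultimately show ?thesis using iz[OF jn(2,3)] j by simp
  qed
  show ?thesis
  proof (cases "b i")
    case True
    then have zx: "z i = x i" by (simp add: z)
    have xp: "inv x i < i" "x i < i" using pk zi zx by auto
    have i3: "3 \<le> i" using psb_peak_pred_valley[OF x n i xp] by simp
    from psb_peak[OF x i xp] show ?thesis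
    proof
      assume *: "Suc (x i) = i \<and> i < x (x i)"
      define j where "j = x i"
      have j: "Suc j = i" "i < x j" "inv x j = i" "z i = j" "2 \<le> j" "j < n"
        using * zx psb_inv_simps(2)[OF x, of i] i3 i by (auto simp: j_def)
      have "i < z j"
      proof (cases "b j")
        case False
        have nl: "\<not> locked x y j" using b3[OF j(5,6)] j(3) True False by auto
        have "valley x j" using j by (auto simp: valley_def)
        moreover have "up_side x j" using j by (auto simp: up_side_def)
        ultimately have "j < y j"
          using nl up_side_not_peak(1)[OF y n j(5,6)] by (auto simp: locked_def)
        moreover have "y j \<noteq> i"
          using b2[of j] j True False by (auto simp: j_def)
        ultimately show ?thesis using j False by (simp add: z)
      qed (use j in \<open>simp add: z\<close>)
      then show ?thesis using j by simp
    next
      assume *: "Suc (inv x i) = i \<and> i < inv x (inv x i)"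
      define j where "j = inv x i"
      have j: "Suc j = i" "i < inv x j" "x j = i" "inv z i = j" "2 \<le> j" "b j"
        using * zi psb_inv_simps(1)[OF x, of i] i3 bi by (auto simp: j_def)
      have "i < inv z j" using down[of j] j iz[of j] i by (cases "b (inv x j)") auto
      then show ?thesis using j by simp
    qed
  next
    case False
    then have zy: "z i = y i" by (simp add: z)
    \<comment> \<open>\<open>z\<close> enters along \<open>x\<close> and leaves along
      \<open>y\<close>, so both tours pass \<open>i\<close> on the same side: on the path up the
      turn is a step-back of \<open>y\<close>, on the path back one of \<open>x\<close>.\<close>
    have nl: "\<not> locked x y i" using b3[OF i2 i(2)] bi False by auto
    show ?thesis
    proof (cases "up_side y i")
      case True
      have UP: "Suc (inv y i) < i" "Suc (y i) = i" "i < y (y i)"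
        using y n i2 i(2) by (cases rule: psb_city_cases; use True zy pk in auto)+
      define j where "j = y i"
      have j: "Suc j = i" "i < y j" "inv y j = i" "z i = j"
        using UP zy psb_inv_simps(2)[OF y, of i] by (auto simp: j_def)
      have "1 \<le> inv y i" using psb_bounds[OF y, of i] i by simp
      then have jr: "2 \<le> j" "j < n" using UP j i by linarith+
      have "i < z j"
      proof (cases "b j")
        case bj: True
        have "\<not> b (inv x j)" using b1[of j] j False jr by simp
        then have nl: "\<not> locked x y j" using b3[OF jr] bj by auto
        have "valley y j" using j by (auto simp: valley_def)
        moreover have "up_side y j" using j by (auto simp: up_side_def)
        ultimately have "j < x j"
          using nl up_side_not_peak(1)[OF x n jr] by (auto simp: locked_def)
        moreover have "x j \<noteq> i" using b2[of i] i bj False by (auto simp: j_def)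
        ultimately show ?thesis using j bj by (simp add: z)
      qed (use j in \<open>simp add: z\<close>)
      then show ?thesis using j by simp
    next
      case dn: False
      then have dx: "\<not> up_side x i" using nl by (auto simp: locked_def)
      have DP: "Suc (x i) < i" "Suc (inv x i) = i" "i < inv x (inv x i)"
        using x n i2 i(2) by (cases rule: psb_city_cases; use dx zi pk in auto)+
      define j where "j = inv x i"
      have "1 \<le> x i" using psb_bounds[OF x, of i] i by simp
      then have j: "Suc j = i" "i < inv x j" "x j = i" "inv z i = j" "2 \<le> j" "b j"
        using DP zi psb_inv_simps(1)[OF x, of i] bi by (auto simp: j_def)
      have "i < inv z j" using down[of j] j iz[of j] i by (cases "b (inv x j)") auto
      then show ?thesis using j by simp
    qed
  qed
qed

text \<open>The ties at common heads make the glued map injective. For a peak entered along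
  \<open>y\<close> the tours are swapped together with the labels.\<close>

lemma psb_of_respects_ties:
  assumes n: "3 \<le> n" and x: "psb n x" and y: "psb n y" and b: "respects_ties n x y b"
  shows "psb n (\<lambda>u. if b u then x u else y u)" (is "psb n ?z")
proof -
  have b1: "b (inv x v) = b (inv y v)" if "1 \<le> v" "v \<le> n" for v
    using b that by (auto simp: respects_ties_def)
  have b2: "b v = b (y v)" if "1 \<le> v" "v \<le> n" "x (y v) = v" for v
    using b that by (auto simp: respects_ties_def)
  have b3: "b (inv x i) = b i" if "2 \<le> i" "i < n" "locked x y i" for i
    using b that by (auto simp: respects_ties_def)
  note sx = psb_inv_simps[OF x] and sy = psb_inv_simps[OF y]
  have out: "x u = u \<and> y u = u" if "u \<notin> {1..n}" for u
    using permutes_not_in[OF psb_permutes[OF x]] permutes_not_in[OF psb_permutes[OF y]] that by auto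
  have perm: "?z permutes {1..n}"
  proof (rule inj_imp_permutes)
    show "inj_on ?z {1..n}"
    proof (rule inj_onI)
      fix u v assume u: "u \<in> {1..n}" and v: "v \<in> {1..n}" and eq: "?z u = ?z v"
      define w where "w = ?z u"
      have w: "1 \<le> w" "w \<le> n"
        using psb_bounds[OF x, of u] psb_bounds[OF y, of u] u by (auto simp: w_def)
      have "u = (if b u then inv x w else inv y w)" "v = (if b v then inv x w else inv y w)"
        using eq sx sy by (auto simp: w_def split: if_splits)
      then show "u = v" using b1[OF w] by metis
    qed
    show "?z u \<in> {1..n}" if "u \<in> {1..n}" for u
      using psb_range(1)[OF x, of u] psb_range(1)[OF y, of u] that by simp
  qed (use out in auto)
  have inv: "inv ?z v = (if b (inv x v) then inv x v else inv y v)" if "1 \<le> v" "v \<le> n" for v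
    by (rule permutes_inv_eq[OF perm, THEN iffD2]) (use b1[OF that] sx sy in auto)
  have step: "(Suc (?z i) = i \<and> i < ?z (?z i)) \<or> (Suc (inv ?z i) = i \<and> i < inv ?z (inv ?z i))"
    if i: "1 \<le> i" "i < n" and pk: "inv ?z i < i" "?z i < i" for i
  proof (cases "b (inv x i)")
    case True
    show ?thesis by (rule respects_ties_step_back[OF n x y b refl inv i pk True])
  next
    case False
    have z': "?z = (\<lambda>u. if \<not> b u then y u else x u)" by (rule ext) simp
    have iz': "inv ?z v = (if \<not> b (inv y v) then inv y v else inv x v)" if "1 \<le> v" "v \<le> n" for v
      using inv[OF that] b1[OF that] by simp
    have "\<not> b (inv y i)" using False b1[of i] i by simp
    from respects_ties_step_back[OF n y x respects_ties_commute[OF x y b] z' iz' i pk this]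
    show ?thesis .
  qed
  have "step_back_peak ?z i" if "i \<in> {1..<n}" "peak ?z i" for i
    using step[of i] that by (auto simp: peak_def step_back_peak_def pred_of_def)
  moreover have "?z i \<noteq> i" if "i \<in> {1..n}" for i
    using psb_bounds[OF x, of i] psb_bounds[OF y, of i] that by auto
  ultimately show ?thesis using perm by (simp add: psb_def)
qed

section \<open>The adjacency criterion\<close>

lemma charvec_at:
  assumes "psb n s" "1 \<le> u" "u \<le> n"
  shows "charvec n s (u, v) = (if s u = v then 1 else 0)"
  using psb_bounds[OF assms] assms by (auto simp: charvec_def arcs_def)

lemma charvec_inj:
  assumes x: "psb n x" and y: "psb n y" and eq: "charvec n x = charvec n y"
  shows "x = y"
proof
  fix u show "x u = y u"
  proof (cases "u \<in> {1..n}")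
    case True
    then have "charvec n y (u, x u) = 1" using charvec_at[OF x, of u] by (simp flip: eq)
    then show ?thesis using charvec_at[OF y, of u "x u"] True by (auto split: if_splits)
  next
    case False
    then show ?thesis
      using permutes_not_in[OF psb_permutes[OF x]] permutes_not_in[OF psb_permutes[OF y]] by simp
  qed
qed

lemma psb_differ_range:
  assumes "psb n x" "psb n y" "x u \<noteq> y u"
  shows "1 \<le> u" "u \<le> n"
proof -
  have "u \<in> {1..n}"
    using assms permutes_not_in[OF psb_permutes[OF assms(1)]]
      permutes_not_in[OF psb_permutes[OF assms(2)]] by metis
  then show "1 \<le> u" "u \<le> n" by auto
qed

section \<open>Convex combinations of tours\<close>

lemma sum_scaleR_fun_apply:
  "(\<Sum>s\<in>A. c s *\<^sub>R f s) e = (\<Sum>s\<in>A. c s * (f s e :: real))"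
  by (induction A rule: infinite_finite_induct) (auto simp: scaleR_fun_def zero_fun_def plus_fun_def)

lemma finite_PSBT: "finite (PSBT n)"
  by (rule finite_subset[OF _ finite_permutations[of "{1..n}"]]) (auto simp: PSBT_def tour_def)

lemma PSB_weights:
  assumes n: "2 \<le> n" and p: "p \<in> PSB n"
  obtains l where "\<And>s. s \<in> PSBT n \<Longrightarrow> 0 \<le> l s" "sum l (PSBT n) = 1"
    "p = (\<Sum>s\<in>PSBT n. l s *\<^sub>R charvec n s)"
proof -
  have inj: "inj_on (charvec n) (PSBT n)"
    using charvec_inj PSBT_iff_psb[OF n] by (auto intro!: inj_onI)
  from p obtain u where u: "\<forall>v\<in>charvec n ` PSBT n. 0 \<le> u v" "sum u (charvec n ` PSBT n) = 1"
      "(\<Sum>v\<in>charvec n ` PSBT n. u v *\<^sub>R v) = p"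
    unfolding PSB_def convex_hull_finite[OF finite_imageI[OF finite_PSBT]] by auto
  show thesis
  proof (rule that)
    show "0 \<le> (u \<circ> charvec n) s" if "s \<in> PSBT n" for s using u that by simp
    show "sum (u \<circ> charvec n) (PSBT n) = 1" using u sum.reindex[OF inj, of u] by simp
    show "p = (\<Sum>s\<in>PSBT n. (u \<circ> charvec n) s *\<^sub>R charvec n s)"
      using u sum.reindex[OF inj, of "\<lambda>v. u v *\<^sub>R v"] by simp
  qed
qed

lemma mixing_of_segment_point:
  assumes n: "3 \<le> n" and x: "psb n x" and y: "psb n y"
    and l: "\<And>s. s \<in> PSBT n \<Longrightarrow> 0 \<le> l s"
    and eq: "(\<Sum>s\<in>PSBT n. l s *\<^sub>R charvec n s) = (1 - t) *\<^sub>R charvec n x + t *\<^sub>R charvec n y"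
  shows "mixing n x y {s\<in>PSBT n. 0 < l s}"
proof -
  let ?Z = "{s\<in>PSBT n. 0 < l s}"
  have psb: "psb n s" if "s \<in> PSBT n" for s using that PSBT_iff_psb n by simp
  have at: "(\<Sum>s\<in>PSBT n. l s * (if s u = v then 1 else 0)) =
      (1 - t) * (if x u = v then 1 else 0) + t * (if y u = v then 1 else 0)"
    if u: "1 \<le> u" "u \<le> n" for u v
  proof -
    have "(\<Sum>s\<in>PSBT n. l s * charvec n s (u, v)) = ((1 - t) *\<^sub>R charvec n x + t *\<^sub>R charvec n y) (u, v)"
      by (simp add: sum_scaleR_fun_apply flip: eq)
    also have "\<dots> = (1 - t) * (if x u = v then 1 else 0) + t * (if y u = v then 1 else 0)"
      using charvec_at[OF x u, of v] charvec_at[OF y u, of v] by (simp add: scaleR_fun_def)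
    finally show ?thesis using charvec_at[OF psb u, of _ v] by simp
  qed
  have "z u = x u \<or> z u = y u" if z: "z \<in> ?Z" for z u
  proof (cases "u \<in> {1..n}")
    case True
    then have u: "1 \<le> u" "u \<le> n" by auto
    show ?thesis
    proof (rule ccontr)
      assume *: "\<not> ?thesis"
      then have "(\<Sum>s\<in>PSBT n. l s * (if s u = z u then 1 else 0)) = 0"
        using at[OF u, of "z u"] by auto
      moreover have "l z * (if z u = z u then 1 else 0) \<le> (\<Sum>s\<in>PSBT n. l s * (if s u = z u then 1 else 0))"
        by (rule member_le_sum) (use z l finite_PSBT in auto)
      ultimately show False using z by simp
    qed
  next
    case False
    have "z \<in> PSBT n" using z by simp
    then show ?thesis
      using False permutes_not_in[OF psb_permutes[OF x]] permutes_not_in[OF psb_permutes[OF psb]] by metis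
  qed
  note zxy = this
  have "\<exists>z\<in>?Z. z u = y u \<and> z v = x v"
    if ne: "x u \<noteq> y u" "x v \<noteq> y v" and ex: "\<exists>z\<in>?Z. z u = x u \<and> z v = y v" for u v
  proof (rule ccontr)
    assume no: "\<not> ?thesis"
    from ex obtain z where z: "z \<in> ?Z" "z u = x u" "z v = y v" by blast
    \<comment> \<open>Both sums equal \<open>1 - t\<close>, the weight of the choice of
      \<open>x\<close> at \<open>v\<close> and at \<open>u\<close>. Without the opposite mixed
      choice every tour of positive weight taking \<open>x v\<close> also takes \<open>x u\<close>,
      and \<open>z\<close> makes the inequality strict.\<close>
    have "(\<Sum>s\<in>PSBT n. l s * (if s v = x v then 1 else 0)) < (\<Sum>s\<in>PSBT n. l s * (if s u = x u then 1 else 0))"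
    proof (rule sum_strict_mono_ex1[OF finite_PSBT])
      show "\<forall>s\<in>PSBT n. l s * (if s v = x v then 1 else 0) \<le> l s * (if s u = x u then 1 else 0)"
      proof
        fix s assume s: "s \<in> PSBT n"
        show "l s * (if s v = x v then 1 else 0) \<le> l s * (if s u = x u then 1 else 0)"
        proof (cases "0 < l s")
          case True
          then have "s \<in> ?Z" using s by simp
          then show ?thesis using no zxy[of s u] l[OF s] by auto
        next
          case False
          then show ?thesis using l[OF s] by simp
        qed
      qed
      show "\<exists>s\<in>PSBT n. l s * (if s v = x v then 1 else 0) < l s * (if s u = x u then 1 else 0)"
        by (rule bexI[of _ z]) (use z ne in auto)
    qed
    then show False
      using at[OF psb_differ_range[OF x y ne(1)], of "x u"] at[OF psb_differ_range[OF x y ne(2)], of "x v"] ne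
      by simp
  qed
  then show ?thesis unfolding mixing_def using n x y zxy psb by simp
qed

text \<open>The labelling read off from \<open>z\<close> is constant on the cities where
  \<open>x\<close> and \<open>y\<close> differ, so \<open>z\<close> follows one of them
  throughout.\<close>

lemma mixing_trivial:
  assumes m: "mixing n x y Z" and z: "z \<in> Z"
    and conn: "\<And>b u v. respects_ties n x y b \<Longrightarrow> x u \<noteq> y u \<Longrightarrow> x v \<noteq> y v \<Longrightarrow> b u = b v"
  shows "z = x \<or> z = y"
proof -
  have "z u = x u \<longleftrightarrow> z v = x v" if "x u \<noteq> y u" "x v \<noteq> y v" for u v
    using conn[OF respects_ties_choice[OF m z] that] that by simp
  then show ?thesis using mixingD(5)[OF m z] by (metis ext)
qed

theorem adjacent_vertices_iff:
  assumes n: "3 \<le> n" and x: "psb n x" and y: "psb n y"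
  shows "adjacent_vertices (PSB n) (charvec n x) (charvec n y) \<longleftrightarrow>
    x \<noteq> y \<and> (\<forall>b u v. respects_ties n x y b \<longrightarrow> x u \<noteq> y u \<longrightarrow> x v \<noteq> y v \<longrightarrow> b u = b v)"
    (is "?adj \<longleftrightarrow> x \<noteq> y \<and> ?conn")
proof
  have n2: "2 \<le> n" using n by simp
  have in_PSB: "charvec n s \<in> PSB n" if "psb n s" for s
    unfolding PSB_def using that PSBT_iff_psb[OF n2] by (auto intro: hull_inc)
  {
    assume adj: ?adj
    then have xy: "x \<noteq> y" and face: "closed_segment (charvec n x) (charvec n y) face_of PSB n"
      by (auto simp: adjacent_vertices_def)
    have False if b: "respects_ties n x y b" and u: "x u \<noteq> y u" "b u" and v: "x v \<noteq> y v" "\<not> b v" for b u v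
    proof -
      let ?z = "\<lambda>u. if b u then x u else y u" and ?w = "\<lambda>u. if \<not> b u then x u else y u"
      have z: "psb n ?z" by (rule psb_of_respects_ties[OF n x y b])
      have "respects_ties n x y (\<lambda>u. \<not> b u)" using b unfolding respects_ties_def by blast
      then have w: "psb n ?w" by (rule psb_of_respects_ties[OF n x y])
      have sum: "charvec n ?z + charvec n ?w = charvec n x + charvec n y"
        by (rule ext) (auto simp: charvec_def)
      have "?z u \<noteq> ?w u" using u by simp
      then have ne: "charvec n ?z \<noteq> charvec n ?w" using charvec_inj[OF z w] by metis
      let ?m = "(1 / 2) *\<^sub>R (charvec n x + charvec n y)"
      have "?m = (1 - 1/2) *\<^sub>R charvec n x + (1/2) *\<^sub>R charvec n y" by (simp add: scaleR_add_right)
      then have "?m \<in> closed_segment (charvec n x) (charvec n y)"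
        unfolding in_segment by (intro exI[of _ "1/2"]) simp
      moreover have "?m = (1 - 1/2) *\<^sub>R charvec n ?z + (1/2) *\<^sub>R charvec n ?w"
        by (simp add: scaleR_add_right flip: sum)
      then have "?m \<in> open_segment (charvec n ?z) (charvec n ?w)"
        unfolding in_segment using ne by (intro conjI exI[of _ "1/2"]) simp_all
      ultimately have "charvec n ?z \<in> closed_segment (charvec n x) (charvec n y)"
        using face in_PSB[OF z] in_PSB[OF w] unfolding face_of_def by blast
      then obtain t where t: "charvec n ?z = (1 - t) *\<^sub>R charvec n x + t *\<^sub>R charvec n y"
        unfolding in_segment by blast
      have at: "charvec n ?z e = (1 - t) * charvec n x e + t * charvec n y e" for e
        by (simp add: t scaleR_fun_def)
      note ur = psb_differ_range[OF x y u(1)] and vr = psb_differ_range[OF x y v(1)]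
      \<comment> \<open>The glued tour takes the arc of \<open>x\<close> at \<open>u\<close> and
        that of \<open>y\<close> at \<open>v\<close>, so \<open>t\<close> would have to be both 0
        and 1.\<close>
      have "1 - t = 1"
        using at[of "(u, x u)"] charvec_at[OF z ur] charvec_at[OF x ur] charvec_at[OF y ur] u by simp
      moreover have "t = 1"
        using at[of "(v, y v)"] charvec_at[OF z vr] charvec_at[OF x vr] charvec_at[OF y vr] v by simp
      ultimately show False by simp
    qed
    then show "x \<noteq> y \<and> ?conn" using xy by metis
  next
    assume "x \<noteq> y \<and> ?conn"
    then have xy: "x \<noteq> y" and conn: "\<And>b u v. respects_ties n x y b \<Longrightarrow> x u \<noteq> y u \<Longrightarrow> x v \<noteq> y v \<Longrightarrow> b u = b v"
      by blast+
    have "closed_segment (charvec n x) (charvec n y) \<subseteq> PSB n"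
      using in_PSB[OF x] in_PSB[OF y] by (intro closed_segment_subset) (auto simp: PSB_def)
    moreover have "p \<in> closed_segment (charvec n x) (charvec n y) \<and> q \<in> closed_segment (charvec n x) (charvec n y)"
      if p: "p \<in> PSB n" and q: "q \<in> PSB n" and r: "r \<in> closed_segment (charvec n x) (charvec n y)"
        "r \<in> open_segment p q" for p q r
    proof -
      from p obtain lp where lp: "\<And>s. s \<in> PSBT n \<Longrightarrow> 0 \<le> lp s" "sum lp (PSBT n) = 1"
        "p = (\<Sum>s\<in>PSBT n. lp s *\<^sub>R charvec n s)" using PSB_weights[OF n2] by metis
      from q obtain lq where lq: "\<And>s. s \<in> PSBT n \<Longrightarrow> 0 \<le> lq s" "sum lq (PSBT n) = 1"
        "q = (\<Sum>s\<in>PSBT n. lq s *\<^sub>R charvec n s)" using PSB_weights[OF n2] by metis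
      from r(2) obtain e where e: "0 < e" "e < 1" "r = (1 - e) *\<^sub>R p + e *\<^sub>R q"
        unfolding in_segment by blast
      from r(1) obtain t where t: "r = (1 - t) *\<^sub>R charvec n x + t *\<^sub>R charvec n y"
        unfolding in_segment by blast
      \<comment> \<open>Weights of \<open>r\<close>. As \<open>0 < e < 1\<close>, every tour used by
        \<open>p\<close> or by \<open>q\<close> has positive weight in \<open>r\<close>, so the
        support of \<open>r\<close> controls both.\<close>
      define l where "l s = (1 - e) * lp s + e * lq s" for s
      have l0: "0 \<le> l s" if "s \<in> PSBT n" for s using lp(1)[OF that] lq(1)[OF that] e by (simp add: l_def)
      have "(\<Sum>s\<in>PSBT n. l s *\<^sub>R charvec n s) = r"
        unfolding e lp(3) lq(3) l_def
        by (simp add: scaleR_add_left sum.distrib scaleR_sum_right)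
      then have m: "mixing n x y {s\<in>PSBT n. 0 < l s}"
        using mixing_of_segment_point[OF n x y l0] t by simp
      have sub: "s = x \<or> s = y" if "s \<in> PSBT n" "0 < l s" for s
        using mixing_trivial[OF m _ conn] that by blast
      have pos: "0 < l s" if s: "s \<in> PSBT n" "0 < lp s \<or> 0 < lq s" for s
        using s lp(1)[OF s(1)] lq(1)[OF s(1)] e
        unfolding l_def by (metis add_nonneg_pos add_pos_nonneg diff_gt_0_iff_gt less_eq_real_def mult_nonneg_nonneg mult_pos_pos)
      have xT: "x \<in> PSBT n" "y \<in> PSBT n" using x y PSBT_iff_psb[OF n2] by auto
      have seg: "(\<Sum>s\<in>PSBT n. k s *\<^sub>R charvec n s) \<in> closed_segment (charvec n x) (charvec n y)"
        if k: "\<And>s. s \<in> PSBT n \<Longrightarrow> 0 \<le> k s" "sum k (PSBT n) = 1"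
          "\<And>s. s \<in> PSBT n \<Longrightarrow> 0 < k s \<Longrightarrow> s = x \<or> s = y" for k
      proof -
        have z: "k s = 0" if "s \<in> PSBT n - {x, y}" for s
          using k(1)[of s] k(3)[of s] that by fastforce
        have "sum k {x, y} = sum k (PSBT n)"
          by (rule sum.mono_neutral_left) (use z xT finite_PSBT in auto)
        then have 1: "k x + k y = 1" using k(2) xy by simp
        have "(\<Sum>s\<in>{x, y}. k s *\<^sub>R charvec n s) = (\<Sum>s\<in>PSBT n. k s *\<^sub>R charvec n s)"
          by (rule sum.mono_neutral_left) (use z xT finite_PSBT in auto)
        then have "(\<Sum>s\<in>PSBT n. k s *\<^sub>R charvec n s) = (1 - k y) *\<^sub>R charvec n x + k y *\<^sub>R charvec n y"
          using xy 1 by (simp add: eq_diff_eq[symmetric])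
        moreover have "k y \<le> 1" "0 \<le> k y" using 1 k(1)[OF xT(1)] k(1)[OF xT(2)] by linarith+
        ultimately show ?thesis unfolding in_segment by blast
      qed
      have xy_only: "s = x \<or> s = y" if "s \<in> PSBT n" "0 < lp s \<or> 0 < lq s" for s
        using sub[OF that(1) pos[OF that]] .
      have "p \<in> closed_segment (charvec n x) (charvec n y)"
        unfolding lp(3) by (rule seg) (use lp(1,2) xy_only in auto)
      moreover have "q \<in> closed_segment (charvec n x) (charvec n y)"
        unfolding lq(3) by (rule seg) (use lq(1,2) xy_only in auto)
      ultimately show ?thesis ..
    qed
    ultimately have "closed_segment (charvec n x) (charvec n y) face_of PSB n"
      unfolding face_of_def by (intro conjI ballI impI convex_closed_segment) blast+
    then show ?adj using xy charvec_inj[OF x y] by (auto simp: adjacent_vertices_def)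
  }
qed

section \<open>A structured language on top of the instruction set\<close>

fun straight :: "instr \<Rightarrow> bool" where
  "straight (Jz r l) = False"
| "straight Halt = False"
| "straight i = True"

definition effect :: "instr \<Rightarrow> (nat \<Rightarrow> int) \<Rightarrow> nat \<Rightarrow> int" where
  "effect i m = snd (exec i (0, m))"

lemma effect_simps [simp]:
  "effect (Const r k) m = m(r := k)"
  "effect (Add r a b) m = m(r := m a + m b)"
  "effect (Sub r a b) m = m(r := m a - m b)"
  "effect (Load r a) m = m(r := m (nat (m a)))"
  "effect (Store a b) m = m(nat (m a) := m b)"
  by (simp_all add: effect_def)

definition code_at :: "instr list \<Rightarrow> nat \<Rightarrow> instr list \<Rightarrow> bool" where
  "code_at P b p \<longleftrightarrow> (\<forall>i<length p. b + i < length P \<and> P ! (b + i) = p ! i)"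

lemma code_at_Nil [simp]: "code_at P b []"
  by (simp add: code_at_def)

lemma code_at_Cons [simp]:
  "code_at P b (i # p) \<longleftrightarrow> b < length P \<and> P ! b = i \<and> code_at P (Suc b) p"
  by (auto simp: code_at_def less_Suc_eq_0_disj)

lemma code_at_append [simp]:
  "code_at P b (p @ q) \<longleftrightarrow> code_at P b p \<and> code_at P (b + length p) q"
  by (induction p arbitrary: b) auto

lemma code_at_self: "code_at (p @ q @ r) (length p) q"
  by (auto simp: code_at_def nth_append)

definition reach :: "instr list \<Rightarrow> nat \<Rightarrow> config \<Rightarrow> config \<Rightarrow> bool" where
  "reach P t c d \<longleftrightarrow> (step P ^^ t) c = d"

lemma reach_0 [simp]: "reach P 0 c d \<longleftrightarrow> c = d"
  by (simp add: reach_def)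

lemma reach_trans: "reach P t c d \<Longrightarrow> reach P u d e \<Longrightarrow> reach P (t + u) c e"
  using funpow_add[of u t "step P"] by (auto simp: reach_def add.commute)

lemma reach_step:
  assumes "b < length P" "P ! b = i" "i \<noteq> Halt"
  shows "reach P 1 (b, m) (exec i (b, m))"
  using assms by (simp add: reach_def step_def halted_def)

lemma exec_straight: "straight i \<Longrightarrow> exec i (b, m) = (Suc b, effect i m)"
  by (cases i) (auto simp: effect_def)

lemma reach_straight:
  "code_at P b p \<Longrightarrow> list_all straight p \<Longrightarrow> reach P (length p) (b, m) (b + length p, fold effect p m)"
proof (induction p arbitrary: b m)
  case (Cons i p)
  have "reach P 1 (b, m) (Suc b, effect i m)"
    using reach_step[of b P i m] exec_straight[of i b m] Cons.prems by (cases i) auto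
  moreover have "reach P (length p) (Suc b, effect i m) (Suc b + length p, fold effect p (effect i m))"
    using Cons.IH[of "Suc b" "effect i m"] Cons.prems by simp
  ultimately show ?case using reach_trans by fastforce
qed simp

section \<open>Commands, weakest preconditions and compilation\<close>

datatype loc = Reg nat | Arr nat nat | Raw nat

datatype aop =
    SetC nat int
  | Plus nat nat nat
  | Minus nat nat nat
  | Size nat
  | Get nat nat nat
  | Put nat nat nat
  | Fetch nat nat

datatype com =
    Op aop
  | Seq com com  (infixr ";;" 60)
  | IfZ nat com com
  | Loop nat com

fun target :: "aop \<Rightarrow> nat set" where
  "target (SetC r k) = {r}"
| "target (Plus r a b) = {r}"
| "target (Minus r a b) = {r}"
| "target (Size r) = {r}"
| "target (Get r c i) = {r}"
| "target (Put c i a) = {}"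
| "target (Fetch r i) = {r}"

fun writes :: "com \<Rightarrow> nat set" where
  "writes (Op f) = target f"
| "writes (c ;; d) = writes c \<union> writes d"
| "writes (IfZ r c d) = writes c \<union> writes d"
| "writes (Loop r c) = insert r (writes c)"

fun op_ok :: "aop \<Rightarrow> bool" where
  "op_ok (SetC r k) = (r < 10)"
| "op_ok (Plus r a b) = (r < 10 \<and> a < 10 \<and> b < 10)"
| "op_ok (Minus r a b) = (r < 10 \<and> a < 10 \<and> b < 10)"
| "op_ok (Size r) = (r < 10)"
| "op_ok (Get r c i) = (r < 10 \<and> c < 16 \<and> i < 10)"
| "op_ok (Put c i a) = (c < 16 \<and> i < 10 \<and> a < 10)"
| "op_ok (Fetch r i) = (r < 10 \<and> i < 10)"

fun com_ok :: "com \<Rightarrow> bool" where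
  "com_ok (Op f) = op_ok f"
| "com_ok (c ;; d) = (com_ok c \<and> com_ok d)"
| "com_ok (IfZ r c d) = (r < 10 \<and> com_ok c \<and> com_ok d)"
| "com_ok (Loop r c) = (r < 10 \<and> r \<notin> writes c \<and> com_ok c)"

fun op_pre :: "nat \<Rightarrow> aop \<Rightarrow> (loc \<Rightarrow> int) \<Rightarrow> bool" where
  "op_pre n (Get r c i) s = (1 \<le> s (Reg i))"
| "op_pre n (Put c i a) s = (1 \<le> s (Reg i))"
| "op_pre n (Fetch r i) s = (16 \<le> s (Reg i) \<and> s (Reg i) < 16 * int n)"
| "op_pre n f s = True"

fun op_post :: "nat \<Rightarrow> aop \<Rightarrow> (loc \<Rightarrow> int) \<Rightarrow> loc \<Rightarrow> int" where
  "op_post n (SetC r k) s = s(Reg r := k)"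
| "op_post n (Plus r a b) s = s(Reg r := s (Reg a) + s (Reg b))"
| "op_post n (Minus r a b) s = s(Reg r := s (Reg a) - s (Reg b))"
| "op_post n (Size r) s = s(Reg r := int n)"
| "op_post n (Get r c i) s = s(Reg r := s (Arr c (nat (s (Reg i)))))"
| "op_post n (Put c i a) s = s(Arr c (nat (s (Reg i))) := s (Reg a))"
| "op_post n (Fetch r i) s = s(Reg r := s (Raw (nat (s (Reg i)))))"

text \<open>A loop runs its body for the counter values n, ..., 1; in the rule, J k describes the state when k
  iterations remain and must not depend on the counter register.\<close>

fun wp :: "nat \<Rightarrow> com \<Rightarrow> ((loc \<Rightarrow> int) \<Rightarrow> bool) \<Rightarrow> (loc \<Rightarrow> int) \<Rightarrow> bool" where
  "wp n (Op f) Q s = (op_pre n f s \<and> Q (op_post n f s))"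
| "wp n (c ;; d) Q s = wp n c (wp n d Q) s"
| "wp n (IfZ r c d) Q s = (if s (Reg r) = 0 then wp n c Q s else wp n d Q s)"
| "wp n (Loop r c) Q s = (\<exists>J. J n s \<and>
     (\<forall>k t. k < n \<longrightarrow> J (Suc k) t \<longrightarrow> wp n c (J k) (t(Reg r := int (Suc k)))) \<and>
     (\<forall>t. J 0 t \<longrightarrow> Q (t(Reg r := 0))))"

text \<open>Four doublings multiply the index by 16. Cell 1 holds \<open>16 * (n - 1)\<close>, which
  also makes up for indices starting at 1.\<close>

definition address :: "nat \<Rightarrow> nat \<Rightarrow> instr list" where
  "address c i = [Add 4 (6 + i) (6 + i), Add 4 4 4, Add 4 4 4, Add 4 4 4, Add 4 4 1, Const 5 (int c), Add 4 4 5]"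

fun comp_op :: "aop \<Rightarrow> instr list" where
  "comp_op (SetC r k) = [Const (6 + r) k]"
| "comp_op (Plus r a b) = [Add (6 + r) (6 + a) (6 + b)]"
| "comp_op (Minus r a b) = [Sub (6 + r) (6 + a) (6 + b)]"
| "comp_op (Size r) = [Add (6 + r) 0 2]"
| "comp_op (Get r c i) = address c i @ [Load (6 + r) 4]"
| "comp_op (Put c i a) = address c i @ [Store 4 (6 + a)]"
| "comp_op (Fetch r i) = [Load (6 + r) (6 + i)]"

text \<open>Jump targets are absolute, hence the start address \<open>b\<close>. Cell 2 always holds
  0, so \<open>Jz 2\<close> jumps unconditionally, and adding cells 0 and 2 copies
  \<open>n\<close>.\<close>

fun comp_com :: "nat \<Rightarrow> com \<Rightarrow> instr list" where
  "comp_com b (Op f) = comp_op f"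
| "comp_com b (c ;; d) = comp_com b c @ comp_com (b + length (comp_com b c)) d"
| "comp_com b (IfZ r c d) =
     (let q = comp_com (b + 1) d; e = b + 1 + length q + 1; p = comp_com e c in
      Jz (6 + r) e # q @ Jz 2 (e + length p) # p)"
| "comp_com b (Loop r c) =
     (let p = comp_com (b + 2) c in
      Add (6 + r) 0 2 # Jz (6 + r) (b + 4 + length p) # p @ [Sub (6 + r) (6 + r) 3, Jz 2 (b + 1)])"

text \<open>8 is the length of the longest operation, seven instructions for an address and one
  access. A loop round adds test, decrement and jump back to its body; the final 2 pays for setting
  the counter and for the last test.\<close>

fun cost :: "nat \<Rightarrow> com \<Rightarrow> nat" where
  "cost n (Op f) = 8"
| "cost n (c ;; d) = cost n c + cost n d"
| "cost n (IfZ r c d) = cost n c + cost n d + 2"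
| "cost n (Loop r c) = n * (cost n c + 3) + 2"

text \<open>Arrays are interleaved with stride 16 beyond address 16 n, so that no array base depends on the size
  of another array. Cells 0 to 3 hold constants, 4 and 5 are scratch, 6 to 15 are the registers.
  Array indices start at 1.\<close>

definition rep :: "nat \<Rightarrow> (loc \<Rightarrow> int) \<Rightarrow> (nat \<Rightarrow> int) \<Rightarrow> bool" where
  "rep n s m \<longleftrightarrow> m 0 = int n \<and> m 1 = 16 * (int n - 1) \<and> m 2 = 0 \<and> m 3 = 1 \<and>
     (\<forall>r<10. m (6 + r) = s (Reg r)) \<and>
     (\<forall>c<16. \<forall>i. m (16 * (n + i) + c) = s (Arr c (Suc i))) \<and>
     (\<forall>j. 16 \<le> j \<longrightarrow> j < 16 * n \<longrightarrow> m j = s (Raw j))"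

section \<open>Correctness of the compiled code\<close>

lemma repD:
  assumes "rep n s m"
  shows "m 0 = int n" "m (Suc 0) = 16 * (int n - 1)" "m 2 = 0" "m 3 = 1"
    "r < 10 \<Longrightarrow> m (6 + r) = s (Reg r)"
    "c < 16 \<Longrightarrow> m (16 * (n + i) + c) = s (Arr c (Suc i))"
    "16 \<le> j \<Longrightarrow> j < 16 * n \<Longrightarrow> m j = s (Raw j)"
  using assms by (auto simp: rep_def)

lemma rep_set_reg:
  assumes "rep n s m" "1 \<le> n" "r < 10"
  shows "rep n (s(Reg r := k)) (m(6 + r := k))"
  using assms by (auto simp: rep_def)

lemma rep_set_tmp:
  assumes r: "rep n s m" and n: "1 \<le> n" and q: "q = 4 \<or> q = 5"
  shows "rep n s (m(q := k))"
proof -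
  have "q \<noteq> 0" "q \<noteq> 1" "q \<noteq> 2" "q \<noteq> 3" "6 + r \<noteq> q" "16 * (n + i) + c \<noteq> q" "16 \<le> j \<Longrightarrow> j \<noteq> q" for r i c j
    using q n by auto
  then show ?thesis using r unfolding rep_def by simp
qed

lemma rep_set_arr:
  assumes r: "rep n s m" and n: "1 \<le> n" and c: "c < 16"
  shows "rep n (s(Arr c (Suc i) := k)) (m(16 * (n + i) + c := k))"
proof -
  define a where "a = 16 * (n + i) + c"
  \<comment> \<open>Division with remainder by the stride: distinct array entries have distinct
    cells.\<close>
  have "16 * (n + j) + d = a \<longleftrightarrow> j = i \<and> d = c" if "d < 16" for j d
    using that c unfolding a_def by (cases j i rule: linorder_cases) auto
  moreover have "0 \<noteq> a" "1 \<noteq> a" "2 \<noteq> a" "3 \<noteq> a" "r < 10 \<Longrightarrow> 6 + r \<noteq> a" "j < 16 * n \<Longrightarrow> j \<noteq> a" for r j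
    using n by (auto simp: a_def)
  ultimately show ?thesis
    using r unfolding rep_def a_def[symmetric] by (auto simp: fun_upd_def)
qed

lemma rep_comp_op:
  assumes r: "rep n s m" and n: "1 \<le> n" and ok: "op_ok f" and pre: "op_pre n f s"
  shows "rep n (op_post n f s) (fold effect (comp_op f) m)"
proof -
  have addr: "rep n s (fold effect (address c i) m) \<and>
      nat (fold effect (address c i) m 4) = 16 * (n + (nat (s (Reg i)) - 1)) + c"
    if i: "i < 10" "1 \<le> s (Reg i)" for c i
  proof -
    define v where "v = s (Reg i)"
    have mi: "m (6 + i) = v" using repD(5)[OF r i(1)] by (simp add: v_def)
    have rp: "rep n s (fold effect (address c i) m)"
      unfolding address_def by (simp; intro rep_set_tmp r n; simp)
    have a4: "fold effect (address c i) m 4 = 16 * v + 16 * (int n - 1) + int c"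
      using mi repD(2)[OF r] by (simp add: address_def)
    obtain w where w: "v = int (Suc w)"
      by (rule that[of "nat (v - 1)"]) (use i(2) in \<open>simp add: v_def\<close>)
    have "fold effect (address c i) m 4 = int (16 * (n + w) + c)" unfolding a4 w by simp
    then have "nat (fold effect (address c i) m 4) = 16 * (n + (nat v - 1)) + c"
      using w by (simp only: nat_int) simp
    with rp show ?thesis by (simp add: v_def)
  qed
  show ?thesis
  proof (cases f)
    case (SetC q k)
    then show ?thesis using rep_set_reg[OF r n] ok by simp
  next
    case (Plus q a b)
    then show ?thesis using rep_set_reg[OF r n] repD(5)[OF r] ok by simp
  next
    case (Minus q a b)
    then show ?thesis using rep_set_reg[OF r n] repD(5)[OF r] ok by simp
  next
    case (Size q)
    then show ?thesis using rep_set_reg[OF r n] repD[OF r] ok by simp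
  next
    case (Get q c i)
    define m' where "m' = fold effect (address c i) m"
    have m': "rep n s m'" "nat (m' 4) = 16 * (n + (nat (s (Reg i)) - 1)) + c"
      using addr[of i c] Get ok pre by (auto simp: m'_def)
    have "m' (nat (m' 4)) = s (Arr c (nat (s (Reg i))))"
      using repD(6)[OF m'(1), of c "nat (s (Reg i)) - 1"] m'(2) Get ok pre by simp
    then show ?thesis using rep_set_reg[OF m'(1) n] Get ok by (simp add: m'_def)
  next
    case (Put c i a)
    define m' where "m' = fold effect (address c i) m"
    have m': "rep n s m'" "nat (m' 4) = 16 * (n + (nat (s (Reg i)) - 1)) + c"
      using addr[of i c] Put ok pre by (auto simp: m'_def)
    then show ?thesis
      using rep_set_arr[OF m'(1) n, of c "nat (s (Reg i)) - 1"] Put ok pre repD(5)[OF m'(1), of a]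
      by (simp add: m'_def)
  next
    case (Fetch q i)
    have "16 \<le> nat (s (Reg i))" "nat (s (Reg i)) < 16 * n"
      using Fetch pre by simp_all linarith+
    then have "m (nat (m (6 + i))) = s (Raw (nat (s (Reg i))))"
      using repD(5)[OF r, of i] repD(7)[OF r, of "nat (s (Reg i))"] Fetch ok pre by simp
    then show ?thesis using rep_set_reg[OF r n] Fetch ok by simp
  qed
qed

text \<open>The clause on registers outside \<open>writes c\<close> serves the loop case: the
  compiled loop decrements its counter in memory, and the value found there after the body is known
  only because the body does not write it.\<close>

lemma wp_sound:
  assumes n: "1 \<le> n"
  shows "com_ok c \<Longrightarrow> code_at P b (comp_com b c) \<Longrightarrow> rep n s m \<Longrightarrow> wp n c Q s \<Longrightarrow>
    \<exists>t s' m'. t \<le> cost n c \<and> reach P t (b, m) (b + length (comp_com b c), m') \<and> rep n s' m' \<and> Q s' \<and>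
      (\<forall>r. r \<notin> writes c \<longrightarrow> s' (Reg r) = s (Reg r))"
proof (induction c arbitrary: b s m Q)
  case (Op f)
  have "list_all straight (comp_op f)" by (cases f) (auto simp: address_def)
  moreover have "length (comp_op f) \<le> 8" by (cases f) (auto simp: address_def)
  moreover have "\<forall>r. r \<notin> target f \<longrightarrow> op_post n f s (Reg r) = s (Reg r)" by (cases f) auto
  ultimately show ?case
    using reach_straight[of P b "comp_op f" m] rep_comp_op[OF Op(3) n, of f] Op by auto
next
  case (Seq c d)
  let ?b = "b + length (comp_com b c)"
  from Seq.prems Seq.IH(1)[of b s m "wp n d Q"] obtain t s1 m1
    where 1: "t \<le> cost n c" "reach P t (b, m) (?b, m1)" "rep n s1 m1" "wp n d Q s1"
      "\<forall>r. r \<notin> writes c \<longrightarrow> s1 (Reg r) = s (Reg r)" by auto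
  from Seq.prems 1 Seq.IH(2)[of ?b s1 m1 Q] obtain u s2 m2
    where 2: "u \<le> cost n d" "reach P u (?b, m1) (?b + length (comp_com ?b d), m2)" "rep n s2 m2" "Q s2"
      "\<forall>r. r \<notin> writes d \<longrightarrow> s2 (Reg r) = s1 (Reg r)" by auto
  have "reach P (t + u) (b, m) (b + length (comp_com b (c ;; d)), m2)"
    using reach_trans[OF 1(2) 2(2)] by (simp add: add.assoc)
  moreover have "t + u \<le> cost n (c ;; d)" using 1 2 by simp
  ultimately show ?case using 1(5) 2(3,4,5) by (intro exI[of _ "t + u"] exI[of _ s2] exI[of _ m2]) simp
next
  case (IfZ r c d)
  define q where "q = comp_com (b + 1) d"
  define e where "e = b + 1 + length q + 1"
  define p where "p = comp_com e c"
  have code: "comp_com b (IfZ r c d) = Jz (6 + r) e # q @ Jz 2 (e + length p) # p"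
    by (simp add: Let_def q_def e_def p_def)
  have at: "b < length P" "P ! b = Jz (6 + r) e" "code_at P (b + 1) q"
    "b + 1 + length q < length P" "P ! (b + 1 + length q) = Jz 2 (e + length p)" "code_at P e p"
    using IfZ.prems(2) unfolding code by (auto simp: e_def)
  have len: "b + length (comp_com b (IfZ r c d)) = e + length p"
    unfolding code by (simp add: e_def)
  have mr: "m (6 + r) = s (Reg r)" using repD(5)[OF IfZ.prems(3)] IfZ.prems(1) by simp
  show ?case
  proof (cases "s (Reg r) = 0")
    case True
    have 1: "reach P 1 (b, m) (e, m)" using reach_step[OF at(1,2), of m] mr True by simp
    from IfZ.prems True at IfZ.IH(1)[of e s m Q] obtain t s' m'
      where 2: "t \<le> cost n c" "reach P t (e, m) (e + length p, m')" "rep n s' m'" "Q s'"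
        "\<forall>r. r \<notin> writes c \<longrightarrow> s' (Reg r) = s (Reg r)" by (auto simp: p_def)
    show ?thesis
      unfolding len using reach_trans[OF 1 2(2)] 2
      by (intro exI[of _ "1 + t"] exI[of _ s'] exI[of _ m']) simp
  next
    case False
    have 1: "reach P 1 (b, m) (b + 1, m)" using reach_step[OF at(1,2), of m] mr False by simp
    from IfZ.prems False at IfZ.IH(2)[of "b + 1" s m Q] obtain t s' m'
      where 2: "t \<le> cost n d" "reach P t (b + 1, m) (b + 1 + length q, m')" "rep n s' m'" "Q s'"
        "\<forall>r. r \<notin> writes d \<longrightarrow> s' (Reg r) = s (Reg r)" by (auto simp: q_def)
    have 3: "reach P 1 (b + 1 + length q, m') (e + length p, m')"
      using reach_step[OF at(4,5), of m'] repD(3)[OF 2(3)] by simp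
    show ?thesis
      unfolding len using reach_trans[OF reach_trans[OF 1 2(2)] 3] 2
      by (intro exI[of _ "1 + t + 1"] exI[of _ s'] exI[of _ m']) simp
  qed
next
  case (Loop r c)
  define p where "p = comp_com (b + 2) c"
  have code: "comp_com b (Loop r c) =
      Add (6 + r) 0 2 # Jz (6 + r) (b + 4 + length p) # p @ [Sub (6 + r) (6 + r) 3, Jz 2 (b + 1)]"
    by (simp add: Let_def p_def)
  have at: "b < length P" "P ! b = Add (6 + r) 0 2" "b + 1 < length P"
    "P ! (b + 1) = Jz (6 + r) (b + 4 + length p)" "code_at P (b + 2) p"
    "b + 2 + length p < length P" "P ! (b + 2 + length p) = Sub (6 + r) (6 + r) 3"
    "b + 3 + length p < length P" "P ! (b + 3 + length p) = Jz 2 (b + 1)"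
    using Loop.prems(2) unfolding code by (auto simp: eval_nat_numeral)
  have r: "r < 10" "r \<notin> writes c" "com_ok c" using Loop.prems(1) by auto
  from Loop.prems(4) obtain J where J: "J n s"
    "\<And>k t. k < n \<Longrightarrow> J (Suc k) t \<Longrightarrow> wp n c (J k) (t(Reg r := int (Suc k)))"
    "\<And>t. J 0 t \<Longrightarrow> Q (t(Reg r := 0))" by auto
  have loop: "\<exists>t s' m'. t \<le> k * (cost n c + 3) + 1 \<and> reach P t (b + 1, m1) (b + 4 + length p, m') \<and>
      rep n (s'(Reg r := 0)) m' \<and> J 0 s' \<and> (\<forall>q. q \<notin> insert r (writes c) \<longrightarrow> s' (Reg q) = s1 (Reg q))"
    if "k \<le> n" "J k s1" "rep n (s1(Reg r := int k)) m1" for k s1 m1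
    using that
  proof (induction k arbitrary: s1 m1)
    case 0
    have "m1 (6 + r) = 0" using repD(5)[OF 0(3) r(1)] by simp
    then have "reach P 1 (b + 1, m1) (b + 4 + length p, m1)"
      using reach_step[OF at(3,4), of m1] by simp
    then show ?case using 0 by (intro exI[of _ 1] exI[of _ s1] exI[of _ m1]) simp
  next
    case (Suc k)
    have "m1 (6 + r) = int (Suc k)" using repD(5)[OF Suc.prems(3) r(1)] by simp
    then have 1: "reach P 1 (b + 1, m1) (b + 2, m1)"
      using reach_step[OF at(3,4), of m1] by simp
    have "wp n c (J k) (s1(Reg r := int (Suc k)))" using J(2) Suc.prems by simp
    from Loop.IH[OF r(3) _ Suc.prems(3) this, of "b + 2"] at(5) obtain t s2 m2
      where 2: "t \<le> cost n c" "reach P t (b + 2, m1) (b + 2 + length p, m2)" "rep n s2 m2" "J k s2"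
        "\<forall>q. q \<notin> writes c \<longrightarrow> s2 (Reg q) = (s1(Reg r := int (Suc k))) (Reg q)"
      by (auto simp: p_def)
    let ?m3 = "m2(6 + r := int k)"
    have "s2 (Reg r) = int (Suc k)" using 2(5) r by simp
    then have "m2 (6 + r) - m2 3 = int k" using repD(4,5)[OF 2(3)] r by simp
    then have 3: "reach P 1 (b + 2 + length p, m2) (b + 3 + length p, ?m3)"
      using reach_step[OF at(6,7), of m2] by (simp add: numeral_3_eq_3)
    have m3: "rep n (s2(Reg r := int k)) ?m3" by (rule rep_set_reg[OF 2(3) n r(1)])
    have 4: "reach P 1 (b + 3 + length p, ?m3) (b + 1, ?m3)"
      using reach_step[OF at(8,9), of ?m3] repD(3)[OF m3] by simp
    have "k \<le> n" using Suc.prems(1) by simp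
    from Suc.IH[OF this 2(4) m3] obtain u s' m'
      where 5: "u \<le> k * (cost n c + 3) + 1" "reach P u (b + 1, ?m3) (b + 4 + length p, m')"
        "rep n (s'(Reg r := 0)) m'" "J 0 s'"
        "\<forall>q. q \<notin> insert r (writes c) \<longrightarrow> s' (Reg q) = s2 (Reg q)" by blast
    have "reach P (1 + t + 1 + 1 + u) (b + 1, m1) (b + 4 + length p, m')"
      using reach_trans[OF reach_trans[OF reach_trans[OF reach_trans[OF 1 2(2)] 3] 4] 5(2)] .
    moreover have "1 + t + 1 + 1 + u \<le> Suc k * (cost n c + 3) + 1" using 2(1) 5(1) by simp
    moreover have "\<forall>q. q \<notin> insert r (writes c) \<longrightarrow> s' (Reg q) = s1 (Reg q)"
      using 5(5) 2(5) by simp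
    ultimately show ?case using 5(3,4) by blast
  qed
  have "reach P 1 (b, m) (b + 1, m(6 + r := int n))"
    using reach_step[OF at(1,2), of m] repD(1,3)[OF Loop.prems(3)] by simp
  moreover from loop[OF le_refl J(1) rep_set_reg[OF Loop.prems(3) n r(1)]] obtain t s' m'
    where 2: "t \<le> n * (cost n c + 3) + 1" "reach P t (b + 1, m(6 + r := int n)) (b + 4 + length p, m')"
      "rep n (s'(Reg r := 0)) m'" "J 0 s'"
      "\<forall>q. q \<notin> insert r (writes c) \<longrightarrow> s' (Reg q) = s (Reg q)" by blast
  ultimately have "reach P (1 + t) (b, m) (b + 4 + length p, m')" using reach_trans by blast
  moreover have "b + length (comp_com b (Loop r c)) = b + 4 + length p"
    unfolding code by simp
  moreover have "1 + t \<le> cost n (Loop r c)" using 2(1) by simp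
  moreover have "\<forall>q. q \<notin> writes (Loop r c) \<longrightarrow> (s'(Reg r := 0)) (Reg q) = s (Reg q)"
    using 2(5) by simp
  ultimately show ?case using 2(3) J(3)[OF 2(4)] by metis
qed

section \<open>Moving the input out of the register cells\<close>

text \<open>All cells used as registers contain input at the start, and only cell 0 has a known value. Since the
  successor of 1 lies between 1 and n, adding n twice to cell 1 gives an address beyond the input,
  where cell 2 can be parked; this frees the first register without losing anything.\<close>

definition prologue :: "instr list" where
  "prologue =
     [Add 1 1 0, Add 1 1 0, Store 1 2, Add 2 0 0, Sub 1 1 2,
      Add 2 2 2, Add 2 2 2, Add 2 2 2, Store 2 1,
      Add 2 0 0, Add 2 2 1, Load 2 2,
      Const 1 1, Add 1 1 0, Add 1 1 1, Add 1 1 1, Add 1 1 1, Add 1 1 1, Store 1 2, Const 2 16]"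

definition save_cells :: "nat \<Rightarrow> instr list" where
  "save_cells k = concat (map (\<lambda>j. [Add 1 1 2, Store 1 j]) [3..<3 + k])"

text \<open>The prologue has moved cells 1 and 2, so 13 cells remain, 3 to 15. Cell 1 then contains
  \<open>16 * (n + 14)\<close>, and subtracting \<open>240 = 16 * 15\<close> leaves the constant
  \<open>16 * (n - 1)\<close> required by \<open>rep\<close>.\<close>

definition startup :: "instr list" where
  "startup = prologue @ save_cells 13 @ [Const 2 240, Sub 1 1 2, Const 2 0, Const 3 1]"

text \<open>Cell \<open>2 * n + a\<close> keeps a stale copy of cell 2. By the bounds on
  \<open>a\<close> it lies beyond the input and before the arrays, so its final content may be left
  open.\<close>

lemma prologue_effect:
  assumes n: "3 \<le> n" and m: "m 0 = int n" and x1: "m 1 = int a" "1 \<le> a" "a \<le> n"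
    and M: "M = fold effect prologue m"
  shows "M 0 = int n" "M 1 = int (16 * (n + 1))" "M 2 = 16" "M (16 * n) = m 1" "M (16 * (n + 1)) = m 2"
    "\<And>j. 2 < j \<Longrightarrow> j \<noteq> 2 * n + a \<Longrightarrow> j \<noteq> 16 * n \<Longrightarrow> j \<noteq> 16 * (n + 1) \<Longrightarrow> M j = m j"
proof -
  let ?b = "2 * n + a" and ?c = "16 * n" and ?d = "16 * (n + 1)"
  have ne: "?b \<noteq> 0" "?b \<noteq> 1" "?b \<noteq> 2" "?c \<noteq> 0" "?c \<noteq> 1" "?c \<noteq> 2" "?d \<noteq> 0" "?d \<noteq> 1" "?d \<noteq> 2"
    "?b \<noteq> ?c" "?b \<noteq> ?d" "?c \<noteq> ?d" using n x1 by auto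
  define m1 where "m1 = m(1 := int ?b, ?b := m 2)"
  have 1: "fold effect [Add 1 1 0, Add 1 1 0, Store 1 2] m = m1"
  proof -
    have "fold effect [Add 1 1 0, Add 1 1 0] m = m(1 := int ?b)"
      using m x1 by (auto simp: fun_eq_iff)
    then show ?thesis using ne by (simp add: m1_def nat_int del: of_nat_add of_nat_mult)
  qed
  define m2 where "m2 = m1(2 := int ?c, 1 := int a, ?c := int a)"
  have 2: "fold effect [Add 2 0 0, Sub 1 1 2, Add 2 2 2, Add 2 2 2, Add 2 2 2, Store 2 1] m1 = m2"
  proof -
    have "fold effect [Add 2 0 0, Sub 1 1 2, Add 2 2 2, Add 2 2 2, Add 2 2 2] m1 = m1(2 := int ?c, 1 := int a)"
      using m ne by (auto simp: fun_eq_iff m1_def)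
    then show ?thesis using ne by (simp add: m2_def nat_int del: of_nat_add of_nat_mult)
  qed
  define m3 where "m3 = m2(2 := m 2)"
  have 3: "fold effect [Add 2 0 0, Add 2 2 1, Load 2 2] m2 = m3"
  proof -
    have "fold effect [Add 2 0 0, Add 2 2 1] m2 = m2(2 := int ?b)"
      using m ne by (auto simp: fun_eq_iff m2_def m1_def)
    moreover have "m2 ?b = m 2" using ne by (simp add: m2_def m1_def)
    ultimately show ?thesis using ne by (simp add: m3_def nat_int del: of_nat_add of_nat_mult)
  qed
  define m4 where "m4 = m3(1 := int ?d, ?d := m 2, 2 := 16)"
  have 4: "fold effect [Const 1 1, Add 1 1 0, Add 1 1 1, Add 1 1 1, Add 1 1 1, Add 1 1 1, Store 1 2, Const 2 16] m3 = m4"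
  proof -
    have "fold effect [Const 1 1, Add 1 1 0, Add 1 1 1, Add 1 1 1, Add 1 1 1, Add 1 1 1] m3 = m3(1 := int ?d)"
      using m ne by (auto simp: fun_eq_iff m3_def m2_def m1_def)
    moreover have "m3 2 = m 2" by (simp add: m3_def)
    ultimately show ?thesis using ne by (simp add: m4_def nat_int del: of_nat_add of_nat_mult)
  qed
  have "M = m4"
    unfolding M prologue_def using 1 2 3 4 by simp
  then have M': "M = m(1 := int ?b, ?b := m 2, 2 := int ?c, 1 := int a, ?c := int a, 2 := m 2, 1 := int ?d, ?d := m 2, 2 := 16)"
    by (simp add: m4_def m3_def m2_def m1_def)
  define b c d where bcd: "b = ?b" "c = ?c" "d = ?d"
  note ne' = ne[folded bcd] and M'' = M'[folded bcd]
  show "M 0 = int n" "M 1 = int ?d" "M 2 = 16" "M ?c = m 1" "M ?d = m 2"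
    unfolding bcd[symmetric] M'' x1(1) using ne' m by simp_all
  show "M j = m j" if "2 < j" "j \<noteq> ?b" "j \<noteq> ?c" "j \<noteq> ?d" for j
    using that unfolding bcd[symmetric] M'' by simp
qed

lemma save_cells_effect:
  assumes n: "3 \<le> n" and k: "k \<le> 13"
    and M: "M 0 = int n" "M 1 = int (16 * (n + 1))" "M 2 = 16"
  shows "fold effect (save_cells k) M 1 = int (16 * (n + 1 + k)) \<and>
    (\<forall>j. j \<noteq> 1 \<longrightarrow> (\<forall>i. 2 \<le> i \<longrightarrow> i < 2 + k \<longrightarrow> j \<noteq> 16 * (n + i)) \<longrightarrow> fold effect (save_cells k) M j = M j) \<and>
    (\<forall>i. 2 \<le> i \<longrightarrow> i < 2 + k \<longrightarrow> fold effect (save_cells k) M (16 * (n + i)) = M (Suc i))"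
  using k
proof (induction k)
  case 0
  then show ?case using M by (simp add: save_cells_def)
next
  case (Suc k)
  define m where "m = fold effect (save_cells k) M"
  have IH: "m 1 = int (16 * (n + 1 + k))"
    "\<And>j. j \<noteq> 1 \<Longrightarrow> (\<And>i. 2 \<le> i \<Longrightarrow> i < 2 + k \<Longrightarrow> j \<noteq> 16 * (n + i)) \<Longrightarrow> m j = M j"
    "\<And>i. 2 \<le> i \<Longrightarrow> i < 2 + k \<Longrightarrow> m (16 * (n + i)) = M (Suc i)"
    using Suc by (auto simp: m_def)
  have small: "m j = M j" if "j < 16" "j \<noteq> 1" for j
    by (rule IH(2)) (use that n in auto)
  have eq: "fold effect (save_cells (Suc k)) M = effect (Store 1 (3 + k)) (effect (Add 1 1 2) m)"
  proof -
    have "[3..<3 + Suc k] = [3..<3 + k] @ [3 + k]" by (simp only: add_Suc_right upt_Suc) simp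
    then have "save_cells (Suc k) = save_cells k @ [Add 1 1 2, Store 1 (3 + k)]"
      unfolding save_cells_def by (simp only: map_append concat_append) simp
    then show ?thesis by (simp add: m_def)
  qed
  have "effect (Add 1 1 2) m = m(1 := int (16 * (n + (2 + k))))"
    using IH(1) small[of 2] M(3) by simp
  then have m': "fold effect (save_cells (Suc k)) M =
      m(1 := int (16 * (n + (2 + k))), 16 * (n + (2 + k)) := M (3 + k))"
    unfolding eq using small[of "3 + k"] Suc.prems by (simp add: nat_int del: of_nat_add of_nat_mult)
  show ?case
    unfolding m'
  proof (intro conjI allI impI)
    fix i assume i: "2 \<le> i" "i < 2 + Suc k"
    show "(m(1 := int (16 * (n + (2 + k))), 16 * (n + (2 + k)) := M (3 + k))) (16 * (n + i)) = M (Suc i)"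
    proof (cases "i = 2 + k")
      case True
      then show ?thesis by (simp add: numeral_3_eq_3)
    next
      case False
      then show ?thesis using IH(3)[of i] i by simp
    qed
  next
    fix j assume j: "j \<noteq> 1" "\<forall>i. 2 \<le> i \<longrightarrow> i < 2 + Suc k \<longrightarrow> j \<noteq> 16 * (n + i)"
    have "j \<noteq> 16 * (n + (2 + k))" using j(2)[rule_format, of "2 + k"] by simp
    then show "(m(1 := int (16 * (n + (2 + k))), 16 * (n + (2 + k)) := M (3 + k))) j = M j"
      using IH(2)[of j] j by simp
  qed (use n in simp)
qed

text \<open>Input cells below 16 had to give way to constants and registers and are already entries
  of array 0; the others are still at their original addresses. The remaining arrays are zero
  because they lie beyond the input.\<close>

definition initial_state :: "nat \<Rightarrow> (nat \<Rightarrow> int) \<Rightarrow> (loc \<Rightarrow> int) \<Rightarrow> bool" where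
  "initial_state n inp s \<longleftrightarrow>
     (\<forall>j. 16 \<le> j \<longrightarrow> j \<le> 2 * n \<longrightarrow> s (Raw j) = inp j) \<and>
     (\<forall>c j. 1 \<le> c \<longrightarrow> c < 16 \<longrightarrow> 1 \<le> j \<longrightarrow> s (Arr c j) = 0) \<and>
     (\<forall>j. 1 \<le> j \<longrightarrow> j < 16 \<longrightarrow> j \<le> 2 * n \<longrightarrow> s (Arr 0 j) = inp j)"

lemma startup_effect:
  assumes n: "3 \<le> n" and m: "m 0 = int n" and x1: "m 1 = int a" "1 \<le> a" "a \<le> n"
    and z: "\<And>j. 2 * n < j \<Longrightarrow> m j = 0"
  obtains s where "rep n s (fold effect startup m)" "initial_state n m s"
proof -
  define M where "M = fold effect prologue m"
  note pe = prologue_effect[OF n m x1 M_def]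
  define M' where "M' = fold effect (save_cells 13) M"
  have se: "M' 1 = int (16 * (n + 14))"
    "\<And>j. j \<noteq> 1 \<Longrightarrow> (\<And>i. 2 \<le> i \<Longrightarrow> i < 15 \<Longrightarrow> j \<noteq> 16 * (n + i)) \<Longrightarrow> M' j = M j"
    "\<And>i. 2 \<le> i \<Longrightarrow> i < 15 \<Longrightarrow> M' (16 * (n + i)) = M (Suc i)"
    using save_cells_effect[OF n, of 13 M] pe(1,2,3) by (auto simp: M'_def)
  define F where "F = M'(2 := 0, 1 := 16 * (int n - 1), 3 := 1)"
  have "fold effect startup m = F"
    using se(1) by (auto simp: startup_def F_def fun_eq_iff simp flip: M_def M'_def)
  have M'0: "M' 0 = int n" using se(2)[of 0] pe(1) n by simp
  have F0: "F 0 = int n" "F 1 = 16 * (int n - 1)" "F 2 = 0" "F 3 = 1" using M'0 by (simp_all add: F_def)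
  have Fb: "F j = M' j" if "4 \<le> j" for j using that by (simp add: F_def)
  define s where "s l = (case l of Reg r \<Rightarrow> F (6 + r) | Arr c i \<Rightarrow> F (16 * (n + (i - 1)) + c) | Raw j \<Rightarrow> F j)" for l
  have "rep n s F" using F0 by (simp add: rep_def s_def)
  moreover have "initial_state n m s"
    unfolding initial_state_def
  proof (intro conjI allI impI)
    fix j assume j: "16 \<le> j" "j \<le> 2 * n"
    have "M' j = M j" by (rule se(2)) (use j n in auto)
    moreover have "M j = m j" by (rule pe(6)) (use j n x1 in auto)
    ultimately show "s (Raw j) = m j" using Fb[of j] j by (simp add: s_def)
  next
    fix c j :: nat assume c: "1 \<le> c" "c < 16" and j: "1 \<le> j"
    let ?a = "16 * (n + (j - 1)) + c"
    have ne: "?a \<noteq> 16 * i" for i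
      using c by (cases "n + (j - 1)" i rule: linorder_cases) auto
    have "?a \<noteq> 1" "2 < ?a" "?a \<noteq> 2 * n + a" using n x1 by auto
    then have "M' ?a = M ?a" "M ?a = m ?a"
      using se(2)[of ?a] pe(6)[of ?a] ne by blast+
    moreover have "m ?a = 0" by (rule z) (use n in auto)
    ultimately show "s (Arr c j) = 0" using Fb[of ?a] n by (simp add: s_def)
  next
    fix j assume j: "1 \<le> j" "j < 16" "j \<le> 2 * n"
    have s: "s (Arr 0 j) = M' (16 * (n + (j - 1)))" using Fb[of "16 * (n + (j - 1))"] n by (simp add: s_def)
    consider "j = 1" | "j = 2" | "3 \<le> j" using j by linarith
    then show "s (Arr 0 j) = m j"
    proof cases
      case 1
      have "M' (16 * n) = M (16 * n)" by (rule se(2)) (use n in auto)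
      then show ?thesis using s 1 pe(4) by simp
    next
      case 2
      have "M' (16 * (n + 1)) = M (16 * (n + 1))" by (rule se(2)) (use n in auto)
      then show ?thesis using s 2 pe(5) by simp
    next
      case 3
      have "M' (16 * (n + (j - 1))) = M (Suc (j - 1))" by (rule se(3)) (use 3 j in auto)
      moreover have "M j = m j" by (rule pe(6)) (use 3 j n x1 in auto)
      ultimately show ?thesis using s 3 by simp
    qed
  qed
  ultimately show thesis using that \<open>fold effect startup m = F\<close> by simp
qed

section \<open>The decision program\<close>

declare wp.simps(4) [simp del]

lemma wp_LoopI:
  assumes "J n s"
    and "\<And>k t. k < n \<Longrightarrow> J (Suc k) t \<Longrightarrow> wp n c (J k) (t(Reg r := int (Suc k)))"
    and "\<And>t. J 0 t \<Longrightarrow> Q (t(Reg r := 0))"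
  shows "wp n (Loop r c) Q s"
  using assms unfolding wp.simps by blast

section \<open>Copying the input and inverting the tours\<close>

definition inputs :: "nat \<Rightarrow> (nat \<Rightarrow> nat) \<Rightarrow> (nat \<Rightarrow> nat) \<Rightarrow> (loc \<Rightarrow> int) \<Rightarrow> bool" where
  "inputs n x y s \<longleftrightarrow>
     (\<forall>j. 1 \<le> j \<longrightarrow> j \<le> n \<longrightarrow> s (Arr 0 j) = int (x j) \<and> s (Arr 0 (n + j)) = int (y j))"

lemma inputsD:
  assumes "inputs n x y s" "1 \<le> j" "j \<le> n"
  shows "s (Arr 0 j) = int (x j)" "s (Arr 0 (n + j)) = int (y j)"
  using assms by (auto simp: inputs_def)

definition zeros :: "nat \<Rightarrow> (loc \<Rightarrow> int) \<Rightarrow> bool" where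
  "zeros c s \<longleftrightarrow> (\<forall>j\<ge>1. s (Arr c j) = 0)"

definition inverses :: "nat \<Rightarrow> (nat \<Rightarrow> nat) \<Rightarrow> (nat \<Rightarrow> nat) \<Rightarrow> (loc \<Rightarrow> int) \<Rightarrow> bool" where
  "inverses n x y s \<longleftrightarrow>
     (\<forall>j. 1 \<le> j \<longrightarrow> j \<le> n \<longrightarrow> s (Arr 1 j) = int (inv x j) \<and> s (Arr 2 j) = int (inv y j))"

definition lock_flag :: "nat \<Rightarrow> (nat \<Rightarrow> nat) \<Rightarrow> (nat \<Rightarrow> nat) \<Rightarrow> nat \<Rightarrow> int" where
  "lock_flag n x y j = of_bool (2 \<le> j \<and> j < n \<and> locked x y j)"

definition locks :: "nat \<Rightarrow> (nat \<Rightarrow> nat) \<Rightarrow> (nat \<Rightarrow> nat) \<Rightarrow> (loc \<Rightarrow> int) \<Rightarrow> bool" where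
  "locks n x y s \<longleftrightarrow> (\<forall>j. 1 \<le> j \<longrightarrow> j \<le> n \<longrightarrow> s (Arr 3 j) = lock_flag n x y j)"

definition labels :: "nat set \<Rightarrow> (loc \<Rightarrow> int) \<Rightarrow> bool" where
  "labels S s \<longleftrightarrow> (\<forall>j\<ge>1. s (Arr 4 j) = of_bool (j \<in> S))"

text \<open>Counter value \<open>k\<close> handles the cells \<open>15 + k\<close> and
  \<open>15 + k + n\<close>, so \<open>n\<close> rounds reach all remaining input cells up to
  \<open>2 * n\<close>. The few cells copied beyond the input are still below the arrays.\<close>

definition copy_input :: com where
  "copy_input = Loop 0 (Op (SetC 2 15) ;; Op (Plus 2 2 0) ;; Op (Fetch 3 2) ;; Op (Put 0 2 3) ;;
     Op (Size 4) ;; Op (Plus 2 2 4) ;; Op (Fetch 3 2) ;; Op (Put 0 2 3))"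

lemma wp_copy_input:
  assumes n: "3 \<le> n" and init: "initial_state n (input_mem n x y) s"
    and Q: "\<And>t. inputs n x y t \<Longrightarrow> (\<And>c. 1 \<le> c \<Longrightarrow> c < 16 \<Longrightarrow> zeros c t) \<Longrightarrow> Q t"
  shows "wp n copy_input Q s"
proof -
  let ?m = "input_mem n x y"
  define J where "J k s \<longleftrightarrow>
     (\<forall>j. 16 \<le> j \<longrightarrow> j \<le> 2 * n \<longrightarrow> s (Raw j) = ?m j) \<and>
     (\<forall>c j. 1 \<le> c \<longrightarrow> c < 16 \<longrightarrow> 1 \<le> j \<longrightarrow> s (Arr c j) = 0) \<and>
     (\<forall>j. 1 \<le> j \<longrightarrow> j \<le> 2 * n \<longrightarrow> j < 16 \<or> 15 + k < j \<and> j \<le> 15 + n \<or> 15 + n + k < j \<longrightarrow>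
        s (Arr 0 j) = ?m j)" for k and s :: "loc \<Rightarrow> int"
  show ?thesis
    unfolding copy_input_def
  proof (rule wp_LoopI[where J = J])
    show "J n s" using init by (auto simp: J_def initial_state_def)
  next
    fix k t assume k: "k < n" and J: "J (Suc k) t"
    have 1: "nat (16 + int k) = 16 + k" "nat (16 + int k + int n) = 16 + k + n" by auto
    have raw: "\<And>j. 16 \<le> j \<Longrightarrow> j \<le> 2 * n \<Longrightarrow> t (Raw j) = ?m j" using J by (simp add: J_def)
    have arr: "\<And>j. 1 \<le> j \<Longrightarrow> j \<le> 2 * n \<Longrightarrow> j < 16 \<or> 15 + Suc k < j \<and> j \<le> 15 + n \<or> 15 + n + Suc k < j \<Longrightarrow>
        t (Arr 0 j) = ?m j" using J unfolding J_def by blast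
    define u where "u = t(Arr 0 (16 + k) := t (Raw (16 + k)), Arr 0 (16 + k + n) := t (Raw (16 + k + n)))"
    have "u (Arr 0 j) = ?m j"
      if j: "1 \<le> j" "j \<le> 2 * n" "j < 16 \<or> 15 + k < j \<and> j \<le> 15 + n \<or> 15 + n + k < j" for j
    proof (cases "j = 16 + k \<or> j = 16 + k + n")
      case True
      then show ?thesis using raw[of j] j by (auto simp: u_def)
    next
      case False
      then show ?thesis using arr[of j] j by (auto simp: u_def)
    qed
    then have "J k u" using J by (simp add: J_def u_def)
    then have "J k v" if "\<And>c j. v (Arr c j) = u (Arr c j)" "\<And>j. v (Raw j) = u (Raw j)" for v
      using that by (simp add: J_def)
    then show "wp n (Op (SetC 2 15) ;; Op (Plus 2 2 0) ;; Op (Fetch 3 2) ;; Op (Put 0 2 3) ;;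
     Op (Size 4) ;; Op (Plus 2 2 4) ;; Op (Fetch 3 2) ;; Op (Put 0 2 3)) (J k) (t(Reg 0 := int (Suc k)))"
      using k n by (simp add: 1 u_def)
  next
    fix t assume J: "J 0 t"
    show "Q (t(Reg 0 := 0))"
    proof (rule Q)
      show "inputs n x y (t(Reg 0 := 0))"
        unfolding inputs_def
      proof (intro allI impI)
        fix j assume j: "1 \<le> j" "j \<le> n"
        have arr: "t (Arr 0 i) = ?m i" if "1 \<le> i" "i \<le> 2 * n" for i
        proof -
          have "i < 16 \<or> 15 + 0 < i \<and> i \<le> 15 + n \<or> 15 + n + 0 < i" using that by linarith
          then show ?thesis using J that unfolding J_def by blast
        qed
        show "(t(Reg 0 := 0)) (Arr 0 j) = int (x j) \<and> (t(Reg 0 := 0)) (Arr 0 (n + j)) = int (y j)"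
          using arr[of j] arr[of "n + j"] j by (simp add: input_mem_def)
      qed
      show "zeros c (t(Reg 0 := 0))" if "1 \<le> c" "c < 16" for c
        using J that by (simp add: zeros_def J_def)
    qed
  qed
qed

definition invert :: com where
  "invert = Loop 0 (Op (Get 2 0 0) ;; Op (Put 1 2 0) ;; Op (Size 3) ;; Op (Plus 3 3 0) ;;
     Op (Get 2 0 3) ;; Op (Put 2 2 0))"

lemma wp_invert:
  assumes x: "psb n x" and y: "psb n y" and s: "inputs n x y s" "zeros 3 s" "zeros 4 s" "zeros 5 s"
    and Q: "\<And>t. inputs n x y t \<Longrightarrow> inverses n x y t \<Longrightarrow> zeros 3 t \<Longrightarrow> zeros 4 t \<Longrightarrow> zeros 5 t \<Longrightarrow> Q t"
  shows "wp n invert Q s"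
proof -
  define J where "J k s \<longleftrightarrow> inputs n x y s \<and> zeros 3 s \<and> zeros 4 s \<and> zeros 5 s \<and>
     (\<forall>v. 1 \<le> v \<longrightarrow> v \<le> n \<longrightarrow> (k < inv x v \<longrightarrow> s (Arr 1 v) = int (inv x v)) \<and>
        (k < inv y v \<longrightarrow> s (Arr 2 v) = int (inv y v)))" for k and s :: "loc \<Rightarrow> int"
  show ?thesis
    unfolding invert_def
  proof (rule wp_LoopI[where J = J])
    show "J n s" using s psb_bounds[OF x] psb_bounds[OF y] by (force simp: J_def)
  next
    fix k t assume k: "k < n" and J: "J (Suc k) t"
    have k1: "nat (1 + int k) = Suc k" "nat (int n + (1 + int k)) = n + Suc k" by auto
    have xy: "1 \<le> x (Suc k)" "1 \<le> y (Suc k)"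
      using psb_bounds[OF x, of "Suc k"] psb_bounds[OF y, of "Suc k"] k by auto
    have in0: "t (Arr 0 (Suc k)) = int (x (Suc k))" "t (Arr 0 (n + Suc k)) = int (y (Suc k))"
      using inputsD[of n x y t "Suc k"] J k by (auto simp: J_def)
    define u where "u = t(Arr 1 (x (Suc k)) := int (Suc k), Arr 2 (y (Suc k)) := int (Suc k))"
    have "u (Arr 1 v) = int (inv x v)" if "1 \<le> v" "v \<le> n" "k < inv x v" for v
    proof (cases "inv x v = Suc k")
      case True
      then have "v = x (Suc k)" using psb_inv_simps(1)[OF x, of v] by simp
      then show ?thesis using True by (simp add: u_def)
    next
      case False
      then have "v \<noteq> x (Suc k)" using psb_inv_simps(2)[OF x] by auto
      then show ?thesis using J that False by (auto simp: u_def J_def)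
    qed
    moreover have "u (Arr 2 v) = int (inv y v)" if "1 \<le> v" "v \<le> n" "k < inv y v" for v
    proof (cases "inv y v = Suc k")
      case True
      then have "v = y (Suc k)" using psb_inv_simps(1)[OF y, of v] by simp
      then show ?thesis using True by (simp add: u_def)
    next
      case False
      then have "v \<noteq> y (Suc k)" using psb_inv_simps(2)[OF y] by auto
      then show ?thesis using J that False by (auto simp: u_def J_def)
    qed
    ultimately have "J k u"
      using J by (simp add: J_def) (simp add: u_def inputs_def zeros_def)
    then have "J k v" if "\<And>c j. v (Arr c j) = u (Arr c j)" for v
      using that by (simp add: J_def inputs_def zeros_def)
    then show "wp n (Op (Get 2 0 0) ;; Op (Put 1 2 0) ;; Op (Size 3) ;; Op (Plus 3 3 0) ;;
     Op (Get 2 0 3) ;; Op (Put 2 2 0)) (J k) (t(Reg 0 := int (Suc k)))"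
      using xy in0 by (simp add: k1 u_def)
  next
    fix t assume J: "J 0 t"
    have "0 < inv x v" "0 < inv y v" if "1 \<le> v" "v \<le> n" for v
      using psb_bounds(3)[OF x that] psb_bounds(3)[OF y that] by auto
    then show "Q (t(Reg 0 := 0))"
      using J by (intro Q) (auto simp: J_def inputs_def inverses_def zeros_def)
  qed
qed

text \<open>Array 5 marks the cities above the current one; as the cities are visited in descending order it
  replaces the comparisons that the instruction set lacks.\<close>

definition find_side :: "nat \<Rightarrow> nat \<Rightarrow> nat \<Rightarrow> com" where
  "find_side p q e =
     Op (Get 6 5 p) ;; Op (Get 7 5 q) ;; Op (SetC 8 1) ;;
     IfZ 6 (Op (Plus 8 8 p) ;; Op (Minus 8 8 0) ;;
            IfZ 8 (Op (SetC e 0) ;; Op (Plus e e 7)) (Op (SetC e 1)))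
           (Op (Plus 8 8 0) ;; Op (Minus 8 8 p) ;;
            IfZ 8 (Op (SetC e 0) ;; Op (Plus e e 7)) (Op (SetC e 0)))"

section \<open>Sides and locked cities\<close>

lemma wp_find_side:
  assumes s: "s (Reg 0) = i" "s (Reg p) = a" "s (Reg q) = b" "s (Arr 5 (nat a)) = g" "s (Arr 5 (nat b)) = h"
    and ab: "1 \<le> a" "1 \<le> b" and reg: "p \<notin> {6, 7, 8}" "q \<notin> {6, 7, 8}" "e \<notin> {6, 7, 8}"
    and Q: "\<And>k. Q (s(Reg 6 := g, Reg 7 := h, Reg 8 := k, Reg e :=
      (if g = 0 then (if 1 + a - i = 0 then h else 1) else (if 1 + i - a = 0 then h else 0))))"
  shows "wp n (find_side p q e) Q s"
proof -
  have r: "p \<noteq> 6" "p \<noteq> 7" "p \<noteq> 8" "q \<noteq> 6" "q \<noteq> 7" "q \<noteq> 8" "e \<noteq> 6" "e \<noteq> 7" "e \<noteq> 8" "6 \<noteq> e" "7 \<noteq> e" "8 \<noteq> e"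
    using reg by auto
  show ?thesis
  proof (cases "g = 0")
    case True
    then show ?thesis using Q[of "1 + a - i"] s ab r by (cases "1 + a - i = 0") (simp_all add: find_side_def)
  next
    case False
    then show ?thesis using Q[of "1 + i - a"] s ab r by (cases "1 + i - a = 0") (simp_all add: find_side_def)
  qed
qed

lemma up_side_flag:
  assumes "inv z i \<noteq> i" "z i \<noteq> i"
  shows "(if of_bool (i < inv z i) = (0::int)
      then (if 1 + int (inv z i) - int i = 0 then of_bool (i < z i) else 1)
      else (if 1 + int i - int (inv z i) = 0 then of_bool (i < z i) else 0)) = (of_bool (up_side z i) :: int)"
proof -
  have "1 + int (inv z i) - int i = 0 \<longleftrightarrow> Suc (inv z i) = i" "1 + int i - int (inv z i) = 0 \<longleftrightarrow> inv z i = Suc i"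
    by linarith+
  note eqs = this
  show ?thesis
  proof (cases "i < inv z i")
    case True
    then show ?thesis unfolding eqs by (cases "inv z i = Suc i") (simp_all add: up_side_def)
  next
    case False
    then have "inv z i < i" using assms by simp
    then show ?thesis using False assms(2) unfolding eqs
      by (cases "Suc (inv z i) = i"; cases "i < z i") (simp_all add: up_side_def)
  qed
qed

text \<open>Registers 9 and 3 hold the sides. Registers 2 and 4 count the neighbours above the
  current city in \<open>x\<close> and in \<open>y\<close>: none at a peak, two at a valley. Peak
  against valley thus shows as a difference of 2 or -2.\<close>

definition lock_verdict :: com where
  "lock_verdict =
     Op (Minus 9 9 3) ;;
     IfZ 9 (Op (Minus 2 2 4) ;; Op (SetC 3 2) ;; Op (Minus 4 2 3) ;;
            IfZ 4 (Op (SetC 9 1)) (Op (Plus 4 2 3) ;; IfZ 4 (Op (SetC 9 1)) (Op (SetC 9 0))))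
           (Op (SetC 9 1))"

lemma wp_lock_verdict:
  assumes "\<And>t. (\<And>c j. t (Arr c j) = s (Arr c j)) \<Longrightarrow> t (Reg 0) = s (Reg 0) \<Longrightarrow>
     t (Reg 9) = of_bool (s (Reg 9) \<noteq> s (Reg 3) \<or>
        s (Reg 2) - s (Reg 4) = 2 \<or> s (Reg 2) - s (Reg 4) = - 2) \<Longrightarrow> Q t"
  shows "wp n lock_verdict Q s"
proof -
  obtain a b c d where ab: "s (Reg 2) = a" "s (Reg 4) = b" "s (Reg 9) = c" "s (Reg 3) = d" by blast
  consider "c \<noteq> d" | "c = d" "a - b = 2" | "c = d" "a - b = - 2" | "c = d" "a - b \<noteq> 2" "a - b \<noteq> - 2"
    by blast
  then show ?thesis
  proof cases
    case 1
    then show ?thesis by (simp add: lock_verdict_def ab) (rule assms; simp add: ab)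
  next
    case 2
    then show ?thesis by (simp add: lock_verdict_def ab) (rule assms; simp add: ab)
  next
    case 3
    then show ?thesis by (simp add: lock_verdict_def ab) (rule assms; simp add: ab)
  next
    case 4
    then have "a - b - 2 \<noteq> 0" "a - b + 2 \<noteq> 0" by auto
    with 4 show ?thesis
      by (simp add: lock_verdict_def ab del: diff_eq_eq eq_diff_eq right_minus_eq) (rule assms; simp add: ab)
  qed
qed

text \<open>The flag is cleared at the cities 1 and \<open>n\<close>, which have no side. The city
  is marked in array 5 only now, so that it counts as above from the next city on.\<close>

definition store_lock :: com where
  "store_lock =
     Op (SetC 3 1) ;; Op (Minus 3 0 3) ;;
     IfZ 3 (Op (SetC 9 0)) (Op (Size 3) ;; Op (Minus 3 3 0) ;; IfZ 3 (Op (SetC 9 0)) (Op (SetC 3 0))) ;;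
     Op (Put 3 0 9) ;; Op (SetC 3 1) ;; Op (Put 5 0 3)"

lemma wp_store_lock:
  assumes s: "s (Reg 0) = int i" "1 \<le> i" "i \<le> n" "s (Reg 9) = of_bool b"
    and Q: "\<And>t. (\<And>c j. t (Arr c j) =
        (s(Arr 3 i := of_bool (2 \<le> i \<and> i < n \<and> b), Arr 5 i := 1)) (Arr c j)) \<Longrightarrow> Q t"
  shows "wp n store_lock Q s"
proof -
  consider "i = 1" | "i \<noteq> 1" "i = n" | "2 \<le> i" "i < n" using s by linarith
  then show ?thesis
  proof cases
    case 1
    then show ?thesis using s by (simp add: store_lock_def) (rule Q; simp)
  next
    case 2
    then have "int i - 1 \<noteq> 0" by simp
    then show ?thesis using s 2 by (simp add: store_lock_def) (rule Q; simp)
  next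
    case 3
    then have "int i - 1 \<noteq> 0" "int n - int i \<noteq> 0" by auto
    then have "wp n store_lock Q s \<longleftrightarrow> Q (s(Arr 3 i := of_bool b, Reg 3 := 1, Arr 5 i := 1))"
      using s 3 by (cases b) (simp_all add: store_lock_def)
    moreover have "Q (s(Arr 3 i := of_bool b, Reg 3 := 1, Arr 5 i := 1))"
      by (rule Q) (use 3 in simp)
    ultimately show ?thesis by simp
  qed
qed

definition find_locks :: com where
  "find_locks = Loop 0
     (Op (Get 2 1 0) ;; Op (Get 3 0 0) ;; Op (Size 4) ;; Op (Plus 4 4 0) ;; Op (Get 5 0 4) ;; Op (Get 4 2 0) ;;
      find_side 2 3 9 ;; Op (Plus 2 6 7) ;; find_side 4 5 3 ;; Op (Plus 4 6 7) ;; lock_verdict ;; store_lock)"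

lemma wp_find_locks:
  assumes x: "psb n x" and y: "psb n y"
    and s: "inputs n x y s" "inverses n x y s" "zeros 4 s" "zeros 5 s"
    and Q: "\<And>t. inputs n x y t \<Longrightarrow> inverses n x y t \<Longrightarrow> locks n x y t \<Longrightarrow> zeros 4 t \<Longrightarrow> Q t"
  shows "wp n find_locks Q s"
proof -
  define J where "J k s \<longleftrightarrow> inputs n x y s \<and> inverses n x y s \<and> zeros 4 s \<and>
     (\<forall>j\<ge>1. j \<le> n \<longrightarrow> s (Arr 5 j) = of_bool (k < j)) \<and>
     (\<forall>j. k < j \<longrightarrow> j \<le> n \<longrightarrow> s (Arr 3 j) = lock_flag n x y j)" for k and s :: "loc \<Rightarrow> int"
  show ?thesis
    unfolding find_locks_def
  proof (rule wp_LoopI[where J = J])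
    show "J n s" using s by (auto simp: J_def zeros_def)
  next
    fix k t assume k: "k < n" and J: "J (Suc k) t"
    define i where "i = Suc k"
    have i: "1 \<le> i" "i \<le> n" using k by (auto simp: i_def)
    have ni: "nat (int n + int i) = n + i" by simp
    note xb = psb_bounds[OF x i] and yb = psb_bounds[OF y i]
    have in0: "t (Arr 0 i) = int (x i)" "t (Arr 0 (n + i)) = int (y i)"
      "t (Arr 1 i) = int (inv x i)" "t (Arr 2 i) = int (inv y i)"
      using J inputsD[of n x y t i] i by (auto simp: J_def inverses_def)
    have up: "t (Arr 5 j) = of_bool (i < j)" if "1 \<le> j" "j \<le> n" for j
      using J that by (simp add: J_def i_def)
    define s1 where "s1 = t(Reg 0 := int i, Reg 2 := int (inv x i), Reg 3 := int (x i), Reg 4 := int (inv y i), Reg 5 := int (y i))"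
    define b where "b \<longleftrightarrow> locked x y i"
    have fin: "J k v" if v: "\<And>c j. v (Arr c j) = (t(Arr 3 i := of_bool (2 \<le> i \<and> i < n \<and> b), Arr 5 i := 1)) (Arr c j)" for v
    proof -
      have "v (Arr 3 j) = lock_flag n x y j" if j: "k < j" "j \<le> n" for j
        using j J v[of 3 j] by (cases "j = i") (auto simp: J_def i_def lock_flag_def b_def)
      moreover have "v (Arr 5 j) = of_bool (k < j)" if j: "1 \<le> j" "j \<le> n" for j
        using up[OF j] v[of 5 j] by (cases "j = i") (auto simp: i_def)
      ultimately show ?thesis
        using J v by (simp add: J_def inputs_def inverses_def zeros_def)
    qed
    define rest where "rest = (Op (Plus 2 6 7) ;; find_side 4 5 3 ;; Op (Plus 4 6 7) ;; lock_verdict ;; store_lock)"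
    have rest: "wp n rest (J k) (s1(Reg 6 := of_bool (i < inv x i), Reg 7 := of_bool (i < x i), Reg 8 := h,
                 Reg 9 := of_bool (up_side x i)))" for h
      unfolding rest_def wp.simps
    proof (intro conjI)
      let ?tx = "of_bool (i < inv x i) + of_bool (i < x i) :: int"
      let ?ty = "of_bool (i < inv y i) + of_bool (i < y i) :: int"
      let ?s2 = "s1(Reg 6 := of_bool (i < inv x i), Reg 7 := of_bool (i < x i), Reg 8 := h,
                 Reg 9 := of_bool (up_side x i), Reg 2 := ?tx)"
      have eq: "op_post n (Plus 2 6 7) (s1(Reg 6 := of_bool (i < inv x i), Reg 7 := of_bool (i < x i), Reg 8 := h,
                 Reg 9 := of_bool (up_side x i))) = ?s2" by simp
      show "wp n (find_side 4 5 3) (\<lambda>s. op_pre n (Plus 4 6 7) s \<and>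
           wp n lock_verdict (wp n store_lock (J k)) (op_post n (Plus 4 6 7) s))
         (op_post n (Plus 2 6 7) (s1(Reg 6 := of_bool (i < inv x i), Reg 7 := of_bool (i < x i), Reg 8 := h,
                 Reg 9 := of_bool (up_side x i))))"
        unfolding eq
      proof (rule wp_find_side[where i = "int i" and a = "int (inv y i)" and b = "int (y i)"
            and g = "of_bool (i < inv y i)" and h = "of_bool (i < y i)"])
        fix h'
        let ?s3 = "?s2(Reg 6 := of_bool (i < inv y i), Reg 7 := of_bool (i < y i), Reg 8 := h',
                 Reg 3 := of_bool (up_side y i), Reg 4 := ?ty)"
        have "wp n lock_verdict (wp n store_lock (J k)) ?s3"
        proof (rule wp_lock_verdict)
          fix u assume u: "\<And>c j. u (Arr c j) = ?s3 (Arr c j)" "u (Reg 0) = ?s3 (Reg 0)"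
            "u (Reg 9) = of_bool (?s3 (Reg 9) \<noteq> ?s3 (Reg 3) \<or>
               ?s3 (Reg 2) - ?s3 (Reg 4) = 2 \<or> ?s3 (Reg 2) - ?s3 (Reg 4) = - 2)"
          have "(?tx - ?ty = 2 \<or> ?tx - ?ty = - 2) \<longleftrightarrow> peak x i \<and> valley y i \<or> valley x i \<and> peak y i"
            using xb yb by (cases "i < inv x i"; cases "i < x i"; cases "i < inv y i"; cases "i < y i")
              (simp_all add: peak_def valley_def pred_of_def)
          then have "?s3 (Reg 9) \<noteq> ?s3 (Reg 3) \<or> ?s3 (Reg 2) - ?s3 (Reg 4) = 2 \<or> ?s3 (Reg 2) - ?s3 (Reg 4) = - 2
              \<longleftrightarrow> b" by (auto simp: b_def locked_def)
          then have u9: "u (Reg 9) = of_bool b" using u(3) by simp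
          show "wp n store_lock (J k) u"
          proof (rule wp_store_lock[where i = i and b = b])
            show "u (Reg 0) = int i" using u(2) by (simp add: s1_def)
            fix v assume "\<And>c j. v (Arr c j) = (u(Arr 3 i := of_bool (2 \<le> i \<and> i < n \<and> b), Arr 5 i := 1)) (Arr c j)"
            then show "J k v" using u(1) by (intro fin) (simp add: s1_def)
          qed (use i u9 in auto)
        qed
        then show "op_pre n (Plus 4 6 7) (?s2(Reg 6 := of_bool (i < inv y i), Reg 7 := of_bool (i < y i), Reg 8 := h',
             Reg 3 := (if of_bool (i < inv y i) = (0::int) then if 1 + int (inv y i) - int i = 0 then of_bool (i < y i) else 1
               else if 1 + int i - int (inv y i) = 0 then of_bool (i < y i) else 0))) \<and>
           wp n lock_verdict (wp n store_lock (J k)) (op_post n (Plus 4 6 7)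
             (?s2(Reg 6 := of_bool (i < inv y i), Reg 7 := of_bool (i < y i), Reg 8 := h',
             Reg 3 := (if of_bool (i < inv y i) = (0::int) then if 1 + int (inv y i) - int i = 0 then of_bool (i < y i) else 1
               else if 1 + int i - int (inv y i) = 0 then of_bool (i < y i) else 0))))"
          unfolding up_side_flag[of y i, OF yb(6,5)] op_pre.simps op_post.simps by simp
      qed (use yb up[of "inv y i"] up[of "y i"] in \<open>simp_all add: s1_def\<close>)
    qed simp
    have "wp n (find_side 2 3 9) (wp n rest (J k)) s1"
    proof (rule wp_find_side[where i = "int i" and a = "int (inv x i)" and b = "int (x i)"
            and g = "of_bool (i < inv x i)" and h = "of_bool (i < x i)"])
      fix h
      show "wp n rest (J k) (s1(Reg 6 := of_bool (i < inv x i), Reg 7 := of_bool (i < x i), Reg 8 := h,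
           Reg 9 := (if of_bool (i < inv x i) = (0::int) then if 1 + int (inv x i) - int i = 0 then of_bool (i < x i) else 1
               else if 1 + int i - int (inv x i) = 0 then of_bool (i < x i) else 0)))"
        unfolding up_side_flag[of x i, OF xb(6,5)] using rest .
    qed (use xb up[of "inv x i"] up[of "x i"] in \<open>simp_all add: s1_def\<close>)
    then show "wp n (Op (Get 2 1 0) ;; Op (Get 3 0 0) ;; Op (Size 4) ;; Op (Plus 4 4 0) ;; Op (Get 5 0 4) ;; Op (Get 4 2 0) ;;
      find_side 2 3 9 ;; Op (Plus 2 6 7) ;; find_side 4 5 3 ;; Op (Plus 4 6 7) ;; lock_verdict ;; store_lock)
      (J k) (t(Reg 0 := int (Suc k)))"
      unfolding i_def[symmetric] rest_def[symmetric]
      using i in0 by (simp add: ni s1_def fun_upd_twist)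
  next
    fix t assume "J 0 t"
    then show "Q (t(Reg 0 := 0))"
      by (intro Q) (auto simp: J_def inputs_def inverses_def zeros_def locks_def)
  qed
qed

section \<open>Seed city and label propagation\<close>

definition prepared :: "nat \<Rightarrow> (nat \<Rightarrow> nat) \<Rightarrow> (nat \<Rightarrow> nat) \<Rightarrow> (loc \<Rightarrow> int) \<Rightarrow> bool" where
  "prepared n x y s \<longleftrightarrow> inputs n x y s \<and> inverses n x y s \<and> locks n x y s"

lemma prepared_cong:
  assumes "prepared n x y s" "\<And>c j. c \<noteq> 4 \<Longrightarrow> t (Arr c j) = s (Arr c j)"
  shows "prepared n x y t"
  using assms by (simp add: prepared_def inputs_def inverses_def locks_def)

lemma preparedD:
  assumes "prepared n x y s" "1 \<le> j" "j \<le> n"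
  shows "s (Arr 0 j) = int (x j)" "s (Arr 0 (n + j)) = int (y j)"
    "s (Arr 1 j) = int (inv x j)" "s (Arr 2 j) = int (inv y j)" "s (Arr 3 j) = lock_flag n x y j"
  using assms inputsD[of n x y s j] by (auto simp: prepared_def inverses_def locks_def)

lemma labels_cong:
  assumes "labels S s" "\<And>j. t (Arr 4 j) = s (Arr 4 j)"
  shows "labels S t"
  using assms by (simp add: labels_def)

definition find_seed :: com where
  "find_seed = Op (SetC 1 0) ;;
     Loop 0 (Op (Get 2 0 0) ;; Op (Size 3) ;; Op (Plus 3 3 0) ;; Op (Get 4 0 3) ;; Op (Minus 2 2 4) ;;
       IfZ 2 (Op (SetC 2 0)) (Op (SetC 1 0) ;; Op (Plus 1 1 0)))"

lemma wp_find_seed: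
  assumes s: "prepared n x y s" "zeros 4 s"
    and Q: "\<And>t u. prepared n x y t \<Longrightarrow> zeros 4 t \<Longrightarrow> t (Reg 1) = int u \<Longrightarrow>
      (u = 0 \<Longrightarrow> \<forall>j. 1 \<le> j \<longrightarrow> j \<le> n \<longrightarrow> x j = y j) \<Longrightarrow>
      (u \<noteq> 0 \<Longrightarrow> u \<le> n \<and> x u \<noteq> y u) \<Longrightarrow> Q t"
  shows "wp n find_seed Q s"
proof -
  define J where "J k s \<longleftrightarrow> prepared n x y s \<and> zeros 4 s \<and>
     (\<exists>u. s (Reg 1) = int u \<and> (u = 0 \<longrightarrow> (\<forall>j. k < j \<longrightarrow> j \<le> n \<longrightarrow> x j = y j)) \<and>
        (u \<noteq> 0 \<longrightarrow> u \<le> n \<and> x u \<noteq> y u))" for k and s :: "loc \<Rightarrow> int"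
  have J_cong: "J k t \<Longrightarrow> (\<And>c j. v (Arr c j) = t (Arr c j)) \<Longrightarrow> v (Reg 1) = t (Reg 1) \<Longrightarrow> J k v" for k t v
    unfolding J_def using prepared_cong[of n x y t v] by (simp add: zeros_def)
  show ?thesis
    unfolding find_seed_def wp.simps(1,2)
  proof (intro conjI, simp, rule wp_LoopI[where J = J])
    show "J n (op_post n (SetC 1 0) s)"
      using s prepared_cong[of n x y s "s(Reg 1 := 0)"] by (simp add: J_def zeros_def)
  next
    fix k t assume k: "k < n" and J: "J (Suc k) t"
    define i where "i = Suc k"
    have i: "1 \<le> i" "i \<le> n" using k by (auto simp: i_def)
    have ni: "nat (int n + int i) = n + i" by simp
    have a: "t (Arr 0 i) = int (x i)" "t (Arr 0 (n + i)) = int (y i)"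
      using J preparedD[of n x y t i] i by (auto simp: J_def)
    show "wp n (Op (Get 2 0 0) ;; Op (Size 3) ;; Op (Plus 3 3 0) ;; Op (Get 4 0 3) ;; Op (Minus 2 2 4) ;;
       IfZ 2 (Op (SetC 2 0)) (Op (SetC 1 0) ;; Op (Plus 1 1 0))) (J k) (t(Reg 0 := int (Suc k)))"
    proof (cases "x i = y i")
      case True
      have "J k t"
      proof -
        have "x j = y j" if "k < j" "\<forall>j. Suc k < j \<longrightarrow> j \<le> n \<longrightarrow> x j = y j" "j \<le> n" for j
          using that True by (cases "j = i") (auto simp: i_def)
        then show ?thesis using J unfolding J_def by blast
      qed
      then have "J k (t(Reg 0 := int i, Reg 2 := 0, Reg 3 := int n + int i, Reg 4 := int (y i)))"
        by (rule J_cong) auto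
      then show ?thesis
        unfolding i_def[symmetric] using True i a by (simp add: ni fun_upd_twist)
    next
      case False
      have "J k (t(Reg 1 := int i))"
      proof -
        have "prepared n x y (t(Reg 1 := int i))" "zeros 4 (t(Reg 1 := int i))"
          using J prepared_cong[of n x y t "t(Reg 1 := int i)"] by (auto simp: J_def zeros_def)
        then show ?thesis
          using False i unfolding J_def by (intro conjI exI[of _ i]) auto
      qed
      then have "J k v" if "\<And>c j. v (Arr c j) = t (Arr c j)" "v (Reg 1) = int i" for v
        by (rule J_cong) (use that in auto)
      then show ?thesis
        unfolding i_def[symmetric] using False i a by (simp add: ni)
    qed
  next
    fix t assume J: "J 0 t"
    then have "J 0 (t(Reg 0 := 0))" by (rule J_cong) auto
    then obtain u where u: "prepared n x y (t(Reg 0 := 0))" "zeros 4 (t(Reg 0 := 0))"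
      "(t(Reg 0 := 0)) (Reg 1) = int u" "u = 0 \<longrightarrow> (\<forall>j. 0 < j \<longrightarrow> j \<le> n \<longrightarrow> x j = y j)"
      "u \<noteq> 0 \<longrightarrow> u \<le> n \<and> x u \<noteq> y u"
      unfolding J_def by blast
    show "Q (t(Reg 0 := 0))" by (rule Q[OF u(1-3)]) (use u in auto)
  qed
qed

definition join :: "nat \<Rightarrow> nat \<Rightarrow> nat set \<Rightarrow> nat set" where
  "join u v S = (if u \<in> S \<or> v \<in> S then insert u (insert v S) else S)"

definition tie :: "nat \<Rightarrow> nat \<Rightarrow> com" where
  "tie p q = Op (Get 6 4 p) ;; Op (Get 7 4 q) ;; Op (Plus 6 6 7) ;;
     IfZ 6 (Op (SetC 7 0)) (Op (SetC 7 1) ;; Op (Put 4 p 7) ;; Op (Put 4 q 7))"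

lemma wp_tie:
  assumes s: "s (Reg p) = int u" "s (Reg q) = int v" "1 \<le> u" "1 \<le> v" "labels S s"
    and reg: "p \<noteq> 6" "p \<noteq> 7" "q \<noteq> 6" "q \<noteq> 7"
    and Q: "\<And>t. labels (join u v S) t \<Longrightarrow> (\<And>c j. c \<noteq> 4 \<Longrightarrow> t (Arr c j) = s (Arr c j)) \<Longrightarrow>
       (\<And>r. r \<noteq> 6 \<Longrightarrow> r \<noteq> 7 \<Longrightarrow> t (Reg r) = s (Reg r)) \<Longrightarrow> Q t"
  shows "wp n (tie p q) Q s"
proof -
  have l: "s (Arr 4 u) = of_bool (u \<in> S)" "s (Arr 4 v) = of_bool (v \<in> S)" using s by (auto simp: labels_def)
  show ?thesis
  proof (cases "u \<in> S \<or> v \<in> S")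
    case False
    have "Q (s(Reg 6 := 0, Reg 7 := 0))"
      by (rule Q) (use s(5) False in \<open>auto simp: join_def labels_def\<close>)
    then show ?thesis using False s reg l by (simp add: tie_def fun_upd_twist)
  next
    case True
    have q: "Q t" if "\<And>c j. t (Arr c j) = (s(Arr 4 u := 1, Arr 4 v := 1)) (Arr c j)"
      "\<And>r. r \<noteq> 6 \<Longrightarrow> r \<noteq> 7 \<Longrightarrow> t (Reg r) = s (Reg r)" for t
      by (rule Q) (use s(5) True that in \<open>auto simp: join_def labels_def\<close>)
    consider "u \<in> S" "v \<in> S" | "u \<in> S" "v \<notin> S" | "u \<notin> S" "v \<in> S" using True by blast
    then show ?thesis
    proof cases
      case 1
      show ?thesis using s reg l 1 by (simp add: tie_def) (rule q; simp)
    next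
      case 2
      show ?thesis using s reg l 2 by (simp add: tie_def) (rule q; simp)
    next
      case 3
      show ?thesis using s reg l 3 by (simp add: tie_def) (rule q; simp)
    qed
  qed
qed

definition ties_at :: "nat \<Rightarrow> (nat \<Rightarrow> nat) \<Rightarrow> (nat \<Rightarrow> nat) \<Rightarrow> nat \<Rightarrow> (nat \<Rightarrow> bool) \<Rightarrow> bool" where
  "ties_at n x y v b \<longleftrightarrow> b (inv x v) = b (inv y v) \<and> (x (y v) = v \<longrightarrow> b v = b (y v)) \<and>
     (2 \<le> v \<and> v < n \<and> locked x y v \<longrightarrow> b (inv x v) = b v)"

lemma respects_ties_iff: "respects_ties n x y b \<longleftrightarrow> (\<forall>v\<in>{1..n}. ties_at n x y v b)"
  unfolding respects_ties_def ties_at_def by auto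

definition tie_step :: "nat \<Rightarrow> (nat \<Rightarrow> nat) \<Rightarrow> (nat \<Rightarrow> nat) \<Rightarrow> nat \<Rightarrow> nat set \<Rightarrow> nat set" where
  "tie_step n x y v S =
     (let S1 = join (inv x v) (inv y v) S;
          S2 = (if x (y v) = v then join v (y v) S1 else S1)
      in if 2 \<le> v \<and> v < n \<and> locked x y v then join (inv x v) v S2 else S2)"

lemma join_superset: "S \<subseteq> join u v S"
  by (auto simp: join_def)

lemma tie_step_superset: "S \<subseteq> tie_step n x y v S"
  using join_superset unfolding tie_step_def Let_def by (auto split: if_splits) blast+

lemma join_eqD: "join u v S = S \<Longrightarrow> u \<in> S \<longleftrightarrow> v \<in> S"
  by (auto simp: join_def split: if_splits)

text \<open>The three joins only enlarge the set; if the result is \<open>S\<close> again, each of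
  them was idle.\<close>

lemma tie_step_fixed:
  assumes "tie_step n x y v S = S"
  shows "ties_at n x y v (\<lambda>u. u \<in> S)"
proof -
  define S1 where "S1 = join (inv x v) (inv y v) S"
  define S2 where "S2 = (if x (y v) = v then join v (y v) S1 else S1)"
  define S3 where "S3 = (if 2 \<le> v \<and> v < n \<and> locked x y v then join (inv x v) v S2 else S2)"
  have "S3 = S" using assms unfolding tie_step_def S1_def S2_def S3_def Let_def .
  moreover have "S \<subseteq> S1" "S1 \<subseteq> S2" "S2 \<subseteq> S3"
    using join_superset by (auto simp: S1_def S2_def S3_def)
  ultimately have eq: "S1 = S" "S2 = S" "S3 = S" by auto
  show ?thesis
    unfolding ties_at_def
  proof (intro conjI impI)
    show "(inv x v \<in> S) = (inv y v \<in> S)" using eq(1) join_eqD by (simp add: S1_def)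
    show "(v \<in> S) = (y v \<in> S)" if "x (y v) = v"
      using eq join_eqD[of v "y v" S] that by (simp add: S2_def)
    show "(inv x v \<in> S) = (v \<in> S)" if "2 \<le> v \<and> v < n \<and> locked x y v"
      using eq join_eqD[of "inv x v" v S] that by (simp add: S3_def)
  qed
qed

lemma join_least: "b u = b v \<Longrightarrow> \<forall>w\<in>S. b w \<Longrightarrow> \<forall>w\<in>join u v S. b w"
  by (auto simp: join_def)

lemma tie_step_least:
  assumes b: "ties_at n x y v b" and S: "\<forall>u\<in>S. b u"
  shows "\<forall>u\<in>tie_step n x y v S. b u"
proof -
  define S1 where "S1 = join (inv x v) (inv y v) S"
  define S2 where "S2 = (if x (y v) = v then join v (y v) S1 else S1)"
  have 1: "\<forall>u\<in>S1. b u" unfolding S1_def by (rule join_least) (use b S in \<open>auto simp: ties_at_def\<close>)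
  have 2: "\<forall>u\<in>S2. b u"
  proof (cases "x (y v) = v")
    case True
    then have "b v = b (y v)" using b unfolding ties_at_def by blast
    from join_least[OF this 1] show ?thesis unfolding S2_def if_P[OF True] .
  qed (use 1 in \<open>simp add: S2_def\<close>)
  have step: "tie_step n x y v S = (if 2 \<le> v \<and> v < n \<and> locked x y v then join (inv x v) v S2 else S2)"
    unfolding tie_step_def S1_def S2_def Let_def ..
  show ?thesis
  proof (cases "2 \<le> v \<and> v < n \<and> locked x y v")
    case True
    then have "b (inv x v) = b v" using b unfolding ties_at_def by blast
    from join_least[OF this 2] show ?thesis unfolding step if_P[OF True] .
  next
    case False
    from 2 show ?thesis unfolding step if_not_P[OF False] .
  qed
qed

lemma tie_step_range:
  assumes x: "psb n x" and y: "psb n y" and S: "S \<subseteq> {1..n}" and v: "1 \<le> v" "v \<le> n"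
  shows "tie_step n x y v S \<subseteq> {1..n}"
proof -
  have "join a b T \<subseteq> {1..n}" if "T \<subseteq> {1..n}" "a \<in> {1..n}" "b \<in> {1..n}" for a b T
    using that by (auto simp: join_def)
  then show ?thesis
    using S v psb_bounds[OF x v] psb_bounds[OF y v] unfolding tie_step_def Let_def by auto
qed

definition apply_ties :: com where
  "apply_ties =
     Op (Get 2 1 0) ;; Op (Get 3 2 0) ;; tie 2 3 ;;
     Op (Size 4) ;; Op (Plus 4 4 0) ;; Op (Get 3 0 4) ;; Op (Get 4 0 3) ;; Op (Minus 4 4 0) ;;
     IfZ 4 (tie 0 3) (Op (SetC 7 0)) ;;
     Op (Get 4 3 0) ;; IfZ 4 (Op (SetC 7 0)) (tie 2 0)"

lemma wp_apply_ties:
  assumes x: "psb n x" and y: "psb n y" and s: "prepared n x y s" "labels S s" "s (Reg 0) = int v"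
    and v: "1 \<le> v" "v \<le> n"
    and Q: "\<And>t. prepared n x y t \<Longrightarrow> labels (tie_step n x y v S) t \<Longrightarrow> Q t"
  shows "wp n apply_ties Q s"
proof -
  note xb = psb_bounds[OF x v] and yb = psb_bounds[OF y v]
  define S1 where "S1 = join (inv x v) (inv y v) S"
  define S2 where "S2 = (if x (y v) = v then join v (y v) S1 else S1)"
  define lk where "lk \<longleftrightarrow> 2 \<le> v \<and> v < n \<and> locked x y v"
  have step: "tie_step n x y v S = (if lk then join (inv x v) v S2 else S2)"
    unfolding tie_step_def S1_def S2_def lk_def Let_def ..
  have flag: "lock_flag n x y v = of_bool lk" unfolding lock_flag_def lk_def ..
  have nv: "nat (int n + int v) = n + v" by simp
  define last where "last = (Op (Get 4 3 0) ;; IfZ 4 (Op (SetC 7 0)) (tie 2 0))"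
  have last: "wp n last Q t"
    if t: "prepared n x y t" "labels S2 t" "t (Reg 0) = int v" "t (Reg 2) = int (inv x v)" for t
  proof -
    have fl: "t (Arr 3 v) = lock_flag n x y v" using preparedD[OF t(1) v] by simp
    show ?thesis
    proof (cases lk)
      case False
      have "Q (t(Reg 4 := 0, Reg 7 := 0))"
        by (rule Q) (use t False prepared_cong[OF t(1)] labels_cong[OF t(2)] in \<open>simp_all add: step\<close>)
      then show ?thesis using t v fl False by (simp add: last_def flag)
    next
      case True
      have "wp n (tie 2 0) Q (t(Reg 4 := 1))"
      proof (rule wp_tie[where u = "inv x v" and v = v and S = S2])
        show "labels S2 (t(Reg 4 := 1))" by (rule labels_cong[OF t(2)]) simp
        fix r assume r: "labels (join (inv x v) v S2) r" "\<And>c j. c \<noteq> 4 \<Longrightarrow> r (Arr c j) = (t(Reg 4 := 1)) (Arr c j)"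
        show "Q r" by (rule Q) (use r True prepared_cong[OF t(1)] in \<open>simp_all add: step\<close>)
      qed (use t v xb in simp_all)
      then show ?thesis using t v fl True by (simp add: last_def flag)
    qed
  qed
  define mid where "mid = (Op (Size 4) ;; Op (Plus 4 4 0) ;; Op (Get 3 0 4) ;; Op (Get 4 0 3) ;; Op (Minus 4 4 0) ;;
     IfZ 4 (tie 0 3) (Op (SetC 7 0)) ;; last)"
  have mid: "wp n mid Q t"
    if t: "prepared n x y t" "labels S1 t" "t (Reg 0) = int v" "t (Reg 2) = int (inv x v)" for t
  proof -
    have a: "t (Arr 0 (n + v)) = int (y v)" "t (Arr 0 (y v)) = int (x (y v))"
      using preparedD[OF t(1) v] preparedD[OF t(1), of "y v"] yb by simp_all
    show ?thesis
    proof (cases "x (y v) = v")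
      case True
      have "wp n (tie 0 3) (wp n last Q) (t(Reg 4 := 0, Reg 3 := int (y v)))"
      proof (rule wp_tie[where u = v and v = "y v" and S = S1])
        show "labels S1 (t(Reg 4 := 0, Reg 3 := int (y v)))" by (rule labels_cong[OF t(2)]) simp
        fix r assume r: "labels (join v (y v) S1) r"
          "\<And>c j. c \<noteq> 4 \<Longrightarrow> r (Arr c j) = (t(Reg 4 := 0, Reg 3 := int (y v))) (Arr c j)"
          "\<And>q. q \<noteq> 6 \<Longrightarrow> q \<noteq> 7 \<Longrightarrow> r (Reg q) = (t(Reg 4 := 0, Reg 3 := int (y v))) (Reg q)"
        show "wp n last Q r"
          by (rule last) (use r t True prepared_cong[OF t(1)] in \<open>simp_all add: S2_def\<close>)
      qed (use t v yb in simp_all)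
      then show ?thesis using t v yb a True by (simp add: mid_def nv fun_upd_twist)
    next
      case False
      have "wp n last Q (t(Reg 4 := int (x (y v)) - int v, Reg 3 := int (y v), Reg 7 := 0))"
        by (rule last) (use t False prepared_cong[OF t(1)] labels_cong[OF t(2)] in \<open>simp_all add: S2_def\<close>)
      then show ?thesis using t v yb a False by (simp add: mid_def nv fun_upd_twist)
    qed
  qed
  have a: "s (Arr 1 v) = int (inv x v)" "s (Arr 2 v) = int (inv y v)" using preparedD[OF s(1) v] by simp_all
  let ?s = "s(Reg 2 := int (inv x v), Reg 3 := int (inv y v))"
  have "wp n (tie 2 3) (wp n mid Q) ?s"
  proof (rule wp_tie[where u = "inv x v" and v = "inv y v" and S = S])
    show "labels S ?s" by (rule labels_cong[OF s(2)]) simp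
    fix r assume r: "labels (join (inv x v) (inv y v) S) r"
      "\<And>c j. c \<noteq> 4 \<Longrightarrow> r (Arr c j) = ?s (Arr c j)" "\<And>q. q \<noteq> 6 \<Longrightarrow> q \<noteq> 7 \<Longrightarrow> r (Reg q) = ?s (Reg q)"
    show "wp n mid Q r" by (rule mid) (use r s prepared_cong[OF s(1)] in \<open>simp_all add: S1_def\<close>)
  qed (use xb yb in simp_all)
  then show ?thesis
    unfolding apply_ties_def mid_def last_def using s v a by simp
qed

text \<open>Taking equality with the label of the seed for \<open>f\<close> turns any labelling into
  one that holds at the seed.\<close>

lemma respects_ties_comp:
  assumes "respects_ties n x y b"
  shows "respects_ties n x y (\<lambda>w. f (b w))"
  using assms unfolding respects_ties_def
  by (intro conjI ballI allI impI arg_cong[where f = f]) blast+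

text \<open>Expresses without paths that \<open>S\<close> stays inside the component of
  \<open>u\<close> under the ties. Once \<open>S\<close> itself respects the ties, it is that
  component.\<close>

definition generated :: "nat \<Rightarrow> (nat \<Rightarrow> nat) \<Rightarrow> (nat \<Rightarrow> nat) \<Rightarrow> nat \<Rightarrow> nat set \<Rightarrow> bool" where
  "generated n x y u S \<longleftrightarrow> u \<in> S \<and> S \<subseteq> {1..n} \<and>
     (\<forall>b. respects_ties n x y b \<longrightarrow> b u \<longrightarrow> (\<forall>v\<in>S. b v))"

definition spread_once :: com where
  "spread_once = Loop 0 apply_ties"

text \<open>Within a round the set only grows. If it ends as \<open>S\<close>, it was
  \<open>S\<close> at every city visited, so a round without change certifies that \<open>S\<close>
  is closed under all ties.\<close>

lemma wp_spread_once:
  assumes x: "psb n x" and y: "psb n y" and s: "prepared n x y s" "labels S s" "generated n x y u S"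
    and Q: "\<And>t S'. prepared n x y t \<Longrightarrow> labels S' t \<Longrightarrow> generated n x y u S' \<Longrightarrow> S \<subseteq> S' \<Longrightarrow>
       (S' = S \<Longrightarrow> respects_ties n x y (\<lambda>v. v \<in> S)) \<Longrightarrow> Q t"
  shows "wp n spread_once Q s"
proof -
  define J where "J k s \<longleftrightarrow> prepared n x y s \<and> (\<exists>S'. labels S' s \<and> generated n x y u S' \<and> S \<subseteq> S' \<and>
     (S' = S \<longrightarrow> (\<forall>v. k < v \<longrightarrow> v \<le> n \<longrightarrow> ties_at n x y v (\<lambda>v. v \<in> S))))" for k and s :: "loc \<Rightarrow> int"
  show ?thesis
    unfolding spread_once_def
  proof (rule wp_LoopI[where J = J])
    show "J n s" using s by (auto simp: J_def)
  next
    fix k t assume k: "k < n" and J: "J (Suc k) t"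
    then obtain S' where S': "prepared n x y t" "labels S' t" "generated n x y u S'" "S \<subseteq> S'"
      "S' = S \<longrightarrow> (\<forall>v. Suc k < v \<longrightarrow> v \<le> n \<longrightarrow> ties_at n x y v (\<lambda>v. v \<in> S))"
      unfolding J_def by blast
    let ?t = "t(Reg 0 := int (Suc k))"
    have v: "1 \<le> Suc k" "Suc k \<le> n" using k by auto
    show "wp n apply_ties (J k) ?t"
    proof (rule wp_apply_ties[OF x y _ _ _ v])
      show "prepared n x y ?t" by (rule prepared_cong[OF S'(1)]) simp
      show "labels S' ?t" by (rule labels_cong[OF S'(2)]) simp
      show "?t (Reg 0) = int (Suc k)" by simp
    next
      fix r assume r: "prepared n x y r" "labels (tie_step n x y (Suc k) S') r"
      let ?S = "tie_step n x y (Suc k) S'"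
      have sup: "S' \<subseteq> ?S" by (rule tie_step_superset)
      have "generated n x y u ?S"
        unfolding generated_def
      proof (intro conjI allI impI)
        show "u \<in> ?S" using S'(3) sup by (auto simp: generated_def)
        show "?S \<subseteq> {1..n}" using tie_step_range[OF x y _ v] S'(3) by (simp add: generated_def)
        fix b assume b: "respects_ties n x y b" "b u"
        show "\<forall>v\<in>?S. b v"
        proof (rule tie_step_least)
          show "ties_at n x y (Suc k) b" using b(1) k by (simp add: respects_ties_iff)
          show "\<forall>v\<in>S'. b v" using S'(3) b unfolding generated_def by blast
        qed
      qed
      moreover have "ties_at n x y w (\<lambda>v. v \<in> S)" if "?S = S" "k < w" "w \<le> n" for w
      proof -
        have eq: "S' = S" using that(1) sup S'(4) by blast
        show ?thesis
        proof (cases "w = Suc k")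
          case True
          show ?thesis using tie_step_fixed[of n x y "Suc k" S] that(1) eq True by simp
        next
          case False
          then show ?thesis using S'(5) eq that by simp
        qed
      qed
      ultimately show "J k r" using r sup S'(4) unfolding J_def by blast
    qed
  next
    fix t assume J: "J 0 t"
    then obtain S' where S': "prepared n x y t" "labels S' t" "generated n x y u S'" "S \<subseteq> S'"
      "S' = S \<longrightarrow> (\<forall>v. 0 < v \<longrightarrow> v \<le> n \<longrightarrow> ties_at n x y v (\<lambda>v. v \<in> S))"
      unfolding J_def by blast
    show "Q (t(Reg 0 := 0))"
    proof (rule Q)
      show "prepared n x y (t(Reg 0 := 0))" by (rule prepared_cong[OF S'(1)]) simp
      show "labels S' (t(Reg 0 := 0))" by (rule labels_cong[OF S'(2)]) simp
      show "respects_ties n x y (\<lambda>v. v \<in> S)" if "S' = S"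
        using S'(5) that by (simp add: respects_ties_iff)
    qed (use S' in auto)
  qed
qed

definition spread :: com where
  "spread = Loop 1 spread_once"

lemma wp_spread:
  assumes x: "psb n x" and y: "psb n y" and u: "1 \<le> u" "u \<le> n"
    and s: "prepared n x y s" "labels {u} s"
    and Q: "\<And>t S. prepared n x y t \<Longrightarrow> labels S t \<Longrightarrow> generated n x y u S \<Longrightarrow>
       respects_ties n x y (\<lambda>v. v \<in> S) \<Longrightarrow> Q t"
  shows "wp n spread Q s"
proof -
  \<comment> \<open>With \<open>k\<close> rounds left, either the set is closed or it has more than
    \<open>n - k\<close> cities, since a round that starts from a set that is not closed adds a
    city. After \<open>n\<close> rounds the second alternative is impossible.\<close>
  define J where "J k s \<longleftrightarrow> prepared n x y s \<and> (\<exists>S. labels S s \<and> generated n x y u S \<and>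
     (respects_ties n x y (\<lambda>v. v \<in> S) \<or> n < card S + k))" for k and s :: "loc \<Rightarrow> int"
  show ?thesis
    unfolding spread_def
  proof (rule wp_LoopI[where J = J])
    have "generated n x y u {u}" using u by (simp add: generated_def)
    then show "J n s" using s unfolding J_def by (intro conjI exI[of _ "{u}"]) auto
  next
    fix k t assume k: "k < n" and J: "J (Suc k) t"
    then obtain S where S: "prepared n x y t" "labels S t" "generated n x y u S"
      "respects_ties n x y (\<lambda>v. v \<in> S) \<or> n < card S + Suc k"
      unfolding J_def by blast
    let ?t = "t(Reg 1 := int (Suc k))"
    show "wp n spread_once (J k) ?t"
    proof (rule wp_spread_once[OF x y _ _ S(3)])
      show "prepared n x y ?t" by (rule prepared_cong[OF S(1)]) simp
      show "labels S ?t" by (rule labels_cong[OF S(2)]) simp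
      fix r S' assume r: "prepared n x y r" "labels S' r" "generated n x y u S'" "S \<subseteq> S'"
        "S' = S \<Longrightarrow> respects_ties n x y (\<lambda>v. v \<in> S)"
      have "respects_ties n x y (\<lambda>v. v \<in> S') \<or> n < card S' + k"
      proof (cases "S' = S")
        case True
        then show ?thesis using r(5) by simp
      next
        case ne: False
        show ?thesis
        proof (cases "respects_ties n x y (\<lambda>v. v \<in> S)")
          case True
          then have "S' \<subseteq> S" using r(3) S(3) unfolding generated_def by blast
          then show ?thesis using ne r(4) by blast
        next
          case False
          have "finite S'" using r(3) finite_subset by (auto simp: generated_def)
          then have "card S < card S'" using r(4) ne by (simp add: psubset_card_mono psubset_eq)
          then show ?thesis using S(4) False by simp
        qed
      qed
      then show "J k r" using r unfolding J_def by blast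
    qed
  next
    fix t assume "J 0 t"
    then obtain S where S: "prepared n x y t" "labels S t" "generated n x y u S"
      "respects_ties n x y (\<lambda>v. v \<in> S) \<or> n < card S"
      unfolding J_def by auto
    have "card S \<le> card {1..n}" by (rule card_mono) (use S(3) in \<open>auto simp: generated_def\<close>)
    then have "respects_ties n x y (\<lambda>v. v \<in> S)" using S(4) by simp
    then show "Q (t(Reg 1 := 0))"
      by (intro Q[OF _ _ S(3)] prepared_cong[OF S(1)] labels_cong[OF S(2)]) simp_all
  qed
qed

section \<open>Verdict, program and running time\<close>

definition check_labels :: com where
  "check_labels = Op (SetC 9 1) ;;
     Loop 0 (Op (Get 2 0 0) ;; Op (Size 3) ;; Op (Plus 3 3 0) ;; Op (Get 4 0 3) ;; Op (Minus 2 2 4) ;;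
       IfZ 2 (Op (SetC 2 0)) (Op (Get 5 4 0) ;; IfZ 5 (Op (SetC 9 0)) (Op (SetC 2 0))))"

lemma wp_check_labels:
  assumes s: "prepared n x y s" "labels S s"
    and Q: "\<And>t. t (Reg 9) = of_bool (\<forall>j. 1 \<le> j \<longrightarrow> j \<le> n \<longrightarrow> x j \<noteq> y j \<longrightarrow> j \<in> S) \<Longrightarrow> Q t"
  shows "wp n check_labels Q s"
proof -
  define J where "J k s \<longleftrightarrow> prepared n x y s \<and> labels S s \<and>
     s (Reg 9) = of_bool (\<forall>j. k < j \<longrightarrow> j \<le> n \<longrightarrow> x j \<noteq> y j \<longrightarrow> j \<in> S)" for k and s :: "loc \<Rightarrow> int"
  show ?thesis
    unfolding check_labels_def wp.simps(1,2)
  proof (intro conjI, simp, rule wp_LoopI[where J = J])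
    show "J n (op_post n (SetC 9 1) s)"
      using prepared_cong[OF s(1), of "s(Reg 9 := 1)"] labels_cong[OF s(2), of "s(Reg 9 := 1)"]
      by (simp add: J_def)
  next
    fix k t assume k: "k < n" and J: "J (Suc k) t"
    define i where "i = Suc k"
    define ok where "ok \<longleftrightarrow> (\<forall>j. i < j \<longrightarrow> j \<le> n \<longrightarrow> x j \<noteq> y j \<longrightarrow> j \<in> S)"
    have i: "1 \<le> i" "i \<le> n" using k by (auto simp: i_def)
    have ni: "nat (int n + int i) = n + i" by simp
    have P: "prepared n x y t" and L: "labels S t" and ok9: "t (Reg 9) = of_bool ok"
      using J by (simp_all add: J_def ok_def i_def)
    have a: "t (Arr 0 i) = int (x i)" "t (Arr 0 (n + i)) = int (y i)" "t (Arr 4 i) = of_bool (i \<in> S)"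
      using preparedD[OF P i] L i by (simp_all add: labels_def)
    have "(\<forall>j. k < j \<longrightarrow> j \<le> n \<longrightarrow> x j \<noteq> y j \<longrightarrow> j \<in> S) \<longleftrightarrow> ok \<and> (x i = y i \<or> i \<in> S)"
    proof -
      have kj: "k < j \<longleftrightarrow> j = i \<or> i < j" for j by (auto simp: i_def)
      show ?thesis unfolding ok_def kj imp_disjL all_conj_distrib using i(2) by auto
    qed
    then have fin: "J k v" if "\<And>c j. v (Arr c j) = t (Arr c j)" "v (Reg 9) = of_bool (ok \<and> (x i = y i \<or> i \<in> S))" for v
      using prepared_cong[OF P, of v] labels_cong[OF L, of v] that by (simp add: J_def)
    show "wp n (Op (Get 2 0 0) ;; Op (Size 3) ;; Op (Plus 3 3 0) ;; Op (Get 4 0 3) ;; Op (Minus 2 2 4) ;;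
       IfZ 2 (Op (SetC 2 0)) (Op (Get 5 4 0) ;; IfZ 5 (Op (SetC 9 0)) (Op (SetC 2 0)))) (J k) (t(Reg 0 := int (Suc k)))"
      unfolding i_def[symmetric]
    proof (cases "x i = y i")
      case True
      show "wp n (Op (Get 2 0 0) ;; Op (Size 3) ;; Op (Plus 3 3 0) ;; Op (Get 4 0 3) ;; Op (Minus 2 2 4) ;;
       IfZ 2 (Op (SetC 2 0)) (Op (Get 5 4 0) ;; IfZ 5 (Op (SetC 9 0)) (Op (SetC 2 0)))) (J k) (t(Reg 0 := int i))"
        using True i a by (simp add: ni) (rule fin; simp add: ok9)
    next
      case False
      show "wp n (Op (Get 2 0 0) ;; Op (Size 3) ;; Op (Plus 3 3 0) ;; Op (Get 4 0 3) ;; Op (Minus 2 2 4) ;;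
       IfZ 2 (Op (SetC 2 0)) (Op (Get 5 4 0) ;; IfZ 5 (Op (SetC 9 0)) (Op (SetC 2 0)))) (J k) (t(Reg 0 := int i))"
      proof (cases "i \<in> S")
        case True
        then show ?thesis using False i a by (simp add: ni) (rule fin; simp add: ok9)
      next
        case nS: False
        then show ?thesis using False i a by (simp add: ni) (rule fin; simp)
      qed
    qed
  next
    fix t assume "J 0 t"
    then show "Q (t(Reg 0 := 0))" by (intro Q) (simp add: J_def Suc_le_eq)
  qed
qed

definition decide :: com where
  "decide = copy_input ;; invert ;; find_locks ;; find_seed ;;
     IfZ 1 (Op (SetC 9 0)) (Op (SetC 9 1) ;; Op (Put 4 1 9) ;; spread ;; check_labels)"

lemma wp_decide:
  assumes n: "3 \<le> n" and x: "psb n x" and y: "psb n y" and s: "initial_state n (input_mem n x y) s"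
  shows "wp n decide (\<lambda>t. t (Reg 9) =
    of_bool (adjacent_vertices (PSB n) (charvec n x) (charvec n y))) s"
    (is "wp n decide ?Q s")
  unfolding decide_def wp.simps(2)
proof (rule wp_copy_input[OF n s], rule wp_invert[OF x y], assumption)
  fix t assume "inputs n x y t" "inverses n x y t" "zeros 3 t" "zeros 4 t" "zeros 5 t"
  then show "wp n find_locks (wp n find_seed
      (wp n (IfZ 1 (Op (SetC 9 0)) (Op (SetC 9 1) ;; Op (Put 4 1 9) ;; spread ;; check_labels)) ?Q)) t"
  proof (intro wp_find_locks[OF x y])
    fix t assume t: "inputs n x y t" "inverses n x y t" "locks n x y t" "zeros 4 t"
    show "wp n find_seed
      (wp n (IfZ 1 (Op (SetC 9 0)) (Op (SetC 9 1) ;; Op (Put 4 1 9) ;; spread ;; check_labels)) ?Q) t"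
    proof (rule wp_find_seed)
      show "prepared n x y t" "zeros 4 t" using t by (auto simp: prepared_def)
      fix r u assume r: "prepared n x y r" "zeros 4 r" "r (Reg 1) = int u"
        "u = 0 \<Longrightarrow> \<forall>j. 1 \<le> j \<longrightarrow> j \<le> n \<longrightarrow> x j = y j" "u \<noteq> 0 \<Longrightarrow> u \<le> n \<and> x u \<noteq> y u"
      show "wp n (IfZ 1 (Op (SetC 9 0)) (Op (SetC 9 1) ;; Op (Put 4 1 9) ;; spread ;; check_labels)) ?Q r"
      proof (cases "u = 0")
        case True
        have "x = y" using r(4)[OF True] psb_differ_range[OF x y] by (metis ext)
        then have "\<not> adjacent_vertices (PSB n) (charvec n x) (charvec n y)" by (simp add: adjacent_vertices_def)
        then show ?thesis using r(3) True by simp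
      next
        case False
        have u: "1 \<le> u" "u \<le> n" "x u \<noteq> y u" using False r(5) by auto
        let ?r = "r(Reg 9 := 1, Arr 4 u := 1)"
        have "wp n spread (wp n check_labels ?Q) ?r"
        proof (rule wp_spread[OF x y u(1,2)])
          show "prepared n x y ?r" by (rule prepared_cong[OF r(1)]) simp
          show "labels {u} ?r" using r(2) by (auto simp: labels_def zeros_def)
          fix v S assume v: "prepared n x y v" "labels S v" "generated n x y u S"
            "respects_ties n x y (\<lambda>v. v \<in> S)"
          have uS: "u \<in> S" using v(3) by (simp add: generated_def)
          have "adjacent_vertices (PSB n) (charvec n x) (charvec n y) \<longleftrightarrow>
              (\<forall>j. 1 \<le> j \<longrightarrow> j \<le> n \<longrightarrow> x j \<noteq> y j \<longrightarrow> j \<in> S)" (is "?adj \<longleftrightarrow> ?all")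
          proof
            assume ?adj
            \<comment> \<open>The adjacency criterion is applied to membership in \<open>S\<close>
              as the labelling.\<close>
            then have "j \<in> S" if "x j \<noteq> y j" for j
              using adjacent_vertices_iff[OF n x y] v(4) u(3) uS that by blast
            then show ?all by blast
          next
            assume all: ?all
            have "b j = b u" if b: "respects_ties n x y b" and j: "x j \<noteq> y j" for b j
            proof -
              have "j \<in> S" using all j psb_differ_range[OF x y j] by blast
              moreover have "respects_ties n x y (\<lambda>w. b w = b u)"
                by (rule respects_ties_comp[OF b])
              ultimately show ?thesis using v(3) unfolding generated_def by blast
            qed
            then show ?adj using adjacent_vertices_iff[OF n x y] u(3) by metis
          qed
          then show "wp n check_labels ?Q v" by (intro wp_check_labels[OF v(1,2)]) simp
        qed
        then show ?thesis using r(3) u by simp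
      qed
    qed
  qed auto
qed auto

text \<open>Register 9 is cell 15; adding the zero of cell 2 copies the verdict to cell 0, which has
  held \<open>n\<close> until then.\<close>

definition program :: "instr list" where
  "program = startup @ comp_com (length startup) decide @ [Add 0 15 2, Halt]"

text \<open>The two nested loops of \<open>spread\<close>, with a body of bounded cost, dominate.
  The constant exceeds the sum of all coefficients once the lower powers of \<open>n\<close> are
  bounded by the cube.\<close>

lemma cost_decide:
  assumes "1 \<le> n"
  shows "cost n decide \<le> 2000 * n ^ 3"
proof -
  have "n \<le> n ^ 3" "n ^ 2 \<le> n ^ 3" "1 \<le> n ^ 3"
    using power_increasing[of 1 3 n] power_increasing[of 2 3 n] assms by simp_all
  moreover have "n * n = n ^ 2" by (simp add: power2_eq_square)
  ultimately show ?thesis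
    by (simp add: decide_def copy_input_def invert_def find_locks_def find_side_def lock_verdict_def
        store_lock_def find_seed_def spread_def spread_once_def apply_ties_def tie_def check_labels_def
        algebra_simps)
qed

lemma decides_within_program:
  assumes n: "3 \<le> n" and x: "psb n x" and y: "psb n y"
  shows "decides_within program (3000 * n ^ 3) (input_mem n x y)
    (adjacent_vertices (PSB n) (charvec n x) (charvec n y))"
proof -
  let ?m = "input_mem n x y" and ?b = "length startup" and ?d = "comp_com (length startup) decide"
  have x1: "1 \<le> x 1" "x 1 \<le> n" using psb_bounds[OF x, of 1] n by auto
  obtain s where s: "rep n s (fold effect startup ?m)" "initial_state n ?m s"
    by (rule startup_effect[OF n, of ?m "x 1"]) (use n x1 in \<open>auto simp: input_mem_def\<close>)
  have code: "code_at program 0 startup" "code_at program ?b ?d"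
    "code_at program (?b + length ?d) [Add 0 15 2, Halt]"
    using code_at_self[of "[]" startup] code_at_self[of startup ?d "[Add 0 15 2, Halt]"]
      code_at_self[of "startup @ ?d" "[Add 0 15 2, Halt]" "[]"] by (simp_all add: program_def)
  have "list_all straight startup"
    by (simp add: startup_def prologue_def save_cells_def list_all_iff)
  then have 1: "reach program ?b (0, ?m) (?b, fold effect startup ?m)"
    using reach_straight[OF code(1)] by simp
  have n1: "1 \<le> n" using n by simp
  have "com_ok decide"
    by (simp add: decide_def copy_input_def invert_def find_locks_def find_side_def lock_verdict_def
        store_lock_def find_seed_def spread_def spread_once_def apply_ties_def tie_def check_labels_def)
  from wp_sound[OF n1 this code(2) s(1) wp_decide[OF n x y s(2)]] obtain t s' m'
    where 2: "t \<le> cost n decide" "reach program t (?b, fold effect startup ?m) (?b + length ?d, m')"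
      "rep n s' m'" "s' (Reg 9) = of_bool (adjacent_vertices (PSB n) (charvec n x) (charvec n y))"
    by blast
  have 3: "reach program 1 (?b + length ?d, m') (Suc (?b + length ?d), m'(0 := m' 15 + m' 2))"
    using reach_step[of "?b + length ?d" program "Add 0 15 2" m'] code(3) by simp
  have out: "m' 15 + m' 2 = s' (Reg 9)" using repD(3)[OF 2(3)] repD(5)[OF 2(3), of 9] by simp
  have "reach program (?b + t + 1) (0, ?m) (Suc (?b + length ?d), m'(0 := s' (Reg 9)))"
    using reach_trans[OF reach_trans[OF 1 2(2)] 3] out by simp
  moreover have "halted program (Suc (?b + length ?d), m'(0 := s' (Reg 9)))"
    using code(3) by (simp add: halted_def)
  moreover have "?b + t + 1 \<le> 3000 * n ^ 3"
  proof -
    \<comment> \<open>20 instructions of the prologue, 26 for the 13 saved cells and 4 for the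
      constants; the gap between 2000 and 3000 absorbs them and the final copy.\<close>
    have "?b = 50" by (simp add: startup_def prologue_def save_cells_def)
    moreover have "1 \<le> n ^ 3" using n1 by simp
    ultimately show ?thesis using 2(1) cost_decide[OF n1] by linarith
  qed
  ultimately show ?thesis
    unfolding decides_within_def reach_def using 2(4) by (intro exI[of _ "?b + t + 1"]) auto
qed

theorem theorem3:
  "\<exists>(P :: instr list) (c :: nat). \<forall>n \<ge> 3. \<forall>x \<in> PSBT n. \<forall>y \<in> PSBT n.
     decides_within P (c * n ^ 3) (input_mem n x y)
       (adjacent_vertices (PSB n) (charvec n x) (charvec n y))"
  using decides_within_program PSBT_iff_psb by (intro exI[of _ program] exI[of _ 3000]) simp

end
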